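(* Let $W$ be a finite Coxeter group of type $A_n$ ($n\ge 2$), $B_n$ ($n\ge 2$), $D_n$ ($n\ge 4$), $I_2(m)$ ($m\ge 3$) or $H_3$, and let $o$ be the following $W$-orbit: in type $A_n$, $o=\{e_1,\dots,e_{n+1}\}$; in types $B_n$ and $D_n$, $o=\{\pm e_1,\dots,\pm e_n\}$; in type $I_2(m)$, an orbit consisting of the vertices of a regular $m$-gon; in type $H_3$, the orbit consisting of the 12 vertices of a regular icosahedron. Two distinct almost positive roots, represented by collections $C_1$ and $C_2$ of line segments (their diagrams constructed from $o$), are compatible if and only if both of the following conditions hold: (1) No segment in $C_1$ crosses any segment in $C_2$, unless the two segments coincide (as unlabeled segments). (2) If two segments, one from $C_1$ and one from $C_2$, involve the same origin point, then either both segments are contained in a common line or the union of the two segments does not cross the gray zone.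
   Context: Setting. $(W,S)$ is a finite irreducible Coxeter system of rank $n$, represented as a real reflection group on a Euclidean space $V$ so that only the origin is fixed by $W$. Type $A_n$ is $S_{n+1}$ permuting coordinates of $\mathbb{R}^{n+1}$ modulo the line spanned by $(1,\dots,1)$ (equivalently, project orthogonally to the sum-zero hyperplane); type $B_n$ is the group of signed permutations on $\mathbb{R}^n$; type $D_n$ is its subgroup of even-signed permutations, with simple reflections $s_i$ transposing $e_i,e_{i+1}$ for $i\le n-1$ and $s_n$ transposing $e_{n-1}$ and $-e_n$; type $I_2(m)$ is the dihedral group of order $2m$; type $H_3$ is the symmetry group of the regular icosahedron. $\Phi$ is a root system for $W$ (a $W$-stable set with exactly two opposite roots normal to each reflecting hyperplane) with simple roots $\alpha_s$ ($s\in S$) and positive roots $\Phi^+$. The almost positive roots are $\Phi_{\ge-1}=\Phi^+\cup\{-\alpha_s:s\in S\}$. $S=S_+\sqcup S_-$ is a bipartition of the Coxeter diagram, $c_\pm=\prod_{s\in S_\pm}s$, $c=c_-c_+$, and $h$ is the order of $c$. Compatibility. For $\varepsilon\in\{+,-\}$ define the involution $\tau_\varepsilon$ on $\Phi_{\ge-1}$ by $\tau_\varepsilon(\alpha)=\alpha$ if $\alpha=-\alpha_s$ with $s\in S_{-\varepsilon}$, and $\tau_\varepsilon(\alpha)=c_\varepsilon(\alpha)$ otherwise. Compatibility is the unique $\langle\tau_+,\tau_-\rangle$-invariant binary relation on $\Phi_{\ge-1}$ such that for every $s\in S$, $\beta$ is compatible with $-\alpha_s$ iff $\alpha_s$ has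 coefficient $0$ in the simple root expansion of $\beta$. Every $\langle\tau_+,\tau_-\rangle$-orbit in $\Phi_{\ge -1}$ contains a negative simple root. Coxeter plane. Let $(c_s)_{s\in S}$ be a positive eigenvector, for the smallest eigenvalue, of the Gram matrix of the unit simple roots $\alpha_s/|\alpha_s|$, and $(\omega_s)$ the basis dual to the unit simple roots. The Coxeter plane is $P=\mathrm{span}(\lambda,\mu)$, $\lambda=\sum_{s\in S_+}c_s\omega_s$, $\mu=\sum_{s\in S_-}c_s\omega_s$; the angle between $\lambda$ and $\mu$ is $\pi/h$. Use polar coordinates on $P$ with $\lambda$ at angle $0$ and $\mu$ at angle $\pi/h$. Diagrams of almost positive roots. In the types considered here, the elements of $o$ that do not project orthogonally to the origin of $P$ project to the vertices of a regular $h$-gon centered at the origin, each vertex having angle $k\pi/h$ for an integer $1\le k\le 2h$. In types $D_n$ and $H_3$ two elements of $o$ project to the origin; they are called origin points and are kept distinguishable (labeled by the corresponding element of $o$). The $h$-gon is enlarged to a regular $(h+2)$-gon with the same distance of vertices to the origin, by subdividing each of the two edges perpendicular to $\mathbb{R}\lambda$ or $\mathbb{R}\mu$ by a new vertex and then making the polygon regular. Explicitly, $x\in o$ with projection at radius $r>0$ and angle $k\pi/h$ is sent to the point $\hat x$ at radius $r$ and angle $(k+2)\pi/(h+2)$ if $1\le k\le h$, and $(k+4)\pi/(h+2)$ if $h+1\le k\le 2h$; the $(h+2)$-gon is the regular $(h+2)$-gon centered at the origin whose vertices include all these $\hat x$. If $x$ projects to the origin, $\hat x$ is the origin labeled by $x$.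 The diagram of $-\alpha_s$ is the collection of (labeled) line segments $\hat x\,\widehat{sx}$ over all $x\in o$ with $sx\ne x$. Let $L'_+$ and $L'_-$ be the lines through the origin at angles $\pi/(h+2)$ and $2\pi/(h+2)$; reflection in $L'_\varepsilon$ preserves the (unlabeled) diagrams of $-\alpha_s$ for $s\in S_{-\varepsilon}$. Let $\tau_\varepsilon$ act on labeled segments $AB$ as follows: if neither endpoint is at the origin, reflect both endpoints in $L'_\varepsilon$; if $A$ is an origin point and $AB$ is not perpendicular to $L'_\varepsilon$, reflect $B$ in $L'_\varepsilon$ and replace the label $x$ of $A$ by $c_\varepsilon x$; if $A$ is an origin point and $AB$ is perpendicular to $L'_\varepsilon$, fix $AB$. The diagrams of all almost positive roots are uniquely determined by requiring that the diagram of $\tau_\varepsilon(\beta)$ be the image under $\tau_\varepsilon$ of the diagram of $\beta$. Two segments cross if they intersect in a point of the relative interior of both (ignoring labels). Two segments involve the same origin point if each has an endpoint at the origin and these endpoints carry the same label. The gray zone is the union of the two opposite acute wedges bounded by the line through the origin perpendicular to $L'_+$ and the line through the origin perpendicular to $L'_-$; its complement (taking the gray zone open) consists of two closed obtuse wedges, and no vertex of the $(h+2)$-gon lies in the open gray zone. The union of two segments with an endpoint at the origin crosses the gray zone if their non-origin endpoints lie in different closed obtuse wedges. *)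

theory Defs
  imports "HOL-Analysis.Analysis"
begin

section \<open>Reflection groups, root systems and simple roots\<close>

definition refl :: "'a::real_inner \<Rightarrow> 'a \<Rightarrow> 'a" where
  "refl v x = x - (2 * (v \<bullet> x) / (v \<bullet> v)) *\<^sub>R v"

text \<open>
  A root system for \<open>W\<close>: a \<open>W\<close>-stable set of normals to the reflecting hyperplanes of \<open>W\<close>,
  with exactly two opposite elements for each hyperplane. It need not be crystallographic.
\<close>

definition root_system_for :: "('a::real_inner \<Rightarrow> 'a) set \<Rightarrow> 'a set \<Rightarrow> bool" where
  "root_system_for W \<Phi> \<longleftrightarrow>
     (\<forall>w\<in>W. w ` \<Phi> \<subseteq> \<Phi>) \<and>
     (\<forall>\<beta>\<in>\<Phi>. \<beta> \<noteq> 0 \<and> refl \<beta> \<in> W) \<and>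
     (\<forall>v. v \<noteq> 0 \<and> refl v \<in> W \<longrightarrow> (\<exists>\<beta>. \<Phi> \<inter> span {v} = {\<beta>, - \<beta>}))"

text \<open>
  Throughout, a simple reflection \<open>s\<close> is represented by its simple root: \<open>S = refl ` \<Delta>\<close>, and
  every family indexed by \<open>S\<close> is a function on the simple roots \<open>\<Delta>\<close>.
\<close>

definition simple_roots :: "'a::real_vector set \<Rightarrow> 'a set \<Rightarrow> bool" where
  "simple_roots \<Phi> \<Delta> \<longleftrightarrow>
     \<Delta> \<subseteq> \<Phi> \<and> independent \<Delta> \<and> span \<Delta> = UNIV \<and>
     (\<forall>\<beta>\<in>\<Phi>. (\<forall>\<alpha>\<in>\<Delta>. representation \<Delta> \<beta> \<alpha> \<ge> 0) \<or> (\<forall>\<alpha>\<in>\<Delta>. representation \<Delta> \<beta> \<alpha> \<le> 0))"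

definition positive_roots :: "'a::real_vector set \<Rightarrow> 'a set \<Rightarrow> 'a set" where
  "positive_roots \<Phi> \<Delta> = {\<beta> \<in> \<Phi>. \<forall>\<alpha>\<in>\<Delta>. representation \<Delta> \<beta> \<alpha> \<ge> 0}"

definition almost_positive_roots :: "'a::real_vector set \<Rightarrow> 'a set \<Rightarrow> 'a set" where
  "almost_positive_roots \<Phi> \<Delta> = positive_roots \<Phi> \<Delta> \<union> uminus ` \<Delta>"


section \<open>The groups and orbits under consideration\<close>

definition orthonormal_frame :: "nat \<Rightarrow> (nat \<Rightarrow> 'a::real_inner) \<Rightarrow> bool" where
  "orthonormal_frame n e \<longleftrightarrow>
     (\<forall>i\<in>{1..n}. \<forall>j\<in>{1..n}. e i \<bullet> e j = (if i = j then 1 else 0))"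

text \<open>
  Type \<open>A\<^sub>n\<close>: \<open>e 1, \<dots>, e (n + 1)\<close> are the orthogonal projections to the sum-zero hyperplane of the
  standard basis of \<open>\<real>\<^sup>n\<^sup>+\<^sup>1\<close>. They are determined up to isometry by their Gram matrix, since
  \<open>(E\<^sub>i - \<Sum>\<^sub>k E\<^sub>k / (n + 1)) \<bullet> (E\<^sub>j - \<Sum>\<^sub>k E\<^sub>k / (n + 1)) = E\<^sub>i \<bullet> E\<^sub>j - 1 / (n + 1)\<close>.
\<close>

definition type_A :: "nat \<Rightarrow> ('a::euclidean_space \<Rightarrow> 'a) set \<Rightarrow> 'a set \<Rightarrow> bool" where
  "type_A n W Orb \<longleftrightarrow> DIM('a) = n \<and>
     (\<exists>e. (\<forall>i\<in>{1..n+1}. \<forall>j\<in>{1..n+1}.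
             e i \<bullet> e j = (if i = j then 1 else 0) - 1 / (real n + 1)) \<and>
          W = {f. linear f \<and> (\<exists>\<pi>. \<pi> permutes {1..n+1} \<and> (\<forall>i\<in>{1..n+1}. f (e i) = e (\<pi> i)))} \<and>
          Orb = e ` {1..n+1})"

definition signed_perm_via ::
    "nat \<Rightarrow> (nat \<Rightarrow> 'a::real_vector) \<Rightarrow> (nat \<Rightarrow> nat) \<Rightarrow> (nat \<Rightarrow> real) \<Rightarrow> ('a \<Rightarrow> 'a) \<Rightarrow> bool" where
  "signed_perm_via n e \<pi> \<sigma> f \<longleftrightarrow> linear f \<and> \<pi> permutes {1..n} \<and>
     (\<forall>i\<in>{1..n}. \<sigma> i \<in> {1, -1} \<and> f (e i) = \<sigma> i *\<^sub>R e (\<pi> i))"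

definition type_B :: "nat \<Rightarrow> ('a::euclidean_space \<Rightarrow> 'a) set \<Rightarrow> 'a set \<Rightarrow> bool" where
  "type_B n W Orb \<longleftrightarrow> DIM('a) = n \<and>
     (\<exists>e. orthonormal_frame n e \<and>
          W = {f. \<exists>\<pi> \<sigma>. signed_perm_via n e \<pi> \<sigma> f} \<and>
          Orb = e ` {1..n} \<union> uminus ` e ` {1..n})"

definition type_D :: "nat \<Rightarrow> ('a::euclidean_space \<Rightarrow> 'a) set \<Rightarrow> 'a set \<Rightarrow> bool" where
  "type_D n W Orb \<longleftrightarrow> DIM('a) = n \<and>
     (\<exists>e. orthonormal_frame n e \<and>
          W = {f. \<exists>\<pi> \<sigma>. signed_perm_via n e \<pi> \<sigma> f \<and> even (card {i\<in>{1..n}. \<sigma> i = -1})} \<and>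
          Orb = e ` {1..n} \<union> uminus ` e ` {1..n})"

definition symmetry_group :: "'a::real_inner set \<Rightarrow> ('a \<Rightarrow> 'a) set" where
  "symmetry_group X = {f. orthogonal_transformation f \<and> f ` X = X}"

definition regular_polygon_vertices :: "nat \<Rightarrow> 'a::real_inner set \<Rightarrow> bool" where
  "regular_polygon_vertices m X \<longleftrightarrow>
     (\<exists>e r. orthonormal_frame 2 e \<and> r > 0 \<and>
        X = (\<lambda>k. r *\<^sub>R (cos (2 * pi * real k / real m) *\<^sub>R e 1 +
                        sin (2 * pi * real k / real m) *\<^sub>R e 2)) ` {..<m})"

definition regular_icosahedron_vertices :: "'a::real_inner set \<Rightarrow> bool" where
  "regular_icosahedron_vertices X \<longleftrightarrow>
     (\<exists>e r. orthonormal_frame 3 e \<and> r > 0 \<and>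
        X = (\<Union>a\<in>{1, -1}. \<Union>b\<in>{(1 + sqrt 5) / 2, - ((1 + sqrt 5) / 2)}.
               {r *\<^sub>R (a *\<^sub>R e 1 + b *\<^sub>R e 2), r *\<^sub>R (a *\<^sub>R e 2 + b *\<^sub>R e 3),
                r *\<^sub>R (a *\<^sub>R e 3 + b *\<^sub>R e 1)}))"

text \<open>The dihedral group of order \<open>2m\<close>, given as the symmetry group of the orbit.\<close>

definition type_I2 :: "nat \<Rightarrow> ('a::euclidean_space \<Rightarrow> 'a) set \<Rightarrow> 'a set \<Rightarrow> bool" where
  "type_I2 m W Orb \<longleftrightarrow> DIM('a) = 2 \<and> regular_polygon_vertices m Orb \<and> W = symmetry_group Orb"

definition type_H3 :: "('a::euclidean_space \<Rightarrow> 'a) set \<Rightarrow> 'a set \<Rightarrow> bool" where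
  "type_H3 W Orb \<longleftrightarrow> DIM('a) = 3 \<and> regular_icosahedron_vertices Orb \<and> W = symmetry_group Orb"


section \<open>Bipartite Coxeter elements and compatibility\<close>

datatype pm = Pls | Mns

fun opp :: "pm \<Rightarrow> pm" where
  "opp Pls = Mns"
| "opp Mns = Pls"

text \<open>
  \<open>D Pls\<close> and \<open>D Mns\<close> are the simple roots of the reflections in \<open>S\<^sub>+\<close> and \<open>S\<^sub>-\<close>. Two vertices of
  the Coxeter diagram are not joined if and only if their simple roots are orthogonal.
\<close>

definition simples :: "(pm \<Rightarrow> 'a set) \<Rightarrow> 'a set" where
  "simples D = D Pls \<union> D Mns"

definition diagram_bipartition :: "(pm \<Rightarrow> 'a::real_inner set) \<Rightarrow> bool" where
  "diagram_bipartition D \<longleftrightarrow> D Pls \<inter> D Mns = {} \<and> (\<forall>\<epsilon>. pairwise orthogonal (D \<epsilon>))"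

text \<open>The reflections in \<open>S\<^sub>\<epsilon>\<close> commute, so the order of the factors is irrelevant.\<close>

definition cox :: "(pm \<Rightarrow> 'a::real_inner set) \<Rightarrow> pm \<Rightarrow> 'a \<Rightarrow> 'a" where
  "cox D \<epsilon> = Finite_Set.fold (\<lambda>\<alpha> f. refl \<alpha> \<circ> f) id (D \<epsilon>)"

definition coxeter_number :: "(pm \<Rightarrow> 'a::real_inner set) \<Rightarrow> nat" where
  "coxeter_number D = (LEAST k. 0 < k \<and> (cox D Mns \<circ> cox D Pls) ^^ k = id)"

definition tau :: "(pm \<Rightarrow> 'a::real_inner set) \<Rightarrow> pm \<Rightarrow> 'a \<Rightarrow> 'a" where
  "tau D \<epsilon> \<beta> = (if \<beta> \<in> uminus ` D (opp \<epsilon>) then \<beta> else cox D \<epsilon> \<beta>)"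

definition compatibility_relation ::
    "'a::real_inner set \<Rightarrow> (pm \<Rightarrow> 'a set) \<Rightarrow> ('a \<times> 'a) set \<Rightarrow> bool" where
  "compatibility_relation \<Phi> D R \<longleftrightarrow>
     (let AP = almost_positive_roots \<Phi> (simples D) in
        R \<subseteq> AP \<times> AP \<and>
        (\<forall>\<epsilon>. \<forall>\<beta>\<in>AP. \<forall>\<gamma>\<in>AP. (tau D \<epsilon> \<beta>, tau D \<epsilon> \<gamma>) \<in> R \<longleftrightarrow> (\<beta>, \<gamma>) \<in> R) \<and>
        (\<forall>\<alpha>\<in>simples D. \<forall>\<beta>\<in>AP. (\<beta>, - \<alpha>) \<in> R \<longleftrightarrow> representation (simples D) \<beta> \<alpha> = 0))"

definition compatible :: "'a::real_inner set \<Rightarrow> (pm \<Rightarrow> 'a set) \<Rightarrow> 'a \<Rightarrow> 'a \<Rightarrow> bool" where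
  "compatible \<Phi> D \<beta> \<gamma> \<longleftrightarrow> (\<beta>, \<gamma>) \<in> (THE R. compatibility_relation \<Phi> D R)"


section \<open>The Coxeter plane\<close>

text \<open>\<open>sgn \<alpha>\<close> is the unit vector \<open>\<alpha> / \<bar>\<alpha>\<bar>\<close>, so \<open>sgn \<alpha> \<bullet> sgn \<beta>\<close> is the Gram matrix of the unit simple roots.\<close>

definition gram_eigenvector :: "'a::real_inner set \<Rightarrow> real \<Rightarrow> ('a \<Rightarrow> real) \<Rightarrow> bool" where
  "gram_eigenvector \<Delta> x v \<longleftrightarrow>
     (\<exists>\<alpha>\<in>\<Delta>. v \<alpha> \<noteq> 0) \<and> (\<forall>\<alpha>\<in>\<Delta>. (\<Sum>\<beta>\<in>\<Delta>. (sgn \<alpha> \<bullet> sgn \<beta>) * v \<beta>) = x * v \<alpha>)"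

definition positive_smallest_eigenvector :: "'a::real_inner set \<Rightarrow> ('a \<Rightarrow> real) \<Rightarrow> bool" where
  "positive_smallest_eigenvector \<Delta> c \<longleftrightarrow>
     (\<forall>\<alpha>\<in>\<Delta>. c \<alpha> > 0) \<and>
     (\<exists>x. gram_eigenvector \<Delta> x c \<and> (\<forall>y v. gram_eigenvector \<Delta> y v \<longrightarrow> x \<le> y))"

definition dual_basis :: "'a::real_inner set \<Rightarrow> ('a \<Rightarrow> 'a) \<Rightarrow> bool" where
  "dual_basis \<Delta> \<omega> \<longleftrightarrow> (\<forall>\<alpha>\<in>\<Delta>. \<forall>\<beta>\<in>\<Delta>. \<omega> \<alpha> \<bullet> sgn \<beta> = (if \<alpha> = \<beta> then 1 else 0))"

text \<open>
  The vectors \<open>\<lambda>\<close> (\<open>\<epsilon> = Pls\<close>) and \<open>\<mu>\<close> (\<open>\<epsilon> = Mns\<close>) spanning the Coxeter plane.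
\<close>

definition plane_vec ::
    "(pm \<Rightarrow> 'a::real_inner set) \<Rightarrow> ('a \<Rightarrow> real) \<Rightarrow> ('a \<Rightarrow> 'a) \<Rightarrow> pm \<Rightarrow> 'a" where
  "plane_vec D c \<omega> \<epsilon> = (\<Sum>\<alpha>\<in>D \<epsilon>. c \<alpha> *\<^sub>R \<omega> \<alpha>)"

text \<open>
  Orthogonal projection to the Coxeter plane, which is identified isometrically with \<open>\<complex>\<close> so that
  \<open>\<lambda>\<close> has angle \<open>0\<close> and \<open>\<mu>\<close> lies in the upper half plane (hence has angle \<open>\<pi>/h\<close>).
\<close>

definition plane_proj ::
    "(pm \<Rightarrow> 'a::real_inner set) \<Rightarrow> ('a \<Rightarrow> real) \<Rightarrow> ('a \<Rightarrow> 'a) \<Rightarrow> 'a \<Rightarrow> complex" where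
  "plane_proj D c \<omega> x =
     (let u = sgn (plane_vec D c \<omega> Pls);
          \<mu> = plane_vec D c \<omega> Mns;
          v = sgn (\<mu> - (\<mu> \<bullet> u) *\<^sub>R u)
      in Complex (x \<bullet> u) (x \<bullet> v))"


section \<open>Diagrams of almost positive roots\<close>

text \<open>
  Labeled points of the enlarged polygon, and their positions in the plane. Only origin points
  carry a label, namely an element of the orbit. A labeled segment is the set of its endpoints.
\<close>

datatype 'a lpoint = Vertex complex | Origin 'a

fun pos :: "'a lpoint \<Rightarrow> complex" where
  "pos (Vertex z) = z"
| "pos (Origin x) = 0"

definition unlabeled :: "'a lpoint set \<Rightarrow> complex set" where
  "unlabeled s = convex hull (pos ` s)"

text \<open>
  The move from the \<open>h\<close>-gon to the \<open>(h + 2)\<close>-gon, for \<open>z \<noteq> 0\<close> whose angle is a multiple of \<open>\<pi>/h\<close>;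
  the range of \<open>k\<close> makes it unique.
\<close>

definition enlarge :: "nat \<Rightarrow> complex \<Rightarrow> complex" where
  "enlarge h z =
     (let k = (THE k. 1 \<le> k \<and> k \<le> 2 * h \<and> z = rcis (cmod z) (real k * pi / real h))
      in rcis (cmod z) (real (if k \<le> h then k + 2 else k + 4) * pi / real (h + 2)))"

definition hat ::
    "(pm \<Rightarrow> 'a::real_inner set) \<Rightarrow> ('a \<Rightarrow> real) \<Rightarrow> ('a \<Rightarrow> 'a) \<Rightarrow> 'a \<Rightarrow> 'a lpoint" where
  "hat D c \<omega> x =
     (let z = plane_proj D c \<omega> x
      in if z = 0 then Origin x else Vertex (enlarge (coxeter_number D) z))"

definition neg_simple_diagram ::
    "(pm \<Rightarrow> 'a::real_inner set) \<Rightarrow> ('a \<Rightarrow> real) \<Rightarrow> ('a \<Rightarrow> 'a) \<Rightarrow> 'a set \<Rightarrow> 'a \<Rightarrow> 'a lpoint set set" where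
  "neg_simple_diagram D c \<omega> Orb \<alpha> =
     {{hat D c \<omega> x, hat D c \<omega> (refl \<alpha> x)} | x. x \<in> Orb \<and> refl \<alpha> x \<noteq> x}"

text \<open>Unit direction vectors of the lines \<open>L'\<^sub>+\<close> and \<open>L'\<^sub>-\<close>.\<close>

fun mirror_dir :: "nat \<Rightarrow> pm \<Rightarrow> complex" where
  "mirror_dir h Pls = cis (pi / real (h + 2))"
| "mirror_dir h Mns = cis (2 * pi / real (h + 2))"

text \<open>Reflection of \<open>\<complex>\<close> in the line spanned by a unit vector \<open>d\<close>.\<close>

definition line_refl :: "complex \<Rightarrow> complex \<Rightarrow> complex" where
  "line_refl d z = d\<^sup>2 * cnj z"

fun tau_point :: "(pm \<Rightarrow> 'a::real_inner set) \<Rightarrow> pm \<Rightarrow> 'a lpoint \<Rightarrow> 'a lpoint" where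
  "tau_point D \<epsilon> (Vertex z) = Vertex (line_refl (mirror_dir (coxeter_number D) \<epsilon>) z)"
| "tau_point D \<epsilon> (Origin x) = Origin (cox D \<epsilon> x)"

definition tau_segment :: "(pm \<Rightarrow> 'a::real_inner set) \<Rightarrow> pm \<Rightarrow> 'a lpoint set \<Rightarrow> 'a lpoint set" where
  "tau_segment D \<epsilon> s =
     (if (\<exists>x. Origin x \<in> s) \<and>
         (\<forall>A\<in>s. \<forall>B\<in>s. orthogonal (pos A - pos B) (mirror_dir (coxeter_number D) \<epsilon>))
      then s else tau_point D \<epsilon> ` s)"

text \<open>
  \<open>is_diagram D c \<omega> Orb \<beta> C\<close>: the collection \<open>C\<close> is the diagram of the almost positive root \<open>\<beta>\<close>,
  obtained from the diagrams of the negative simple roots by \<open>\<tau>\<^sub>+\<close>, \<open>\<tau>\<^sub>-\<close>-equivariance.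
\<close>

inductive is_diagram ::
    "(pm \<Rightarrow> 'a::real_inner set) \<Rightarrow> ('a \<Rightarrow> real) \<Rightarrow> ('a \<Rightarrow> 'a) \<Rightarrow> 'a set \<Rightarrow> 'a \<Rightarrow> 'a lpoint set set \<Rightarrow> bool"
  for D c \<omega> Orb where
  neg_simple: "\<alpha> \<in> simples D \<Longrightarrow> is_diagram D c \<omega> Orb (- \<alpha>) (neg_simple_diagram D c \<omega> Orb \<alpha>)"
| tau: "is_diagram D c \<omega> Orb \<beta> C \<Longrightarrow> is_diagram D c \<omega> Orb (tau D \<epsilon> \<beta>) (tau_segment D \<epsilon> ` C)"


section \<open>Crossings and the gray zone\<close>

definition segments_cross :: "'a lpoint set \<Rightarrow> 'a lpoint set \<Rightarrow> bool" where
  "segments_cross s t \<longleftrightarrow> rel_interior (unlabeled s) \<inter> rel_interior (unlabeled t) \<noteq> {}"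

definition same_origin_point :: "'a lpoint set \<Rightarrow> 'a lpoint set \<Rightarrow> bool" where
  "same_origin_point s t \<longleftrightarrow> (\<exists>x. Origin x \<in> s \<and> Origin x \<in> t)"

text \<open>
  The open gray zone consists of the points whose inner products with the directions of \<open>L'\<^sub>+\<close> and
  \<open>L'\<^sub>-\<close> have strictly opposite signs: these directions form the angle \<open>\<pi>/(h + 2)\<close>, so opposite
  signs occur on the two acute wedges. The closed obtuse wedges are \<open>obtuse_wedge h\<close> and its negative.
\<close>

definition obtuse_wedge :: "nat \<Rightarrow> complex set" where
  "obtuse_wedge h = {z. 0 \<le> z \<bullet> mirror_dir h Pls \<and> 0 \<le> z \<bullet> mirror_dir h Mns}"

definition union_crosses_gray_zone :: "nat \<Rightarrow> 'a lpoint set \<Rightarrow> 'a lpoint set \<Rightarrow> bool" where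
  "union_crosses_gray_zone h s t \<longleftrightarrow>
     (\<exists>A\<in>s. \<exists>B\<in>t. pos A \<noteq> 0 \<and> pos B \<noteq> 0 \<and>
        (pos A \<in> obtuse_wedge h \<and> pos B \<in> uminus ` obtuse_wedge h \<or>
         pos A \<in> uminus ` obtuse_wedge h \<and> pos B \<in> obtuse_wedge h))"

end

theory Submission
  imports Defs
begin

text \<open>
  In all the types considered, any two elements \<open>x\<close> and \<open>y\<close> of the orbit are swapped by the reflection
  \<open>refl (x - y)\<close> of \<open>W\<close>, except that in types \<open>D\<^sub>n\<close> and \<open>H\<^sub>3\<close> no reflection swaps \<open>x\<close> and \<open>- x\<close>. Hence the
  orbit is totally ordered by the cone of the simple roots, \<open>x\<^sub>1 > \<dots> > x\<^sub>N\<close>, except for a single incomparable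
  pair \<open>\<plusminus> q\<close> in the middle, which exists exactly in the exceptional case. Consecutive elements are swapped by
  simple reflections, alternately from \<open>S\<^sub>+\<close> and \<open>S\<^sub>-\<close>. So \<open>c\<^sub>+\<close> and \<open>c\<^sub>-\<close> swap alternate pairs of
  neighbours, which forces \<open>h = N\<close>, \<open>\<plusminus> q\<close> to project to the origin, and \<open>x\<^sub>1, \<dots>, x\<^sub>N\<close> to project to the
  vertices of the \<open>h\<close>-gon in zigzag order from top to bottom. In the \<open>(h + 2)\<close>-gon the zigzag becomes
  \<open>X\<^sub>0, \<dots>, X\<^sub>N\<^sub>+\<^sub>1\<close> with a new vertex at either end, and \<open>\<tau>\<^sub>\<epsilon>\<close> again swaps alternate neighbours.

  The diagram of \<open>- \<alpha>\<close> consists of the segments \<open>X\<^sub>l X\<^sub>l\<^sub>+\<^sub>1\<close> for which \<open>x\<^sub>l - x\<^sub>l\<^sub>+\<^sub>1\<close> is a multiple of \<open>\<alpha>\<close>, and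
  equivariance yields the diagram of a positive root \<open>\<beta>\<close>: if \<open>\<beta>\<close> swaps \<open>x\<^sub>i\<close> and \<open>x\<^sub>j\<close> with \<open>i < j\<close>, then it
  contains \<open>X\<^sub>i\<^sub>-\<^sub>1 X\<^sub>j\<^sub>+\<^sub>1\<close>. This crosses \<open>X\<^sub>l X\<^sub>l\<^sub>+\<^sub>1\<close> if and only if \<open>i \<le> l < j\<close>; as
  \<open>x\<^sub>i - x\<^sub>j\<close> is a multiple of \<open>\<beta>\<close>, a crossing with the diagram of \<open>- \<alpha>\<close> occurs exactly if \<open>\<alpha>\<close> has a nonzero
  coefficient in \<open>\<beta>\<close>. The label condition plays the same role for the steps from \<open>x\<^sub>N\<^sub>/\<^sub>2\<close> to \<open>\<plusminus> q\<close>.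
  So the criterion on diagrams is a relation with the defining properties of compatibility.
\<close>

section \<open>Reflections and bipartite root systems\<close>

text \<open>The two polygons differ by an offset. In the h-gon, \<open>cox D (e i)\<close> swaps x_i
  and x_(i+1); in the (h+2)-gon the mirror of the opposite class swaps X_i and X_(i+1), and the
  mirror of class \<open>e i\<close> sends them outward to X_(i-1) and X_(i+2). This matches
  \<open>tau\<close>, which turns -\<alpha> into \<alpha> for its own class and fixes it for the
  other. The obstacle is that \<open>tau_segment\<close> is no motion of labeled segments: a radius
  perpendicular to the mirror stays put. The two conditions are therefore transported separately.
  Crossings depend only on the drawing without labels, which is still reflected because an
  exceptional diagram is symmetric. Labels are followed through an action on indices, in which the
  exception keeps a radius from jumping over the gray zone. The angle \<theta> between \<lambda> and
  \<mu> is derived: descent along the chain gives sin(i \<theta>) > 0 for 0 < i < N, and the fixed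
  last element gives sin(N \<theta>) = 0. Uniqueness of compatibility needs every orbit of the
  involutions to meet a negative simple root; this follows by summing a root over the powers of
  c.\<close>

lemma refl_linear: "linear (refl v)"
  unfolding refl_def
  by (rule linearI) (auto simp: inner_right_distrib algebra_simps add_divide_distrib)

lemma refl_minus: "refl v (- x) = - refl v x"
  by (simp add: refl_def)

lemma inner_refl_self: "v \<bullet> refl v x = - (v \<bullet> x)"
  by (cases "v = 0") (auto simp: refl_def inner_right_distrib algebra_simps)

lemma refl_refl [simp]: "refl v (refl v x) = x"
  using inner_refl_self[of v x] unfolding refl_def by simp

lemma refl_adjoint: "refl v x \<bullet> y = x \<bullet> refl v y"
  unfolding refl_def by (simp add: inner_diff_left inner_diff_right inner_commute)

lemma refl_inner: "refl v x \<bullet> refl v y = x \<bullet> y"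
  by (simp add: refl_adjoint)

lemma refl_scaleR: "k \<noteq> 0 \<Longrightarrow> refl (k *\<^sub>R v) = refl v"
  by (rule ext) (simp add: refl_def)

lemma refl_fix_iff: "refl v x = x \<longleftrightarrow> v \<bullet> x = 0"
  by (cases "v = 0") (auto simp: refl_def)

lemma refl_swap:
  assumes "norm x = norm y"
  shows "refl (x - y) x = y"
proof (cases "x = y")
  case False
  have "x \<bullet> x = y \<bullet> y" using assms by (simp add: norm_eq_sqrt_inner)
  then have *: "2 * ((x - y) \<bullet> x) = (x - y) \<bullet> (x - y)"
    by (simp add: inner_diff_left inner_diff_right inner_commute)
  have "(x - y) \<bullet> (x - y) \<noteq> 0" using False by simp
  then show ?thesis unfolding refl_def * by simp
qed (simp add: refl_def)

lemma refl_conj: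
  assumes "linear f" "\<And>x y. f x \<bullet> f y = x \<bullet> y"
  shows "refl (f v) (f x) = f (refl v x)"
  unfolding refl_def by (simp add: assms linear_diff linear_scale)

lemma refl_commute:
  assumes "orthogonal v w"
  shows "refl v (refl w x) = refl w (refl v x)"
  using assms unfolding refl_def orthogonal_def
  by (simp add: inner_diff_right inner_commute algebra_simps)

text \<open>Orthogonal reflections commute, so the fold is well defined, and each factor removes its
  own component without affecting the others. Later computations with \<open>cox\<close> start from
  this sum.\<close>

lemma fold_refl:
  assumes "finite A" "pairwise orthogonal A"
  shows "Finite_Set.fold (\<lambda>\<alpha> f. refl \<alpha> \<circ> f) id A v = v - (\<Sum>\<alpha>\<in>A. (2 * (\<alpha> \<bullet> v) / (\<alpha> \<bullet> \<alpha>)) *\<^sub>R \<alpha>)"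
  using assms
proof (induction A arbitrary: v rule: finite_induct)
  case (insert a A)
  interpret comp_fun_commute_on "insert a A" "\<lambda>\<alpha> f. refl \<alpha> \<circ> f"
  proof
    fix v w assume "v \<in> insert a A" "w \<in> insert a A"
    then have "refl v (refl w z) = refl w (refl v z)" for z
      using insert.prems refl_commute[of v w z] by (cases "v = w") (auto simp: pairwise_def)
    then show "(\<circ>) (refl w) \<circ> (\<circ>) (refl v) = (\<circ>) (refl v) \<circ> (\<circ>) (refl w)"
      by (simp add: fun_eq_iff)
  qed
  have orth: "a \<bullet> \<beta> = 0" if "\<beta> \<in> A" for \<beta>
    using insert.prems insert.hyps that by (auto simp: pairwise_def orthogonal_def)
  have "a \<bullet> (\<Sum>\<alpha>\<in>A. (2 * (\<alpha> \<bullet> v) / (\<alpha> \<bullet> \<alpha>)) *\<^sub>R \<alpha>) = 0"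
    by (simp add: inner_sum_right orth)
  moreover have "Finite_Set.fold (\<lambda>\<alpha> f. refl \<alpha> \<circ> f) id A v = v - (\<Sum>\<alpha>\<in>A. (2 * (\<alpha> \<bullet> v) / (\<alpha> \<bullet> \<alpha>)) *\<^sub>R \<alpha>)"
    by (rule insert.IH) (rule pairwise_subset[OF insert.prems], blast)
  ultimately have "refl a (Finite_Set.fold (\<lambda>\<alpha> f. refl \<alpha> \<circ> f) id A v) =
      v - (\<Sum>\<alpha>\<in>insert a A. (2 * (\<alpha> \<bullet> v) / (\<alpha> \<bullet> \<alpha>)) *\<^sub>R \<alpha>)"
    using insert.hyps by (simp add: refl_def inner_diff_right)
  then show ?case using insert.hyps by (subst fold_insert) auto
qed simp

locale bipartite_roots =
  fixes W :: "('a::euclidean_space \<Rightarrow> 'a) set" and \<Phi> :: "'a set" and D :: "pm \<Rightarrow> 'a set"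
  assumes root_system: "root_system_for W \<Phi>"
    and simple_roots: "simple_roots \<Phi> (simples D)"
    and bipartition: "diagram_bipartition D"
begin

abbreviation simple_set ("\<Delta>") where "\<Delta> \<equiv> simples D"
abbreviation cf where "cf \<alpha> v \<equiv> representation \<Delta> v \<alpha>"
abbreviation AP where "AP \<equiv> almost_positive_roots \<Phi> \<Delta>"
abbreviation Pos where "Pos \<equiv> positive_roots \<Phi> \<Delta>"

lemma independent_simples: "independent \<Delta>" and span_simples: "span \<Delta> = UNIV"
  and simples_roots: "\<Delta> \<subseteq> \<Phi>"
  using simple_roots by (auto simp: simple_roots_def)

lemma finite_simples: "finite \<Delta>"
  using independent_simples by (rule independent_imp_finite)

lemma in_simples_iff: "\<alpha> \<in> \<Delta> \<longleftrightarrow> (\<exists>\<epsilon>. \<alpha> \<in> D \<epsilon>)"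
  unfolding simples_def by (metis Un_iff pm.exhaust)

lemma D_simples: "\<alpha> \<in> D \<epsilon> \<Longrightarrow> \<alpha> \<in> \<Delta>"
  by (auto simp: in_simples_iff)

lemma finite_D: "finite (D \<epsilon>)"
  using finite_simples D_simples by (meson rev_finite_subset subsetI)

lemma D_disjoint: "\<alpha> \<in> D \<epsilon> \<Longrightarrow> \<alpha> \<in> D \<delta> \<Longrightarrow> \<epsilon> = \<delta>"
  using bipartition unfolding diagram_bipartition_def by (metis (full_types) IntI empty_iff pm.exhaust)

lemma D_orthogonal: "\<alpha> \<in> D \<epsilon> \<Longrightarrow> \<beta> \<in> D \<epsilon> \<Longrightarrow> \<alpha> \<noteq> \<beta> \<Longrightarrow> \<alpha> \<bullet> \<beta> = 0"
  using bipartition by (auto simp: diagram_bipartition_def pairwise_def orthogonal_def)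

lemma simple_opp: "\<alpha> \<in> \<Delta> \<Longrightarrow> \<alpha> \<notin> D \<epsilon> \<Longrightarrow> \<alpha> \<in> D (opp \<epsilon>)"
  by (cases \<epsilon>) (auto simp: simples_def)

lemma root_nonzero: "\<beta> \<in> \<Phi> \<Longrightarrow> \<beta> \<noteq> 0" and root_refl: "\<beta> \<in> \<Phi> \<Longrightarrow> refl \<beta> \<in> W"
  and W_root: "w \<in> W \<Longrightarrow> \<beta> \<in> \<Phi> \<Longrightarrow> w \<beta> \<in> \<Phi>"
  using root_system by (auto simp: root_system_for_def)

lemma simple_nonzero: "\<alpha> \<in> \<Delta> \<Longrightarrow> \<alpha> \<noteq> 0" and simple_refl: "\<alpha> \<in> \<Delta> \<Longrightarrow> refl \<alpha> \<in> W"
  using simples_roots root_nonzero root_refl by auto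

lemma refl_root: "\<alpha> \<in> \<Phi> \<Longrightarrow> \<beta> \<in> \<Phi> \<Longrightarrow> refl \<alpha> \<beta> \<in> \<Phi>"
  using W_root root_refl by blast

lemma root_line:
  assumes "v \<noteq> 0" "refl v \<in> W"
  obtains \<beta> where "\<Phi> \<inter> span {v} = {\<beta>, - \<beta>}"
  using root_system assms unfolding root_system_for_def by blast

text \<open>Both vectors lie on one root line, where \<open>\<Phi>\<close> has only two opposite
  elements.\<close>

lemma root_multiple:
  assumes "\<beta> \<in> \<Phi>" "k *\<^sub>R \<beta> \<in> \<Phi>"
  shows "k = 1 \<or> k = -1"
proof -
  obtain \<gamma> where \<gamma>: "\<Phi> \<inter> span {\<beta>} = {\<gamma>, - \<gamma>}"
    using root_line[OF root_nonzero root_refl] assms by blast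
  have "\<beta> \<in> {\<gamma>, - \<gamma>}" "k *\<^sub>R \<beta> \<in> {\<gamma>, - \<gamma>}"
    unfolding \<gamma>[symmetric] using assms by (auto simp: span_base span_scale)
  then have "k *\<^sub>R \<beta> = 1 *\<^sub>R \<beta> \<or> k *\<^sub>R \<beta> = (-1) *\<^sub>R \<beta>" by auto
  then show ?thesis using root_nonzero[OF assms(1)] unfolding scaleR_cancel_right by blast
qed

lemma cf_add: "cf \<alpha> (u + v) = cf \<alpha> u + cf \<alpha> v"
  and cf_diff: "cf \<alpha> (u - v) = cf \<alpha> u - cf \<alpha> v"
  and cf_scale: "cf \<alpha> (r *\<^sub>R v) = r * cf \<alpha> v"
  and cf_minus: "cf \<alpha> (- v) = - cf \<alpha> v"
  and cf_zero: "cf \<alpha> 0 = 0"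
  using independent_simples span_simples
  by (simp_all add: representation_add representation_diff representation_scale representation_neg representation_zero)

lemma cf_sum: "cf \<alpha> (sum g A) = (\<Sum>x\<in>A. cf \<alpha> (g x))"
  by (induction A rule: infinite_finite_induct) (auto simp: cf_zero cf_add)

lemma cf_simple: "\<beta> \<in> \<Delta> \<Longrightarrow> cf \<alpha> \<beta> = (if \<alpha> = \<beta> then 1 else 0)"
  using representation_basis[OF independent_simples, of \<beta>] by (auto simp: fun_eq_iff)

lemma sum_cf: "(\<Sum>\<alpha>\<in>\<Delta>. cf \<alpha> v *\<^sub>R \<alpha>) = v"
  using sum_representation_eq[OF independent_simples _ finite_simples order_refl] span_simples by blast

lemma inner_cf: "u \<bullet> v = (\<Sum>\<alpha>\<in>\<Delta>. cf \<alpha> v * (u \<bullet> \<alpha>))"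
  by (subst (1) sum_cf[of v, symmetric]) (simp add: inner_sum_right)

lemma cf_eqI: "(\<And>\<alpha>. \<alpha> \<in> \<Delta> \<Longrightarrow> cf \<alpha> u = cf \<alpha> v) \<Longrightarrow> u = v"
  by (metis (mono_tags, lifting) sum.cong sum_cf)

lemma root_sign: "\<beta> \<in> \<Phi> \<Longrightarrow> (\<forall>\<alpha>\<in>\<Delta>. cf \<alpha> \<beta> \<ge> 0) \<or> (\<forall>\<alpha>\<in>\<Delta>. cf \<alpha> \<beta> \<le> 0)"
  using simple_roots by (auto simp: simple_roots_def)

lemma PosD: "\<beta> \<in> Pos \<Longrightarrow> \<beta> \<in> \<Phi>" "\<beta> \<in> Pos \<Longrightarrow> \<alpha> \<in> \<Delta> \<Longrightarrow> cf \<alpha> \<beta> \<ge> 0"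
  by (auto simp: positive_roots_def)

lemma Pos_cf_pos: 
  assumes "\<beta> \<in> Pos" obtains \<alpha> where "\<alpha> \<in> \<Delta>" "cf \<alpha> \<beta> > 0"
proof -
  have "\<exists>\<alpha>\<in>\<Delta>. cf \<alpha> \<beta> \<noteq> 0"
    using cf_eqI[of \<beta> 0] root_nonzero PosD(1)[OF assms] by (auto simp: cf_zero)
  then show ?thesis using that PosD(2)[OF assms] by force
qed

lemma simple_Pos: "\<alpha> \<in> \<Delta> \<Longrightarrow> \<alpha> \<in> Pos"
  using simples_roots by (auto simp: positive_roots_def cf_simple)

lemma Pos_neg_simple: "\<beta> \<in> Pos \<Longrightarrow> \<alpha> \<in> \<Delta> \<Longrightarrow> \<beta> \<noteq> - \<alpha>"
  using PosD(2)[of \<beta> \<alpha>] by (auto simp: cf_minus cf_simple)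

lemma AP_cases [consumes 1, case_names pos neg]:
  assumes "\<beta> \<in> AP"
  obtains "\<beta> \<in> Pos" | \<alpha> where "\<alpha> \<in> \<Delta>" "\<beta> = - \<alpha>"
  using assms by (auto simp: almost_positive_roots_def)

lemma neg_simple_AP: "\<alpha> \<in> \<Delta> \<Longrightarrow> - \<alpha> \<in> AP" and Pos_AP: "\<beta> \<in> Pos \<Longrightarrow> \<beta> \<in> AP"
  by (auto simp: almost_positive_roots_def)

lemma cox_eq: "cox D \<epsilon> v = v - (\<Sum>\<alpha>\<in>D \<epsilon>. (2 * (\<alpha> \<bullet> v) / (\<alpha> \<bullet> \<alpha>)) *\<^sub>R \<alpha>)"
  unfolding cox_def using bipartition by (intro fold_refl finite_D) (auto simp: diagram_bipartition_def)

lemma cox_eq_refl: "cox D \<epsilon> v = v - (\<Sum>\<alpha>\<in>D \<epsilon>. v - refl \<alpha> v)"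
  unfolding cox_eq by (simp add: refl_def)

lemma cox_linear: "linear (cox D \<epsilon>)"
  unfolding cox_eq refl_def
  by (rule linearI)
    (auto simp: inner_right_distrib algebra_simps add_divide_distrib sum.distrib scaleR_sum_right)

lemma cox_minus: "cox D \<epsilon> (- v) = - cox D \<epsilon> v"
  by (rule linear_neg[OF cox_linear])

lemma inner_cox:
  assumes "\<alpha> \<in> D \<epsilon>"
  shows "\<alpha> \<bullet> cox D \<epsilon> v = - (\<alpha> \<bullet> v)"
proof -
  have "(\<Sum>\<beta>\<in>D \<epsilon>. \<alpha> \<bullet> ((2 * (\<beta> \<bullet> v) / (\<beta> \<bullet> \<beta>)) *\<^sub>R \<beta>)) = (\<Sum>\<beta>\<in>D \<epsilon>. if \<beta> = \<alpha> then 2 * (\<alpha> \<bullet> v) else 0)"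
    using assms D_orthogonal simple_nonzero D_simples by (intro sum.cong) auto
  also have "\<dots> = 2 * (\<alpha> \<bullet> v)" using assms finite_D by simp
  finally show ?thesis unfolding cox_eq by (simp add: inner_diff_right inner_sum_right)
qed

lemma cox_cox [simp]: "cox D \<epsilon> (cox D \<epsilon> v) = v"
proof -
  have "cox D \<epsilon> (cox D \<epsilon> v) = cox D \<epsilon> v + (\<Sum>\<alpha>\<in>D \<epsilon>. (2 * (\<alpha> \<bullet> v) / (\<alpha> \<bullet> \<alpha>)) *\<^sub>R \<alpha>)"
    by (subst cox_eq) (simp add: inner_cox sum_negf[symmetric])
  then show ?thesis by (simp add: cox_eq)
qed

lemma cox_adjoint: "cox D \<epsilon> u \<bullet> v = u \<bullet> cox D \<epsilon> v"
  by (simp add: cox_eq inner_diff_left inner_diff_right inner_sum_left inner_sum_right inner_commute mult_ac)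

lemma cox_inner: "cox D \<epsilon> u \<bullet> cox D \<epsilon> v = u \<bullet> v"
  by (simp add: cox_adjoint)

lemma cox_fix: "(\<And>\<alpha>. \<alpha> \<in> D \<epsilon> \<Longrightarrow> \<alpha> \<bullet> v = 0) \<Longrightarrow> cox D \<epsilon> v = v"
  by (simp add: cox_eq)

lemma cox_simple:
  assumes "\<alpha> \<in> D \<epsilon>"
  shows "cox D \<epsilon> \<alpha> = - \<alpha>"
proof -
  have "(\<Sum>\<beta>\<in>D \<epsilon>. (2 * (\<beta> \<bullet> \<alpha>) / (\<beta> \<bullet> \<beta>)) *\<^sub>R \<beta>) = (\<Sum>\<beta>\<in>D \<epsilon>. if \<beta> = \<alpha> then 2 *\<^sub>R \<alpha> else 0)"
    using assms D_orthogonal simple_nonzero D_simples by (intro sum.cong) auto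
  also have "\<dots> = 2 *\<^sub>R \<alpha>" using assms finite_D by simp
  finally show ?thesis unfolding cox_eq by (simp add: scaleR_2)
qed

lemma cf_cox: 
  assumes "\<alpha> \<in> \<Delta>" "\<alpha> \<notin> D \<epsilon>"
  shows "cf \<alpha> (cox D \<epsilon> v) = cf \<alpha> v"
proof -
  have "cf \<alpha> (\<Sum>\<beta>\<in>D \<epsilon>. (2 * (\<beta> \<bullet> v) / (\<beta> \<bullet> \<beta>)) *\<^sub>R \<beta>) = 0"
    unfolding cf_sum cf_scale using assms D_simples by (intro sum.neutral) (auto simp: cf_simple)
  then show ?thesis by (simp add: cox_eq cf_diff)
qed

text \<open>The sum is a product of commuting reflections, so stability under each single one is
  enough. Through \<open>cox_closed\<close> this serves both \<open>\<Phi>\<close> and the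
  orbit.\<close>

lemma fold_refl_closed:
  assumes "\<And>\<alpha> y. \<alpha> \<in> A \<Longrightarrow> y \<in> B \<Longrightarrow> refl \<alpha> y \<in> B"
    and "v \<in> B" "finite A" "pairwise orthogonal A"
  shows "v - (\<Sum>\<alpha>\<in>A. (2 * (\<alpha> \<bullet> v) / (\<alpha> \<bullet> \<alpha>)) *\<^sub>R \<alpha>) \<in> B"
  using assms(3,4,1,2)
proof (induction A rule: finite_induct)
  case (insert a A)
  have orth: "a \<bullet> \<beta> = 0" if "\<beta> \<in> A" for \<beta>
    using insert.prems insert.hyps that by (auto simp: pairwise_def orthogonal_def)
  let ?w = "v - (\<Sum>\<alpha>\<in>A. (2 * (\<alpha> \<bullet> v) / (\<alpha> \<bullet> \<alpha>)) *\<^sub>R \<alpha>)"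
  have w: "?w \<in> B"
    by (rule insert.IH) (use insert.prems in \<open>auto simp: pairwise_def\<close>)
  have "a \<bullet> ?w = a \<bullet> v"
    by (simp add: inner_diff_right inner_sum_right orth)
  then have "refl a ?w = v - (\<Sum>\<alpha>\<in>insert a A. (2 * (\<alpha> \<bullet> v) / (\<alpha> \<bullet> \<alpha>)) *\<^sub>R \<alpha>)"
    using insert.hyps by (simp add: refl_def)
  then show ?case using insert.prems(2)[of a, OF _ w] by auto
qed simp

lemma cox_closed:
  assumes "\<And>\<alpha> y. \<alpha> \<in> D \<epsilon> \<Longrightarrow> y \<in> B \<Longrightarrow> refl \<alpha> y \<in> B" "v \<in> B"
  shows "cox D \<epsilon> v \<in> B"
  unfolding cox_eq using bipartition finite_D assms
  by (intro fold_refl_closed) (auto simp: diagram_bipartition_def)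

lemma cox_root: "\<beta> \<in> \<Phi> \<Longrightarrow> cox D \<epsilon> \<beta> \<in> \<Phi>"
  by (rule cox_closed) (use refl_root D_simples simples_roots in blast)+

text \<open>The simple roots in the support of \<beta> are mutually orthogonal, so reflecting in one
  of them, \<alpha>, flips the sign of that coordinate alone. As the coordinates of a root have one
  sign, the others vanish and \<beta> is a multiple of \<alpha>.\<close>

lemma Pos_in_span_D:
  assumes "\<beta> \<in> Pos" "\<And>\<alpha>. \<alpha> \<in> \<Delta> \<Longrightarrow> \<alpha> \<notin> D \<epsilon> \<Longrightarrow> cf \<alpha> \<beta> = 0"
  shows "\<beta> \<in> D \<epsilon>"
proof -
  obtain \<alpha> where \<alpha>: "\<alpha> \<in> \<Delta>" "cf \<alpha> \<beta> > 0" using Pos_cf_pos assms by blast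
  have \<alpha>D: "\<alpha> \<in> D \<epsilon>" using assms \<alpha> by fastforce
  have "\<alpha> \<bullet> \<beta> = (\<Sum>\<gamma>\<in>\<Delta>. cf \<gamma> \<beta> * (\<alpha> \<bullet> \<gamma>))" by (rule inner_cf)
  also have "\<dots> = (\<Sum>\<gamma>\<in>\<Delta>. if \<gamma> = \<alpha> then cf \<alpha> \<beta> * (\<alpha> \<bullet> \<alpha>) else 0)"
    using assms(2) D_orthogonal[OF \<alpha>D] by (intro sum.cong) auto
  also have "\<dots> = cf \<alpha> \<beta> * (\<alpha> \<bullet> \<alpha>)" using finite_simples \<alpha> by simp
  finally have "refl \<alpha> \<beta> = \<beta> - (2 * cf \<alpha> \<beta>) *\<^sub>R \<alpha>"
    using simple_nonzero[OF \<alpha>(1)] by (simp add: refl_def)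
  then have cfr: "cf \<gamma> (refl \<alpha> \<beta>) = (if \<gamma> = \<alpha> then - cf \<alpha> \<beta> else cf \<gamma> \<beta>)" for \<gamma>
    using \<alpha> by (auto simp: cf_diff cf_scale cf_simple)
  have "refl \<alpha> \<beta> \<in> \<Phi>" using refl_root \<alpha> simples_roots PosD assms by blast
  then have "\<forall>\<gamma>\<in>\<Delta>. cf \<gamma> (refl \<alpha> \<beta>) \<le> 0"
    using root_sign[of "refl \<alpha> \<beta>"] \<alpha> cfr[of \<alpha>] by force
  then have z: "cf \<gamma> \<beta> = 0" if "\<gamma> \<in> \<Delta>" "\<gamma> \<noteq> \<alpha>" for \<gamma>
    using that PosD(2)[OF assms(1), of \<gamma>] cfr[of \<gamma>] by force
  have \<beta>: "\<beta> = cf \<alpha> \<beta> *\<^sub>R \<alpha>"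
    by (rule cf_eqI) (use \<alpha> z in \<open>auto simp: cf_scale cf_simple\<close>)
  then have "cf \<alpha> \<beta> = 1"
    using root_multiple[of \<alpha> "cf \<alpha> \<beta>"] \<alpha> simples_roots PosD(1)[OF assms(1)] by auto
  then show ?thesis using \<beta> \<alpha>D by simp
qed

text \<open>A coordinate of \<beta> outside \<open>D \<epsilon>\<close> is left alone by
  \<open>cox D \<epsilon>\<close>; being positive, it decides the sign of the image root.\<close>

lemma cox_Pos:
  assumes "\<beta> \<in> Pos" "\<beta> \<notin> D \<epsilon>"
  shows "cox D \<epsilon> \<beta> \<in> Pos"
proof -
  obtain \<alpha> where \<alpha>: "\<alpha> \<in> \<Delta>" "\<alpha> \<notin> D \<epsilon>" "cf \<alpha> \<beta> \<noteq> 0"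
    using Pos_in_span_D assms by blast
  then have "cf \<alpha> (cox D \<epsilon> \<beta>) > 0"
    using cf_cox[of \<alpha> \<epsilon>] PosD(2)[OF assms(1)] by force
  moreover have "cox D \<epsilon> \<beta> \<in> \<Phi>" using cox_root PosD assms by blast
  ultimately show ?thesis using root_sign[of "cox D \<epsilon> \<beta>"] \<alpha> by (force simp: positive_roots_def)
qed

section \<open>The involutions on almost positive roots\<close>

lemma tau_fixed: "\<alpha> \<in> D (opp \<epsilon>) \<Longrightarrow> tau D \<epsilon> (- \<alpha>) = - \<alpha>"
  by (auto simp: tau_def)

lemma tau_neg_simple:
  assumes "\<alpha> \<in> D \<epsilon>"
  shows "tau D \<epsilon> (- \<alpha>) = \<alpha>"
proof -
  have "\<alpha> \<notin> D (opp \<epsilon>)" using assms D_disjoint by (metis opp.elims pm.distinct(1))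
  then show ?thesis using assms by (auto simp: tau_def cox_minus cox_simple)
qed

lemma tau_Pos: "\<beta> \<in> Pos \<Longrightarrow> tau D \<epsilon> \<beta> = cox D \<epsilon> \<beta>"
  using Pos_neg_simple D_simples by (auto simp: tau_def)

lemma tau_simple: "\<alpha> \<in> D \<epsilon> \<Longrightarrow> tau D \<epsilon> \<alpha> = - \<alpha>"
  using tau_Pos simple_Pos D_simples cox_simple by metis

lemma tau_cases [consumes 1, case_names simple pos neg fixed]:
  assumes "\<beta> \<in> AP"
  obtains "\<beta> \<in> D \<epsilon>" "tau D \<epsilon> \<beta> = - \<beta>"
  | "\<beta> \<in> Pos" "\<beta> \<notin> D \<epsilon>" "tau D \<epsilon> \<beta> = cox D \<epsilon> \<beta>" "cox D \<epsilon> \<beta> \<in> Pos"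
  | \<alpha> where "\<alpha> \<in> D \<epsilon>" "\<beta> = - \<alpha>" "tau D \<epsilon> \<beta> = \<alpha>"
  | \<alpha> where "\<alpha> \<in> D (opp \<epsilon>)" "\<beta> = - \<alpha>" "tau D \<epsilon> \<beta> = \<beta>"
  using assms
proof (cases rule: AP_cases)
  case pos
  then show ?thesis using that(1,2) tau_simple tau_Pos cox_Pos by metis
next
  case (neg \<alpha>)
  then show ?thesis using that(3,4) tau_neg_simple tau_fixed simple_opp by metis
qed

lemma tau_AP: "\<beta> \<in> AP \<Longrightarrow> tau D \<epsilon> \<beta> \<in> AP"
  by (cases rule: tau_cases[of \<beta> \<epsilon>]) (auto intro: neg_simple_AP Pos_AP simple_Pos D_simples)

lemma tau_tau:
  assumes "\<beta> \<in> AP"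
  shows "tau D \<epsilon> (tau D \<epsilon> \<beta>) = \<beta>"
  using assms
proof (cases rule: tau_cases[of \<beta> \<epsilon>])
  case pos
  then show ?thesis using tau_Pos[OF pos(4)] by simp
qed (auto simp: tau_neg_simple tau_simple)

lemma tau_inj: "\<beta> \<in> AP \<Longrightarrow> \<gamma> \<in> AP \<Longrightarrow> tau D \<epsilon> \<beta> = tau D \<epsilon> \<gamma> \<longleftrightarrow> \<beta> = \<gamma>"
  using tau_tau by metis

text \<open>A vector fixed by \<open>c = c\<^sub>- c\<^sub>+\<close> vanishes, since its differences with its images under \<open>c\<^sub>+\<close>
  and \<open>c\<^sub>-\<close> lie in the spans of disjoint sets of simple roots.\<close>

lemma cox_fixed_zero:
  assumes "cox D Mns (cox D Pls v) = v"
  shows "v = 0"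
proof -
  have eq: "cox D Pls v = cox D Mns v" using assms by (metis cox_cox)
  have "cox D \<epsilon> v = v" for \<epsilon>
  proof (rule cf_eqI)
    fix \<alpha> assume "\<alpha> \<in> \<Delta>"
    show "cf \<alpha> (cox D \<epsilon> v) = cf \<alpha> v"
    proof (cases "\<alpha> \<in> D \<epsilon>")
      case True
      then have "\<alpha> \<notin> D (opp \<epsilon>)" using D_disjoint by (metis opp.elims pm.distinct(1))
      then have "cf \<alpha> (cox D (opp \<epsilon>) v) = cf \<alpha> v" using cf_cox \<open>\<alpha> \<in> \<Delta>\<close> by blast
      then show ?thesis using eq by (cases \<epsilon>) auto
    qed (use cf_cox \<open>\<alpha> \<in> \<Delta>\<close> in blast)
  qed
  then have "\<alpha> \<bullet> v = 0" if "\<alpha> \<in> \<Delta>" for \<alpha>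
    using that inner_cox[of \<alpha> _ v] unfolding in_simples_iff by fastforce
  then have "v \<bullet> v = 0" by (simp add: inner_cf[of v v] inner_commute)
  then show ?thesis by simp
qed

text \<open>If \<open>P\<close> failed at \<beta>, it would fail along the whole orbit, which would
  then avoid the negative simple roots and consist of positive roots, where \<open>tau\<close> acts
  as \<open>cox\<close>. The sum over the powers of c is fixed by c and hence zero, yet one of its
  coordinates is positive. The finite order of c is supplied later by
  \<open>cc_power_N\<close>.\<close>

lemma tau_orbit_induct [consumes 3, case_names neg_simple tau]:
  assumes fin: "0 < N" "(cox D Mns \<circ> cox D Pls) ^^ N = id"
    and \<beta>: "\<beta> \<in> AP"
    and base: "\<And>\<alpha>. \<alpha> \<in> \<Delta> \<Longrightarrow> P (- \<alpha>)"
    and step: "\<And>\<beta> \<epsilon>. \<beta> \<in> AP \<Longrightarrow> P \<beta> \<Longrightarrow> P (tau D \<epsilon> \<beta>)"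
  shows "P \<beta>"
proof (rule ccontr)
  assume neg: "\<not> P \<beta>"
  let ?c = "cox D Mns \<circ> cox D Pls"
  have B: "\<gamma> \<in> Pos \<and> cox D \<epsilon> \<gamma> \<in> AP \<and> \<not> P (cox D \<epsilon> \<gamma>)" if "\<gamma> \<in> AP" "\<not> P \<gamma>" for \<gamma> \<epsilon>
  proof -
    have \<gamma>: "\<gamma> \<in> Pos" using that base by (cases rule: AP_cases) auto
    moreover have "\<not> P (tau D \<epsilon> \<gamma>)" using step[OF tau_AP] tau_tau that by metis
    ultimately show ?thesis using tau_Pos tau_AP that by metis
  qed
  have it: "(?c ^^ k) \<beta> \<in> AP \<and> \<not> P ((?c ^^ k) \<beta>)" for k
    by (induction k) (use \<beta> neg B in auto)
  let ?s = "\<Sum>k<N. (?c ^^ k) \<beta>"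
  have lin: "linear ?c" by (intro linear_compose cox_linear)
  have "?c ?s = (\<Sum>k<N. (?c ^^ Suc k) \<beta>)" using linear_sum[OF lin] by simp
  also have "\<dots> = ?s + (?c ^^ N) \<beta> - \<beta>"
    using sum.lessThan_Suc_shift[of "\<lambda>k. (?c ^^ k) \<beta>" N] by simp
  also have "\<dots> = ?s" using fin by simp
  finally have s0: "?s = 0" using cox_fixed_zero[of ?s] by simp
  have "\<beta> \<in> Pos" using B[OF \<beta> neg] by blast
  then obtain \<alpha> where \<alpha>: "\<alpha> \<in> \<Delta>" "cf \<alpha> \<beta> > 0" by (rule Pos_cf_pos)
  have "0 \<le> cf \<alpha> ((?c ^^ k) \<beta>)" for k using it B PosD(2) \<alpha> by blast
  moreover have "0 < cf \<alpha> ((?c ^^ 0) \<beta>)" using \<alpha> by simp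
  ultimately have "0 < (\<Sum>k<N. cf \<alpha> ((?c ^^ k) \<beta>))"
    using fin by (intro sum_pos2[where i = 0]) auto
  then show False using s0 cf_sum[of "\<lambda>k. (?c ^^ k) \<beta>" "{..<N}" \<alpha>] by (simp add: cf_zero)
qed

end

section \<open>The order on the orbit\<close>

lemma enumerate_decreasing:
  fixes g :: "'a \<Rightarrow> real"
  assumes "finite A" "inj_on g A"
  obtains x where "bij_betw x {1..card A} A" "\<And>i j. 1 \<le> i \<Longrightarrow> i < j \<Longrightarrow> j \<le> card A \<Longrightarrow> g (x j) < g (x i)"
proof -
  let ?B = "(\<lambda>a. - g a) ` A"
  have inj: "inj_on (\<lambda>a. - g a) A" using assms(2) by (auto simp: inj_on_def)
  have cB: "card ?B = card A" using inj by (rule card_image)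
  define h where "h = (!) (sorted_list_of_set ?B)"
  have fB: "finite ?B" using assms(1) by simp
  have h: "bij_betw h {0..<card A} ?B"
    unfolding h_def by (rule bij_betw_nth) (use fB cB in auto)
  have h_less: "h i < h j" if "i < j" "j < card A" for i j
    unfolding h_def using that cB fB
    by (intro sorted_wrt_nth_less[OF strict_sorted_list_of_set]) auto
  let ?k = "inv_into A (\<lambda>a. - g a)"
  let ?x = "\<lambda>i. ?k (h (i - 1))"
  have "bij_betw (\<lambda>i. i - 1) {1..card A} {0..<card A}"
    by (rule bij_betwI[where g = Suc]) auto
  moreover have "bij_betw ?k ?B A" using inj by (simp add: bij_betw_inv_into inj_on_imp_bij_betw)
  ultimately have "bij_betw (?k \<circ> (h \<circ> (\<lambda>i. i - 1))) {1..card A} A"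
    using h by (blast intro: bij_betw_trans)
  then have 1: "bij_betw ?x {1..card A} A" by (simp add: comp_def)
  have gx: "g (?x i) = - h (i - 1)" if "1 \<le> i" "i \<le> card A" for i
  proof -
    have "h (i - 1) \<in> ?B" using h that by (auto simp: bij_betw_def)
    from f_inv_into_f[OF this] show ?thesis by simp
  qed
  have "g (?x j) < g (?x i)" if "1 \<le> i" "i < j" "j \<le> card A" for i j
  proof -
    have "i - 1 < j - 1" using that by linarith
    then have "h (i - 1) < h (j - 1)" using h_less[of "i - 1" "j - 1"] that by simp
    then show ?thesis using gx that by simp
  qed
  then show ?thesis using 1 that by blast
qed

lemma minus_eq_self_real_iff: "- v = v \<longleftrightarrow> v = (0 :: 'a::real_vector)"
proof
  assume "- v = v"
  then have "2 *\<^sub>R v = 0" by (simp add: scaleR_2 neg_eq_iff_add_eq_0)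
  then show "v = 0" by simp
qed simp

text \<open>\<open>total_Orb\<close> says that the orbit spans the space, so that vectors can be
  tested against orbit elements.\<close>

locale root_orbit = bipartite_roots +
  fixes Orb :: "'a::euclidean_space set"
  assumes finite_Orb: "finite Orb"
    and norm_Orb: "\<lbrakk>x \<in> Orb; y \<in> Orb\<rbrakk> \<Longrightarrow> norm x = norm y"
    and refl_Orb: "\<lbrakk>refl \<beta> \<in> W; x \<in> Orb\<rbrakk> \<Longrightarrow> refl \<beta> x \<in> Orb"
    and total_Orb: "(\<And>x. x \<in> Orb \<Longrightarrow> v \<bullet> x = 0) \<Longrightarrow> v = 0"
begin

text \<open>This is the root order: x - y lies in the cone of the simple roots, read off in
  coordinates.\<close>

definition above :: "'a \<Rightarrow> 'a \<Rightarrow> bool" (infix "\<succ>" 50) where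
  "x \<succ> y \<longleftrightarrow> x \<noteq> y \<and> (\<forall>\<alpha>\<in>\<Delta>. cf \<alpha> y \<le> cf \<alpha> x)"

lemma above_trans: "x \<succ> y \<Longrightarrow> y \<succ> z \<Longrightarrow> x \<succ> z"
  unfolding above_def by (metis cf_eqI order_antisym order_trans)

lemma above_irrefl: "\<not> x \<succ> x"
  by (simp add: above_def)

lemma above_asym: "x \<succ> y \<Longrightarrow> \<not> y \<succ> x"
  using above_trans above_irrefl by blast

lemma above_minus: "x \<succ> y \<Longrightarrow> - y \<succ> - x"
  by (auto simp: above_def cf_minus)

lemma above_cf_strict: "x \<succ> y \<Longrightarrow> \<exists>\<alpha>\<in>\<Delta>. cf \<alpha> y < cf \<alpha> x"
  unfolding above_def by (metis cf_eqI order_antisym not_less)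

text \<open>A strictly monotone real function, used to list a totally ordered set in decreasing
  order.\<close>

definition height where "height v = (\<Sum>\<alpha>\<in>\<Delta>. cf \<alpha> v)"

lemma above_height: "x \<succ> y \<Longrightarrow> height y < height x"
  unfolding height_def using above_cf_strict[of x y] finite_simples
  by (intro sum_strict_mono_ex1) (auto simp: above_def)

lemma above_scale: "x - y = k *\<^sub>R \<beta> \<Longrightarrow> k > 0 \<Longrightarrow> \<beta> \<in> Pos \<Longrightarrow> x \<succ> y"
proof -
  assume a: "x - y = k *\<^sub>R \<beta>" "k > 0" "\<beta> \<in> Pos"
  have "cf \<alpha> x - cf \<alpha> y = k * cf \<alpha> \<beta>" for \<alpha>
    using a(1) by (metis cf_diff cf_scale)
  moreover have "x \<noteq> y" using a root_nonzero PosD(1) by fastforce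
  ultimately show ?thesis
    unfolding above_def using a PosD(2)[OF a(3)] by (metis diff_ge_0_iff_ge less_imp_le zero_le_mult_iff)
qed

text \<open>The line of x - y contains a root, and the coordinates of a root all have one
  sign.\<close>

lemma comparable:
  assumes "refl (x - y) \<in> W" "x \<noteq> y"
  shows "x \<succ> y \<or> y \<succ> x"
proof -
  obtain \<beta> where \<beta>: "\<Phi> \<inter> span {x - y} = {\<beta>, - \<beta>}" using root_line[of "x - y"] assms by auto
  then have "\<beta> \<in> \<Phi>" "\<beta> \<in> span {x - y}" by auto
  then obtain k where k: "\<beta> = k *\<^sub>R (x - y)" by (auto simp: span_singleton)
  have "k \<noteq> 0" using k root_nonzero \<open>\<beta> \<in> \<Phi>\<close> by force
  have sg: "(\<forall>\<alpha>\<in>\<Delta>. cf \<alpha> (x - y) \<ge> 0) \<or> (\<forall>\<alpha>\<in>\<Delta>. cf \<alpha> (x - y) \<le> 0)"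
    using root_sign[OF \<open>\<beta> \<in> \<Phi>\<close>] \<open>k \<noteq> 0\<close> unfolding k cf_scale
    by (cases "k > 0") (auto simp: zero_le_mult_iff mult_le_0_iff)
  then show ?thesis using assms(2) by (auto simp: above_def cf_diff)
qed

lemma refl_simple_Orb: "\<alpha> \<in> \<Delta> \<Longrightarrow> x \<in> Orb \<Longrightarrow> refl \<alpha> x \<in> Orb"
  using refl_Orb simple_refl by blast

lemma refl_eq_scale: "x - refl \<alpha> x = (2 * (\<alpha> \<bullet> x) / (\<alpha> \<bullet> \<alpha>)) *\<^sub>R \<alpha>"
  by (simp add: refl_def)

lemma refl_coeff_pos: "\<alpha> \<noteq> 0 \<Longrightarrow> \<alpha> \<bullet> x > 0 \<Longrightarrow> 2 * (\<alpha> \<bullet> x) / (\<alpha> \<bullet> \<alpha>) > 0"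
  by simp

lemma Pos_descend: "\<beta> \<in> Pos \<Longrightarrow> \<beta> \<bullet> x > 0 \<Longrightarrow> x \<succ> refl \<beta> x"
  using above_scale refl_eq_scale refl_coeff_pos root_nonzero PosD(1) by metis

lemma descend: "\<alpha> \<in> \<Delta> \<Longrightarrow> \<alpha> \<bullet> x > 0 \<Longrightarrow> x \<succ> refl \<alpha> x"
  using Pos_descend simple_Pos by blast

lemma inner_less_norm:
  assumes "x \<in> Orb" "y \<in> Orb" "x \<noteq> y"
  shows "x \<bullet> y < x \<bullet> x"
proof -
  have "norm x = norm y" using norm_Orb assms by blast
  moreover have "(x - y) \<bullet> (x - y) > 0" using assms by simp
  ultimately show ?thesis
    by (simp add: norm_eq_sqrt_inner inner_diff_left inner_diff_right inner_commute)
qed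

text \<open>Distinct vectors of equal norm satisfy x \<bullet> (x - z) > 0. Since x - z is a
  nonnegative combination of simple roots, one of these has positive inner product with x.\<close>

lemma ex_descend:
  assumes "x \<in> Orb" "z \<in> Orb" "x \<succ> z"
  obtains \<alpha> where "\<alpha> \<in> \<Delta>" "\<alpha> \<bullet> x > 0" "x \<succ> refl \<alpha> x" "refl \<alpha> x \<in> Orb"
proof -
  have "0 < x \<bullet> (x - z)" using inner_less_norm assms by (auto simp: above_def inner_diff_right)
  also have "x \<bullet> (x - z) = (\<Sum>\<alpha>\<in>\<Delta>. cf \<alpha> (x - z) * (x \<bullet> \<alpha>))" by (rule inner_cf)
  finally obtain \<alpha> where "\<alpha> \<in> \<Delta>" "0 < cf \<alpha> (x - z) * (x \<bullet> \<alpha>)"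
    by (meson not_less sum_nonpos)
  moreover have "0 \<le> cf \<alpha> (x - z)" using assms(3) \<open>\<alpha> \<in> \<Delta>\<close> by (auto simp: above_def cf_diff)
  ultimately show ?thesis using that descend refl_simple_Orb assms(1)
    by (metis inner_commute zero_less_mult_pos less_eq_real_def mult_zero_left)
qed

text \<open>Dual to \<open>ex_descend\<close>: here z \<bullet> (x - z) < 0, so some simple root is
  negative on z.\<close>

lemma ex_ascend:
  assumes "x \<in> Orb" "z \<in> Orb" "x \<succ> z"
  obtains \<alpha> where "\<alpha> \<in> \<Delta>" "\<alpha> \<bullet> refl \<alpha> z > 0" "refl \<alpha> z \<succ> z" "refl \<alpha> z \<in> Orb"
proof -
  have "z \<bullet> (x - z) < 0" using inner_less_norm[OF assms(2,1)] assms by (auto simp: above_def inner_diff_right)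
  moreover have "z \<bullet> (x - z) = (\<Sum>\<alpha>\<in>\<Delta>. cf \<alpha> (x - z) * (z \<bullet> \<alpha>))" by (rule inner_cf)
  ultimately have "\<not> 0 \<le> (\<Sum>\<alpha>\<in>\<Delta>. cf \<alpha> (x - z) * (z \<bullet> \<alpha>))" by simp
  then obtain \<alpha> where \<alpha>: "\<alpha> \<in> \<Delta>" "cf \<alpha> (x - z) * (z \<bullet> \<alpha>) < 0"
    using sum_nonneg[of \<Delta> "\<lambda>\<alpha>. cf \<alpha> (x - z) * (z \<bullet> \<alpha>)"] not_less by blast
  moreover have "0 \<le> cf \<alpha> (x - z)" using assms(3) \<open>\<alpha> \<in> \<Delta>\<close> by (auto simp: above_def cf_diff)
  ultimately have "\<alpha> \<bullet> z < 0" by (simp add: mult_less_0_iff inner_commute)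
  then have "\<alpha> \<bullet> refl \<alpha> z > 0" by (simp add: inner_refl_self)
  then show ?thesis using that \<alpha>(1) descend[of \<alpha> "refl \<alpha> z"] refl_simple_Orb assms(2) by auto
qed

text \<open>Two elements swapped by a simple reflection are neighbours in the order: an element between
  them would lie on the segment joining them, which meets the sphere only at its ends.\<close>

lemma simple_covers:
  assumes \<alpha>: "\<alpha> \<in> \<Delta>" and Orb: "x \<in> Orb" "z \<in> Orb" and z: "x \<succ> z" "z \<succ> refl \<alpha> x"
  shows False
proof -
  define t where "t = cf \<alpha> (x - z)"
  let ?m = "2 * (\<alpha> \<bullet> x) / (\<alpha> \<bullet> \<alpha>)"
  have "cf \<gamma> (x - z) = 0" if "\<gamma> \<in> \<Delta>" "\<gamma> \<noteq> \<alpha>" for \<gamma>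
  proof -
    have "cf \<gamma> x - cf \<gamma> (refl \<alpha> x) = 0"
      using refl_eq_scale[of x \<alpha>] that \<alpha> by (metis cf_diff cf_scale cf_simple mult_zero_right)
    then show ?thesis using z that by (force simp: above_def cf_diff)
  qed
  then have "x - z = t *\<^sub>R \<alpha>"
    using \<alpha> by (intro cf_eqI) (auto simp: cf_scale cf_simple t_def)
  then have zx: "z = x - t *\<^sub>R \<alpha>" by (simp add: algebra_simps)
  have "x \<bullet> x = z \<bullet> z" using norm_Orb[OF Orb] by (simp add: norm_eq_sqrt_inner)
  also have "z \<bullet> z = x \<bullet> x - 2 * t * (\<alpha> \<bullet> x) + t * t * (\<alpha> \<bullet> \<alpha>)"
    unfolding zx by (simp add: inner_diff_left inner_diff_right inner_commute)
  finally have "t * (2 * (\<alpha> \<bullet> x) - t * (\<alpha> \<bullet> \<alpha>)) = 0" by (simp add: algebra_simps)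
  then consider "t = 0" | "t * (\<alpha> \<bullet> \<alpha>) = 2 * (\<alpha> \<bullet> x)" by force
  then show False
  proof cases
    case 1
    then show ?thesis using zx z(1) above_irrefl by simp
  next
    case 2
    then have "t = ?m" using simple_nonzero[OF \<alpha>] by (simp add: field_simps)
    then show ?thesis using zx z(2) above_irrefl by (simp add: refl_def)
  qed
qed

text \<open>Orthogonal \<open>\<alpha>\<close> and \<open>\<gamma>\<close> would give a second element, \<open>refl \<gamma> x\<close>, between \<open>x\<close> and \<open>z\<close>.\<close>

lemma consecutive_not_orthogonal:
  assumes Orb: "x \<in> Orb" and \<alpha>: "\<alpha> \<in> \<Delta>" "\<alpha> \<bullet> x > 0"
    and \<gamma>: "\<gamma> \<in> \<Delta>" "\<gamma> \<bullet> refl \<alpha> x > 0"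
    and only: "\<And>w. w \<in> Orb \<Longrightarrow> x \<succ> w \<Longrightarrow> w \<succ> refl \<gamma> (refl \<alpha> x) \<Longrightarrow> w = refl \<alpha> x"
  shows "\<alpha> \<bullet> \<gamma> \<noteq> 0"
proof
  assume o: "\<alpha> \<bullet> \<gamma> = 0"
  then have gx: "\<gamma> \<bullet> x > 0" using \<gamma> by (simp add: refl_def inner_diff_right inner_commute)
  have comm: "refl \<gamma> (refl \<alpha> x) = refl \<alpha> (refl \<gamma> x)"
    using o by (intro refl_commute) (simp add: orthogonal_def inner_commute)
  have "\<alpha> \<bullet> refl \<gamma> x > 0" using \<alpha> o by (simp add: refl_def inner_diff_right)
  then have "refl \<gamma> x \<succ> refl \<gamma> (refl \<alpha> x)" using descend \<alpha> comm by simp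
  then have "refl \<gamma> x = refl \<alpha> x"
    using only descend[OF \<gamma>(1) gx] refl_simple_Orb[OF \<gamma>(1) Orb] by blast
  then have "(2 * (\<gamma> \<bullet> x) / (\<gamma> \<bullet> \<gamma>)) *\<^sub>R \<gamma> = (2 * (\<alpha> \<bullet> x) / (\<alpha> \<bullet> \<alpha>)) *\<^sub>R \<alpha>"
    by (simp add: refl_def)
  then have "((2 * (\<gamma> \<bullet> x) / (\<gamma> \<bullet> \<gamma>)) *\<^sub>R \<gamma>) \<bullet> \<gamma> = 0" using o by simp
  then show False using gx simple_nonzero[OF \<gamma>(1)] by simp
qed

lemma not_orthogonal_opp:
  assumes "\<alpha> \<in> D \<epsilon>" "\<gamma> \<in> \<Delta>" "\<alpha> \<bullet> \<gamma> \<noteq> 0" "\<alpha> \<noteq> \<gamma>"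
  shows "\<gamma> \<in> D (opp \<epsilon>)"
  using assms D_orthogonal simple_opp by blast

end

text \<open>One locale covers both shapes of the order. Either \<open>Q\<close> is empty, or
  \<open>Q = {q, - q}\<close> sits between \<open>x M\<close> and \<open>x (Suc M)\<close>. The
  value \<open>e i\<close> is the class of the simple reflections leading down from
  \<open>x i\<close>; it is defined for all i because the classes beyond the ends,
  \<open>e 0\<close> and \<open>e N\<close>, are those that fix \<open>x 1\<close> and
  \<open>x N\<close>. The assumption \<open>only\<close> says that there are no further
  moves.\<close>

locale snake = root_orbit +
  fixes N M :: nat and x :: "nat \<Rightarrow> 'a::euclidean_space" and Q :: "'a set" and e :: "nat \<Rightarrow> pm"
  assumes N_ge: "3 \<le> N"
    and e_Suc: "e (Suc i) = opp (e i)"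
    and Orb_eq: "Orb = x ` {1..N} \<union> Q"
    and x_above: "\<lbrakk>1 \<le> i; i < j; j \<le> N\<rbrakk> \<Longrightarrow> x i \<succ> x j"
    and x_notin_Q: "\<lbrakk>1 \<le> i; i \<le> N\<rbrakk> \<Longrightarrow> x i \<notin> Q"
    and step: "\<lbrakk>1 \<le> i; i < N; Q = {} \<or> i \<noteq> M\<rbrakk> \<Longrightarrow> \<exists>\<alpha>\<in>D (e i). refl \<alpha> (x i) = x (Suc i) \<and> 0 < \<alpha> \<bullet> x i"
    and only: "\<lbrakk>\<alpha> \<in> simples D; y \<in> Orb; 0 < \<alpha> \<bullet> y\<rbrakk> \<Longrightarrow>
      (\<exists>i. 1 \<le> i \<and> i < N \<and> (Q = {} \<or> i \<noteq> M) \<and> y = x i \<and> refl \<alpha> y = x (Suc i)) \<or>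
      (y = x M \<and> refl \<alpha> y \<in> Q) \<or> (y \<in> Q \<and> refl \<alpha> y = x (Suc M))"
    and Q_pair: "q \<in> Q \<Longrightarrow> Q = {q, - q}"
    and Q_M: "Q \<noteq> {} \<Longrightarrow> N = 2 * M \<and> 2 \<le> M"
    and Q_minus: "\<lbrakk>Q \<noteq> {}; 1 \<le> i; i \<le> N\<rbrakk> \<Longrightarrow> x (Suc N - i) = - x i"
    and Q_step: "q \<in> Q \<Longrightarrow> \<exists>\<alpha>\<in>D (e M). refl \<alpha> (x M) = q \<and> 0 < \<alpha> \<bullet> x M"
    and Q_not: "\<lbrakk>Q \<noteq> {}; y \<in> Orb; \<beta> \<in> \<Phi>\<rbrakk> \<Longrightarrow> refl \<beta> y \<noteq> - y"

section \<open>Existence of the chain\<close>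

lemma opp_opp [simp]: "opp (opp \<epsilon>) = \<epsilon>"
  by (cases \<epsilon>) auto

lemma opp_neq [simp]: "opp \<epsilon> \<noteq> \<epsilon>" "\<epsilon> \<noteq> opp \<epsilon>"
  by (cases \<epsilon>; simp)+

context root_orbit
begin

text \<open>The order is total, so \<open>simple_covers\<close> makes a simple reflection move an
  element at most to a neighbour, and \<open>consecutive_not_orthogonal\<close> forces the classes
  of successive steps to alternate.\<close>

lemma chain_snake:
  assumes U: "\<And>y z. \<lbrakk>y \<in> Orb; z \<in> Orb; y \<noteq> z\<rbrakk> \<Longrightarrow> refl (y - z) \<in> W"
    and card: "3 \<le> card Orb"
  shows "\<exists>N M x Q e. snake W \<Phi> D Orb N M x Q e"
proof -
  have comp: "y \<succ> z \<or> z \<succ> y" if "y \<in> Orb" "z \<in> Orb" "y \<noteq> z" for y z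
    using comparable U that by blast
  have "inj_on height Orb"
    by (rule inj_onI) (use comp above_height in force)
  from enumerate_decreasing[OF finite_Orb this]
  obtain x where x: "bij_betw x {1..card Orb} Orb"
    "\<And>i j. 1 \<le> i \<Longrightarrow> i < j \<Longrightarrow> j \<le> card Orb \<Longrightarrow> height (x j) < height (x i)" by blast
  define N where "N = card Orb"
  have N: "3 \<le> N" using card by (simp add: N_def)
  have Orb: "Orb = x ` {1..N}" and inj: "inj_on x {1..N}"
    using x(1) by (auto simp: bij_betw_def N_def)
  have xin: "x i \<in> Orb" if "1 \<le> i" "i \<le> N" for i using that Orb by auto
  have ab: "x i \<succ> x j" if "1 \<le> i" "i < j" "j \<le> N" for i j
  proof -
    have "height (x j) < height (x i)" using x(2) that by (simp add: N_def)
    then show ?thesis using comp[of "x i" "x j"] above_height[of "x j" "x i"] xin that by force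
  qed
  have ab_iff: "i < j" if "1 \<le> i" "i \<le> N" "1 \<le> j" "j \<le> N" "x i \<succ> x j" for i j
    using that ab[of j i] above_asym above_irrefl by (metis linorder_neqE_nat)
  have nxt: "refl \<alpha> (x i) = x (Suc i)"
    if "1 \<le> i" "i \<le> N" "\<alpha> \<in> \<Delta>" "0 < \<alpha> \<bullet> x i" "i < N" for i \<alpha>
  proof -
    have "refl \<alpha> (x i) \<in> Orb" using that refl_simple_Orb xin by simp
    then obtain j where j: "1 \<le> j" "j \<le> N" "refl \<alpha> (x i) = x j" using Orb by auto
    have "i < j" using ab_iff[of i j] j that descend[of \<alpha> "x i"] by simp
    moreover have "\<not> Suc i < j"
      using simple_covers[of \<alpha> "x i" "x (Suc i)"] ab[of i "Suc i"] ab[of "Suc i" j] j that xin by auto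
    ultimately have "j = Suc i" by simp
    then show ?thesis using j by simp
  qed
  have lt: "i < N" if "1 \<le> i" "i \<le> N" "\<alpha> \<in> \<Delta>" "0 < \<alpha> \<bullet> x i" for i \<alpha>
  proof -
    have "refl \<alpha> (x i) \<in> Orb" using that refl_simple_Orb xin by simp
    then obtain j where j: "1 \<le> j" "j \<le> N" "refl \<alpha> (x i) = x j" using Orb by auto
    have "i < j" using ab_iff[of i j] j that descend[of \<alpha> "x i"] by simp
    then show ?thesis using j by simp
  qed
  have ex: "\<exists>\<alpha>\<in>\<Delta>. 0 < \<alpha> \<bullet> x i" if "1 \<le> i" "i < N" for i
    using ex_descend[of "x i" "x (Suc i)"] ab[of i "Suc i"] xin that by auto
  have alt: "\<gamma> \<in> D (opp \<epsilon>)" if i: "1 \<le> i" "Suc i < N" and \<alpha>: "\<alpha> \<in> D \<epsilon>" "0 < \<alpha> \<bullet> x i"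
    and \<gamma>: "\<gamma> \<in> \<Delta>" "0 < \<gamma> \<bullet> x (Suc i)" for i \<alpha> \<gamma> \<epsilon>
  proof -
    have r: "refl \<alpha> (x i) = x (Suc i)" and r2: "refl \<gamma> (x (Suc i)) = x (Suc (Suc i))"
      using nxt[of i \<alpha>] nxt[of "Suc i" \<gamma>] i \<alpha> \<gamma> D_simples by auto
    have "\<alpha> \<bullet> \<gamma> \<noteq> 0"
    proof (rule consecutive_not_orthogonal[of "x i"])
      fix w assume w: "w \<in> Orb" "x i \<succ> w" "w \<succ> refl \<gamma> (refl \<alpha> (x i))"
      obtain j where j: "1 \<le> j" "j \<le> N" "w = x j" using w(1) Orb by auto
      have "i < j" "j < Suc (Suc i)"
        using ab_iff[of i j] ab_iff[of j "Suc (Suc i)"] w j i r r2 by auto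
      then show "w = refl \<alpha> (x i)" using j r by (metis less_antisym not_less_eq)
    qed (use i \<alpha> \<gamma> xin D_simples r in auto)
    moreover have "\<alpha> \<noteq> \<gamma>" using inner_refl_self[of \<alpha> "x i"] \<alpha> \<gamma> r by auto
    ultimately show ?thesis using not_orthogonal_opp \<alpha> \<gamma> by blast
  qed
  obtain \<alpha>1 where \<alpha>1: "\<alpha>1 \<in> \<Delta>" "0 < \<alpha>1 \<bullet> x 1" using ex[of 1] N by auto
  obtain \<epsilon>1 where \<epsilon>1: "\<alpha>1 \<in> D \<epsilon>1" using \<alpha>1 in_simples_iff by blast
  define e where "e i = (if odd i then \<epsilon>1 else opp \<epsilon>1)" for i :: nat
  have "\<exists>\<alpha>\<in>D (e i). 0 < \<alpha> \<bullet> x i" if "1 \<le> i" "i < N" for i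
    using that
  proof (induction i rule: dec_induct)
    case base
    then show ?case using \<alpha>1 \<epsilon>1 by (auto simp: e_def)
  next
    case (step i)
    then obtain \<alpha> where \<alpha>: "\<alpha> \<in> D (e i)" "0 < \<alpha> \<bullet> x i" by auto
    obtain \<gamma> where \<gamma>: "\<gamma> \<in> \<Delta>" "0 < \<gamma> \<bullet> x (Suc i)" using ex[of "Suc i"] step by auto
    then have "\<gamma> \<in> D (opp (e i))" using alt[of i \<alpha> "e i" \<gamma>] \<alpha> step by simp
    then show ?case using \<gamma> by (auto simp: e_def)
  qed
  then have step: "\<exists>\<alpha>\<in>D (e i). refl \<alpha> (x i) = x (Suc i) \<and> 0 < \<alpha> \<bullet> x i" if "1 \<le> i" "i < N" for i
    using nxt that D_simples by (metis less_imp_le)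
  \<comment> \<open>With \<open>Q\<close> empty the middle index is a placeholder, set to 0.\<close>
  have "snake W \<Phi> D Orb N 0 x {} e"
  proof unfold_locales
    fix \<alpha> y assume "\<alpha> \<in> \<Delta>" "y \<in> Orb" "0 < \<alpha> \<bullet> y"
    then show "(\<exists>i\<ge>1. i < N \<and> ({} = {} \<or> i \<noteq> 0) \<and> y = x i \<and> refl \<alpha> y = x (Suc i)) \<or>
      y = x 0 \<and> refl \<alpha> y \<in> {} \<or> y \<in> {} \<and> refl \<alpha> y = x (Suc 0)"
      using nxt lt Orb by auto
  qed (use N Orb ab step in \<open>auto simp: e_def\<close>)
  then show ?thesis by blast
qed

text \<open>\<open>P\<close> collects the elements above their negatives, \<open>Q\<close> those
  incomparable with their negatives. The chain is \<open>P\<close> in decreasing order followed,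
  after the pair \<open>Q\<close>, by the negatives of \<open>P\<close> in reverse, so that index 2M
  + 1 - i belongs to the negative of index i.\<close>

lemma origin_snake:
  assumes sym: "\<And>y. y \<in> Orb \<Longrightarrow> - y \<in> Orb"
    and U: "\<And>y z. \<lbrakk>y \<in> Orb; z \<in> Orb; y \<noteq> z; y \<noteq> - z\<rbrakk> \<Longrightarrow> refl (y - z) \<in> W"
    and R: "\<And>y. y \<in> Orb \<Longrightarrow> refl y \<notin> W"
    and card: "6 \<le> card Orb"
  shows "\<exists>N M x Q e. snake W \<Phi> D Orb N M x Q e"
proof -
  have comp: "y \<succ> z \<or> z \<succ> y" if "y \<in> Orb" "z \<in> Orb" "y \<noteq> z" "y \<noteq> - z" for y z
    using comparable U that by blast
  \<comment> \<open>An orbit element on a root line would have its own reflection in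
    \<open>W\<close>, which \<open>R\<close> forbids.\<close>
  have not_multiple: False if "\<gamma> \<in> \<Phi>" "y \<in> Orb" "y = k *\<^sub>R \<gamma>" for \<gamma> y k
  proof -
    have "y \<noteq> 0"
    proof
      assume "y = 0"
      then have "Orb \<subseteq> {0}" using norm_Orb[OF that(2)] by auto
      then have "card Orb \<le> 1" using card_mono[of "{0::'a}" Orb] by simp
      then show False using card by simp
    qed
    then have "refl y = refl \<gamma>" using that(3) refl_scaleR by force
    then show False using R that root_refl by metis
  qed
  have not_refl: False if "\<gamma> \<in> \<Phi>" "y \<in> Orb" "refl \<gamma> y = - y" for \<gamma> y
  proof -
    have "2 *\<^sub>R y = (2 * (\<gamma> \<bullet> y) / (\<gamma> \<bullet> \<gamma>)) *\<^sub>R \<gamma>"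
      using refl_eq_scale[of y \<gamma>] that(3) by (simp add: scaleR_2)
    then have "(1/2) *\<^sub>R 2 *\<^sub>R y = (1/2) *\<^sub>R (2 * (\<gamma> \<bullet> y) / (\<gamma> \<bullet> \<gamma>)) *\<^sub>R \<gamma>" by (rule arg_cong)
    then have "y = ((\<gamma> \<bullet> y) / (\<gamma> \<bullet> \<gamma>)) *\<^sub>R \<gamma>" by simp
    then show False using not_multiple that by blast
  qed
  define P where "P = {y \<in> Orb. y \<succ> - y}"
  define Q where "Q = {y \<in> Orb. \<not> y \<succ> - y \<and> \<not> - y \<succ> y}"
  have Qm: "- q \<in> Q" if "q \<in> Q" for q using that sym by (auto simp: Q_def)
  have Q2: "y = q \<or> y = - q" if "q \<in> Q" "y \<in> Q" for q y
  proof (rule ccontr)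
    assume n: "\<not> (y = q \<or> y = - q)"
    have O: "y \<in> Orb" "q \<in> Orb" "- q \<in> Orb" using that sym by (auto simp: Q_def)
    \<comment> \<open>Both comparisons exist. Negating one of them and composing with the other
      makes y or q comparable with its own negative.\<close>
    have "y \<succ> q \<or> q \<succ> y" "y \<succ> - q \<or> - q \<succ> y"
      using comp[of y q] comp[of y "- q"] n O by auto
    then have "y \<succ> - y \<or> - q \<succ> q \<or> q \<succ> - q \<or> - y \<succ> y"
      using above_trans above_minus by (metis minus_minus)
    then show False using that by (auto simp: Q_def)
  qed
  have split: "y \<in> P \<or> - y \<in> P \<or> y \<in> Q" if "y \<in> Orb" for y
    using that sym by (auto simp: P_def Q_def)
  have P_Orb: "y \<in> Orb" if "y \<in> P" for y using that by (simp add: P_def)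
  have P_cf: "0 \<le> cf \<gamma> y" if "y \<in> P" "\<gamma> \<in> \<Delta>" for y \<gamma>
    using that by (auto simp: P_def above_def cf_minus)
  have Pm: "- y \<notin> P" if "y \<in> P" for y using that above_asym by (auto simp: P_def)
  have PQ: "a \<succ> q" if "a \<in> P" "q \<in> Q" for a q
  proof -
    have "a \<noteq> q" "a \<noteq> - q" using that Qm by (auto simp: P_def Q_def)
    then have "a \<succ> q \<or> q \<succ> a" using comp[of a q] that by (auto simp: P_def Q_def)
    moreover have "\<not> q \<succ> a"
      using that above_trans[of q a "- a"] above_minus[of q a] above_trans[of q "- a" "- q"]
      by (auto simp: P_def Q_def)
    ultimately show ?thesis by blast
  qed
  have QP: "q \<succ> - a" if "a \<in> P" "q \<in> Q" for a q
    using above_minus[OF PQ[OF that(1) Qm[OF that(2)]]] by simp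
  have finP: "finite P" using finite_Orb by (simp add: P_def)
  have compP: "y \<succ> z \<or> z \<succ> y" if "y \<in> P" "z \<in> P" "y \<noteq> z" for y z
    using comp[of y z] that Pm[of z] P_Orb by auto
  have "inj_on height P"
    by (rule inj_onI) (use compP above_height in force)
  from enumerate_decreasing[OF finP this]
  obtain z where z: "bij_betw z {1..card P} P"
    "\<And>i j. 1 \<le> i \<Longrightarrow> i < j \<Longrightarrow> j \<le> card P \<Longrightarrow> height (z j) < height (z i)" by blast
  define M where "M = card P"
  have Pz: "P = z ` {1..M}" using z(1) by (auto simp: bij_betw_def M_def)
  have zP: "z i \<in> P" if "1 \<le> i" "i \<le> M" for i using that Pz by auto
  have zab: "z i \<succ> z j" if "1 \<le> i" "i < j" "j \<le> M" for i j
  proof -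
    have "height (z j) < height (z i)" using z(2) that by (simp add: M_def)
    then show ?thesis using compP[of "z i" "z j"] above_height[of "z j" "z i"] zP that by force
  qed
  have cardQ: "card Q \<le> 2"
  proof (cases "Q = {}")
    case False
    then obtain q where "q \<in> Q" by blast
    then have "Q \<subseteq> {q, - q}" using Q2 by blast
    then have "card Q \<le> card {q, - q}" by (intro card_mono) auto
    also have "\<dots> \<le> 2" by (simp add: card_insert_if)
    finally show ?thesis .
  qed simp
  have "Orb \<subseteq> P \<union> uminus ` P \<union> Q" using split by (auto simp: image_iff) (metis minus_minus)
  then have "card Orb \<le> card (P \<union> uminus ` P \<union> Q)"
    using finP finite_Orb by (intro card_mono) (auto simp: Q_def)
  also have "\<dots> \<le> card P + card (uminus ` P) + card Q"
    by (meson add_mono card_Un_le le_refl order_trans)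
  also have "\<dots> \<le> 2 * M + 2" using card_image_le[OF finP, of uminus] cardQ by (simp add: M_def)
  \<comment> \<open>At most two of the six elements lie in \<open>Q\<close>; the other four are
    shared equally by \<open>P\<close> and its negatives. This is the origin of the bound 6.\<close>
  finally have M: "2 \<le> M" using card by simp
  have zmin: False if y: "z M \<succ> y" "y \<in> P" for y
  proof -
    obtain j where j: "1 \<le> j" "j \<le> M" "y = z j" using y Pz by auto
    then show False using y zab[of j M] above_asym above_irrefl by (cases "j = M") auto
  qed
  \<comment> \<open>Were \<open>Q\<close> empty, the lowest element of \<open>P\<close> would
    descend directly to the negative of an element of \<open>P\<close>. Comparing coordinates leaves
    it at most one nonzero coordinate, so it would be a multiple of a simple root.\<close>
  have "Q \<noteq> {}"
  proof
    assume Qe: "Q = {}"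
    have zM: "z M \<in> P" "z M \<in> Orb" "z M \<succ> - z M" using zP[of M] M by (auto simp: P_def)
    obtain \<alpha> where \<alpha>: "\<alpha> \<in> \<Delta>" "\<alpha> \<bullet> z M > 0" "z M \<succ> refl \<alpha> (z M)" "refl \<alpha> (z M) \<in> Orb"
      using ex_descend[OF zM(2) sym[OF zM(2)] zM(3)] by blast
    let ?y = "refl \<alpha> (z M)"
    have "?y \<notin> P" using zmin \<alpha> by blast
    then have yP: "- ?y \<in> P" using split[OF \<alpha>(4)] Qe by blast
    then have le: "cf \<gamma> (z M) \<le> cf \<gamma> (- ?y)" if "\<gamma> \<in> \<Delta>" for \<gamma>
    proof (cases "- ?y = z M")
      case False
      then have "- ?y \<succ> z M" using compP[of "z M" "- ?y"] zmin[of "- ?y"] zM yP by auto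
      then show ?thesis using that by (simp add: above_def)
    qed simp
    have "cf \<gamma> (z M) = 0" if "\<gamma> \<in> \<Delta>" "\<gamma> \<noteq> \<alpha>" for \<gamma>
    proof -
      have "cf \<gamma> (z M) - cf \<gamma> ?y = 0"
        using refl_eq_scale[of "z M" \<alpha>] that \<alpha> by (metis cf_diff cf_scale cf_simple mult_zero_right)
      then show ?thesis using le[of \<gamma>] P_cf[OF zM(1), of \<gamma>] that by (simp add: cf_minus)
    qed
    then have "z M = cf \<alpha> (z M) *\<^sub>R \<alpha>"
      using \<alpha> by (intro cf_eqI) (auto simp: cf_scale cf_simple)
    then show False using not_multiple zM \<alpha> simples_roots by blast
  qed
  then obtain p where p: "p \<in> Q" by blast
  have Qp: "Q = {q, - q}" if "q \<in> Q" for q using that Q2 Qm by blast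
  define N where "N = 2 * M"
  define x where "x i = (if i \<le> M then z i else - z (Suc N - i))" for i
  have xP: "x i \<in> P" if "1 \<le> i" "i \<le> M" for i using zP that by (simp add: x_def)
  have xm: "x (Suc N - i) = - x i" if "1 \<le> i" "i \<le> N" for i
    using that by (auto simp: x_def N_def)
  have xnP: "- x i \<in> P" if "M < i" "i \<le> N" for i using zP[of "Suc N - i"] that by (simp add: x_def N_def)
  have xin: "x i \<in> Orb" if "1 \<le> i" "i \<le> N" for i
    using xP[of i] xnP[of i] sym[of "- x i"] P_Orb that by (cases "i \<le> M") auto
  have xQ: "x i \<succ> q" if "1 \<le> i" "i \<le> M" "q \<in> Q" for i q using PQ xP that by blast
  have Qx: "q \<succ> x i" if "M < i" "i \<le> N" "q \<in> Q" for i q using QP[OF xnP] that by force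
  have ab: "x i \<succ> x j" if "1 \<le> i" "i < j" "j \<le> N" for i j
  proof -
    consider "j \<le> M" | "i \<le> M" "M < j" | "M < i" by linarith
    then show ?thesis
    proof cases
      case 1 then show ?thesis using zab that by (simp add: x_def)
    next
      case 2 then show ?thesis using xQ[of i p] Qx[of j p] p above_trans that by blast
    next
      case 3 then show ?thesis using above_minus[OF zab[of "Suc N - j" "Suc N - i"]] that
        by (simp add: x_def N_def)
    qed
  qed
  have xnQ: "x i \<notin> Q" if "1 \<le> i" "i \<le> N" for i
    using xQ[of i "x i"] Qx[of i "x i"] that above_irrefl by (meson not_less)
  have Orb: "y \<in> Q \<or> (\<exists>i. 1 \<le> i \<and> i \<le> N \<and> y = x i)" if y: "y \<in> Orb" for y
  proof -
    consider "y \<in> P" | "- y \<in> P" | "y \<in> Q" using split y by blast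
    then show ?thesis
    proof cases
      case 1
      then obtain i where "1 \<le> i" "i \<le> M" "y = z i" using Pz by auto
      then show ?thesis by (intro disjI2 exI[of _ i]) (auto simp: x_def N_def)
    next
      case 2
      then obtain i where "1 \<le> i" "i \<le> M" "- y = z i" using Pz by auto
      moreover have "y = - z i" using \<open>- y = z i\<close> by (metis minus_minus)
      ultimately show ?thesis by (intro disjI2 exI[of _ "Suc N - i"]) (auto simp: x_def N_def)
    qed auto
  qed
  have QOrb: "q \<in> Orb" if "q \<in> Q" for q using that by (simp add: Q_def)
  have ab_iff: "i < j" if "1 \<le> i" "i \<le> N" "1 \<le> j" "j \<le> N" "x i \<succ> x j" for i j
    using that ab[of j i] above_asym above_irrefl by (metis linorder_neqE_nat)
  have xQ_iff: "i \<le> M" if "1 \<le> i" "i \<le> N" "q \<in> Q" "x i \<succ> q" for i q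
    using Qx[of i q] that above_asym by (meson not_less)
  have Qx_iff: "M < i" if "1 \<le> i" "i \<le> N" "q \<in> Q" "q \<succ> x i" for i q
    using xQ[of i q] that above_asym by (meson not_less)
  have QQ: "\<not> q \<succ> q'" if "q \<in> Q" "q' \<in> Q" for q q'
    using Q2[OF that(2,1)] that above_irrefl by (auto simp: Q_def)
  have only: "(\<exists>i. 1 \<le> i \<and> i < N \<and> i \<noteq> M \<and> y = x i \<and> refl \<alpha> y = x (Suc i)) \<or>
      (y = x M \<and> refl \<alpha> y \<in> Q) \<or> (y \<in> Q \<and> refl \<alpha> y = x (Suc M))"
    if \<alpha>: "\<alpha> \<in> \<Delta>" and y: "y \<in> Orb" and pos: "0 < \<alpha> \<bullet> y" for \<alpha> y
  proof -
    let ?w = "refl \<alpha> y"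
    have w: "?w \<in> Orb" "y \<succ> ?w" using refl_simple_Orb descend that by auto
    have cov: False if "v \<in> Orb" "y \<succ> v" "v \<succ> ?w" for v using simple_covers \<alpha> y that by blast
    consider i j where "1 \<le> i" "i \<le> N" "y = x i" "1 \<le> j" "j \<le> N" "?w = x j"
      | i where "1 \<le> i" "i \<le> N" "y = x i" "?w \<in> Q"
      | j where "y \<in> Q" "1 \<le> j" "j \<le> N" "?w = x j" | "y \<in> Q" "?w \<in> Q"
      using Orb[OF y] Orb[OF w(1)] by blast
    then show ?thesis
    proof cases
      case 1
      have ij: "i < j" using ab_iff 1 w by metis
      have "\<not> Suc i < j" using cov[of "x (Suc i)"] ab[of i "Suc i"] ab[of "Suc i" j] 1 xin by auto
      then have j: "j = Suc i" using ij by simp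
      \<comment> \<open>A direct step from \<open>x M\<close> to \<open>x (Suc M)\<close> would jump
        over \<open>p\<close>.\<close>
      have "i \<noteq> M" using cov[of p] xQ[of M p] Qx[of "Suc M" p] p QOrb 1 j by auto
      then show ?thesis using 1 j by auto
    next
      case 2
      have "i \<le> M" using xQ_iff 2 w by metis
      moreover have "\<not> i < M" using cov[of "x M"] ab[of i M] xQ[of M ?w] 2 xin[of M] by (auto simp: N_def)
      ultimately show ?thesis using 2 by (metis le_neq_implies_less)
    next
      case 3
      have "M < j" using Qx_iff 3 w by metis
      moreover have "\<not> Suc M < j"
        using cov[of "x (Suc M)"] ab[of "Suc M" j] Qx[of "Suc M" y] 3 xin[of "Suc M"] by auto
      ultimately show ?thesis using 3 by (metis Suc_lessI)
    next
      case 4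
      then show ?thesis using QQ w by blast
    qed
  qed
  have x_eq_iff: "i = j" if "1 \<le> i" "i \<le> N" "1 \<le> j" "j \<le> N" "x i = x j" for i j
    using ab[of i j] ab[of j i] that above_irrefl by (metis linorder_neqE_nat)
  have ex: "\<exists>\<alpha>\<in>\<Delta>. refl \<alpha> (x i) = x (Suc i) \<and> 0 < \<alpha> \<bullet> x i" if i: "1 \<le> i" "i < N" "i \<noteq> M" for i
  proof -
    obtain \<alpha> where \<alpha>: "\<alpha> \<in> \<Delta>" "0 < \<alpha> \<bullet> x i"
      using ex_descend[of "x i" "x (Suc i)"] ab[of i "Suc i"] xin i by auto
    have "\<not> x i = x M" "x i \<notin> Q" using x_eq_iff[of i M] i M xnQ by (auto simp: N_def)
    then obtain i' where "1 \<le> i'" "i' < N" "x i = x i'" "refl \<alpha> (x i) = x (Suc i')"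
      using only[OF \<alpha>(1) xin \<alpha>(2)] i by auto
    then show ?thesis using x_eq_iff[of i i'] i \<alpha> by auto
  qed
  have exQ: "\<exists>\<alpha>\<in>\<Delta>. refl \<alpha> (x M) = q \<and> 0 < \<alpha> \<bullet> x M" if q: "q \<in> Q" for q
  proof -
    obtain \<alpha> where \<alpha>: "\<alpha> \<in> \<Delta>" "\<alpha> \<bullet> refl \<alpha> q > 0" "refl \<alpha> q \<in> Orb"
      using ex_ascend[of "x M" q] xin[of M] xQ[of M q] q QOrb M by (auto simp: N_def)
    have "refl \<alpha> q = x M"
      using only[OF \<alpha>(1,3,2)] xnQ[of "Suc M"] q M xnQ[of "Suc _"] by (auto simp: N_def)
    then show ?thesis using \<alpha> by (intro bexI[of _ \<alpha>]) (auto, metis refl_refl)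
  qed
  have adj: "\<alpha> \<bullet> \<gamma> \<noteq> 0 \<and> \<alpha> \<noteq> \<gamma>" if i: "1 \<le> i" "i < M" and \<alpha>: "\<alpha> \<in> \<Delta>" "refl \<alpha> (x i) = x (Suc i)" "0 < \<alpha> \<bullet> x i"
    and \<gamma>: "\<gamma> \<in> \<Delta>" "0 < \<gamma> \<bullet> x (Suc i)"
    and r: "Suc i < M \<and> refl \<gamma> (x (Suc i)) = x (Suc (Suc i)) \<or> Suc i = M \<and> refl \<gamma> (x (Suc i)) \<in> Q" for i \<alpha> \<gamma>
  proof
    show "\<alpha> \<noteq> \<gamma>" using inner_refl_self[of \<alpha> "x i"] \<alpha> \<gamma> by auto
    show "\<alpha> \<bullet> \<gamma> \<noteq> 0"
    proof (rule consecutive_not_orthogonal[of "x i"])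
      fix w assume w: "w \<in> Orb" "x i \<succ> w" "w \<succ> refl \<gamma> (refl \<alpha> (x i))"
      consider "w \<in> Q" | j where "1 \<le> j" "j \<le> N" "w = x j" using Orb[OF w(1)] by blast
      then show "w = refl \<alpha> (x i)"
      proof cases
        case 1
        then have False using w(3) r \<alpha>(2) QQ xQ[of "Suc (Suc i)" w] above_asym by (auto simp: Suc_leI)
        then show ?thesis ..
      next
        case 2
        have "i < j" using ab_iff[of i j] w 2 i by (auto simp: N_def)
        moreover have "j < Suc (Suc i)"
          using r
        proof
          assume "Suc i < M \<and> refl \<gamma> (x (Suc i)) = x (Suc (Suc i))"
          then show ?thesis using ab_iff[of j "Suc (Suc i)"] w 2 \<alpha> i by (auto simp: N_def)
        next
          assume "Suc i = M \<and> refl \<gamma> (x (Suc i)) \<in> Q"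
          then show ?thesis using xQ_iff[of j "refl \<gamma> (x (Suc i))"] w 2 \<alpha> by auto
        qed
        ultimately show ?thesis using 2 \<alpha> by (metis less_antisym not_less_eq)
      qed
    qed (use i \<alpha> \<gamma> xin in \<open>auto simp: N_def\<close>)
  qed
  obtain \<alpha>p where \<alpha>p: "\<alpha>p \<in> \<Delta>" "refl \<alpha>p (x M) = p" "0 < \<alpha>p \<bullet> x M" using exQ p by blast
  obtain \<epsilon>M where \<epsilon>M: "\<alpha>p \<in> D \<epsilon>M" using \<alpha>p in_simples_iff by blast
  \<comment> \<open>The alternation is anchored at the step into \<open>Q\<close> and carried from
    there to smaller indices; indices above M follow by negation.\<close>
  define e where "e i = (if even (i + M) then \<epsilon>M else opp \<epsilon>M)" for i
  have e_Suc: "e (Suc i) = opp (e i)" for i by (simp add: e_def)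
  have below: "\<alpha> \<in> D (e i)" if "1 \<le> i" "i < M" "\<alpha> \<in> \<Delta>" "refl \<alpha> (x i) = x (Suc i)" "0 < \<alpha> \<bullet> x i" for i \<alpha>
    using that
  proof (induction "M - i" arbitrary: i \<alpha>)
    case (Suc k)
    show ?case
    proof (cases "Suc i = M")
      case True
      have "\<alpha> \<bullet> \<alpha>p \<noteq> 0" "\<alpha> \<noteq> \<alpha>p" using adj[of i \<alpha> \<alpha>p] True \<alpha>p p Suc.prems by auto
      then have "\<alpha> \<in> D (opp \<epsilon>M)"
        using not_orthogonal_opp[OF \<epsilon>M, of \<alpha>] Suc.prems by (auto simp: inner_commute)
      moreover have "e i = opp \<epsilon>M" using True by (auto simp: e_def)
      ultimately show ?thesis by simp
    next
      case False
      then have i: "1 \<le> Suc i" "Suc i < M" "Suc i < N" using Suc.prems by (auto simp: N_def)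
      obtain \<gamma> where \<gamma>: "\<gamma> \<in> \<Delta>" "refl \<gamma> (x (Suc i)) = x (Suc (Suc i))" "0 < \<gamma> \<bullet> x (Suc i)"
        using ex[of "Suc i"] i by auto
      have "\<gamma> \<in> D (e (Suc i))" using Suc.hyps(1)[of "Suc i" \<gamma>] Suc.hyps(2) i \<gamma> by auto
      moreover have "\<alpha> \<bullet> \<gamma> \<noteq> 0" "\<alpha> \<noteq> \<gamma>" using adj[of i \<alpha> \<gamma>] i \<gamma> Suc.prems by auto
      ultimately show ?thesis
        using not_orthogonal_opp[of \<gamma> "e (Suc i)" \<alpha>] Suc.prems e_Suc by (auto simp: inner_commute)
    qed
  qed simp
  have middle: "\<alpha> \<in> D (e M)" if "\<alpha> \<in> \<Delta>" "refl \<alpha> (x M) \<in> Q" "0 < \<alpha> \<bullet> x M" for \<alpha>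
  proof -
    have i: "1 \<le> M - 1" "M - 1 < M" "M - 1 < N" "Suc (M - 1) = M" using M by (auto simp: N_def)
    obtain \<gamma> where \<gamma>: "\<gamma> \<in> \<Delta>" "refl \<gamma> (x (M - 1)) = x M" "0 < \<gamma> \<bullet> x (M - 1)"
      using ex[of "M - 1"] i by (metis nat_neq_iff)
    have "\<gamma> \<bullet> \<alpha> \<noteq> 0 \<and> \<gamma> \<noteq> \<alpha>" using adj[of "M - 1" \<gamma> \<alpha>] \<gamma> that i by simp
    moreover have "\<gamma> \<in> D (e (M - 1))" using below[of "M - 1" \<gamma>] i \<gamma> by simp
    ultimately show ?thesis using not_orthogonal_opp that e_Suc[of "M - 1"] i(4) by metis
  qed
  have "snake W \<Phi> D Orb N M x Q e"
  proof unfold_locales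
    show "3 \<le> N" using M by (simp add: N_def)
    show "Orb = x ` {1..N} \<union> Q" using Orb xin QOrb by force
    show "Q \<noteq> {} \<Longrightarrow> N = 2 * M \<and> 2 \<le> M" using M by (simp add: N_def)
    show "Q \<noteq> {} \<Longrightarrow> y \<in> Orb \<Longrightarrow> \<beta> \<in> \<Phi> \<Longrightarrow> refl \<beta> y \<noteq> - y" for y \<beta> using not_refl by blast
    show "\<exists>\<alpha>\<in>D (e M). refl \<alpha> (x M) = q \<and> 0 < \<alpha> \<bullet> x M" if "q \<in> Q" for q
      using exQ[OF that] middle that by blast
    show "(\<exists>i\<ge>1. i < N \<and> (Q = {} \<or> i \<noteq> M) \<and> y = x i \<and> refl \<alpha> y = x (Suc i)) \<or>
      y = x M \<and> refl \<alpha> y \<in> Q \<or> y \<in> Q \<and> refl \<alpha> y = x (Suc M)"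
      if "\<alpha> \<in> \<Delta>" "y \<in> Orb" "0 < \<alpha> \<bullet> y" for \<alpha> y
      using only[OF that] by blast
    show "\<exists>\<alpha>\<in>D (e i). refl \<alpha> (x i) = x (Suc i) \<and> 0 < \<alpha> \<bullet> x i"
      if i: "1 \<le> i" "i < N" "Q = {} \<or> i \<noteq> M" for i
    proof -
      have iM: "i \<noteq> M" using i p by auto
      obtain \<alpha> where \<alpha>: "\<alpha> \<in> \<Delta>" "refl \<alpha> (x i) = x (Suc i)" "0 < \<alpha> \<bullet> x i" using ex i iM by blast
      have "\<alpha> \<in> D (e i)"
      proof (cases "i < M")
        case False
        \<comment> \<open>Negation turns the step from i to i + 1 into the step from N - i to N + 1
          - i. Both have the same class because N = 2M is even.\<close>
        let ?j = "N - i"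
        have j: "1 \<le> ?j" "?j < M" "Suc ?j = Suc N - i" "Suc N - Suc i = ?j" "even (?j + M) = even (i + M)"
          using i iM False by (auto simp: N_def)
        have x1: "x ?j = - x (Suc i)" "x (Suc ?j) = - x i"
          using xm[of "Suc i"] xm[of i] i j by auto
        have "refl \<alpha> (x ?j) = x (Suc ?j)"
          unfolding x1 \<alpha>(2)[symmetric] by (simp add: refl_minus)
        moreover have "0 < \<alpha> \<bullet> x ?j"
          unfolding x1 \<alpha>(2)[symmetric] using \<alpha>(3) by (simp add: inner_refl_self)
        ultimately have "\<alpha> \<in> D (e ?j)" using below[of ?j \<alpha>] j \<alpha> by blast
        then show ?thesis using j by (simp add: e_def)
      qed (use below i \<alpha> in blast)
      then show ?thesis using \<alpha> by blast
    qed
  qed (use ab xnQ Qp xm e_Suc in auto)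
  then show ?thesis by blast
qed

end

section \<open>The action of the simple reflections on the chain\<close>

context bipartite_roots
begin

text \<open>\<open>cox\<close> displaces a vector by the sum of the displacements under the single
  reflections, so only those that move it count.\<close>

lemma cox_single:
  assumes "\<alpha> \<in> D \<epsilon>" "\<And>\<gamma>. \<gamma> \<in> D \<epsilon> \<Longrightarrow> \<gamma> \<noteq> \<alpha> \<Longrightarrow> refl \<gamma> v = v"
  shows "cox D \<epsilon> v = refl \<alpha> v"
proof -
  have "(\<Sum>\<gamma>\<in>D \<epsilon>. v - refl \<gamma> v) = (\<Sum>\<gamma>\<in>{\<alpha>}. v - refl \<gamma> v)"
    using assms finite_D by (intro sum.mono_neutral_right) auto
  then show ?thesis by (simp add: cox_eq_refl)
qed

lemma cox_double:
  assumes "\<alpha> \<in> D \<epsilon>" "\<delta> \<in> D \<epsilon>" "\<alpha> \<noteq> \<delta>" "\<And>\<gamma>. \<gamma> \<in> D \<epsilon> \<Longrightarrow> \<gamma> \<noteq> \<alpha> \<Longrightarrow> \<gamma> \<noteq> \<delta> \<Longrightarrow> refl \<gamma> v = v"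
  shows "cox D \<epsilon> v = refl \<alpha> v + refl \<delta> v - v"
proof -
  have "(\<Sum>\<gamma>\<in>D \<epsilon>. v - refl \<gamma> v) = (\<Sum>\<gamma>\<in>{\<alpha>,\<delta>}. v - refl \<gamma> v)"
    using assms finite_D by (intro sum.mono_neutral_right) auto
  then show ?thesis using assms(3) by (simp add: cox_eq_refl algebra_simps)
qed

lemma cox_no_move:
  assumes "\<And>\<gamma>. \<gamma> \<in> D \<epsilon> \<Longrightarrow> refl \<gamma> v = v"
  shows "cox D \<epsilon> v = v"
  using assms by (simp add: cox_eq_refl)

text \<open>The displacement points along the simple root, and distinct simple roots are
  independent.\<close>

lemma simple_unique:
  assumes "\<alpha> \<in> \<Delta>" "\<gamma> \<in> \<Delta>" "refl \<alpha> y = refl \<gamma> y" "refl \<alpha> y \<noteq> y"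
  shows "\<alpha> = \<gamma>"
proof (rule ccontr)
  assume n: "\<alpha> \<noteq> \<gamma>"
  have "(2 * (\<alpha> \<bullet> y) / (\<alpha> \<bullet> \<alpha>)) *\<^sub>R \<alpha> = (2 * (\<gamma> \<bullet> y) / (\<gamma> \<bullet> \<gamma>)) *\<^sub>R \<gamma>"
    using assms(3) by (simp add: refl_def)
  then have "cf \<alpha> ((2 * (\<alpha> \<bullet> y) / (\<alpha> \<bullet> \<alpha>)) *\<^sub>R \<alpha>) = cf \<alpha> ((2 * (\<gamma> \<bullet> y) / (\<gamma> \<bullet> \<gamma>)) *\<^sub>R \<gamma>)" by simp
  then have "\<alpha> \<bullet> y = 0" using n assms simple_nonzero by (simp add: cf_scale cf_simple)
  then show False using assms(4) refl_fix_iff by blast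
qed

end

context snake
begin

lemma x_in: "1 \<le> i \<Longrightarrow> i \<le> N \<Longrightarrow> x i \<in> Orb" and Q_in: "q \<in> Q \<Longrightarrow> q \<in> Orb"
  using Orb_eq by auto

lemma Orb_cases [consumes 1, case_names x Q]:
  assumes "y \<in> Orb" obtains i where "1 \<le> i" "i \<le> N" "y = x i" | "y \<in> Q"
  using assms Orb_eq by auto

lemma Q_uminus: "q \<in> Q \<Longrightarrow> - q \<in> Q"
  using Q_pair by blast

lemma Q_cases: "q \<in> Q \<Longrightarrow> q' \<in> Q \<Longrightarrow> q' = q \<or> q' = - q"
  using Q_pair by blast

lemma N_eq: "q \<in> Q \<Longrightarrow> N = 2 * M" and M_ge: "q \<in> Q \<Longrightarrow> 2 \<le> M"
  using Q_M by auto

lemma x_Suc_M: "q \<in> Q \<Longrightarrow> x (Suc M) = - x M"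
proof -
  assume q: "q \<in> Q"
  then have "Suc N - M = Suc M" "1 \<le> M" "M \<le> N" using N_eq M_ge by fastforce+
  then show ?thesis using Q_minus[of M] q by auto
qed

lemma Q_neq_minus: "q \<in> Q \<Longrightarrow> - q \<noteq> q"
proof
  assume "q \<in> Q" "- q = q"
  then have "q = 0" by (simp add: minus_eq_self_real_iff)
  moreover obtain \<beta> where "\<beta> \<in> \<Phi>" using Q_step[OF \<open>q \<in> Q\<close>] D_simples simples_roots by blast
  ultimately show False using Q_not[of q \<beta>] Q_in \<open>q \<in> Q\<close> by (auto simp: refl_def)
qed

lemma x_eq_iff: "1 \<le> i \<Longrightarrow> i \<le> N \<Longrightarrow> 1 \<le> j \<Longrightarrow> j \<le> N \<Longrightarrow> x i = x j \<longleftrightarrow> i = j"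
  using x_above above_irrefl by (metis linorder_neqE_nat)

lemma M_above_Q: "q \<in> Q \<Longrightarrow> x M \<succ> q"
  using Q_step descend D_simples by metis

lemma Q_above_M: "q \<in> Q \<Longrightarrow> q \<succ> x (Suc M)"
  using above_minus[OF M_above_Q[OF Q_uminus]] x_Suc_M by fastforce

lemma x_above_Q: "1 \<le> i \<Longrightarrow> i \<le> M \<Longrightarrow> q \<in> Q \<Longrightarrow> x i \<succ> q"
  using M_above_Q x_above[of i M] above_trans N_eq by (cases "i = M") auto

lemma Q_above_x: "M < i \<Longrightarrow> i \<le> N \<Longrightarrow> q \<in> Q \<Longrightarrow> q \<succ> x i"
  using Q_above_M x_above[of "Suc M" i] above_trans N_eq by (cases "i = Suc M") auto

lemma above_x_iff: "1 \<le> i \<Longrightarrow> i \<le> N \<Longrightarrow> 1 \<le> j \<Longrightarrow> j \<le> N \<Longrightarrow> x i \<succ> x j \<longleftrightarrow> i < j"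
  using x_above above_asym above_irrefl by (metis linorder_neqE_nat)

lemma x_above_Q_iff: "1 \<le> i \<Longrightarrow> i \<le> N \<Longrightarrow> q \<in> Q \<Longrightarrow> x i \<succ> q \<longleftrightarrow> i \<le> M"
  using x_above_Q Q_above_x above_asym by (meson not_less)

lemma Q_above_x_iff: "1 \<le> i \<Longrightarrow> i \<le> N \<Longrightarrow> q \<in> Q \<Longrightarrow> q \<succ> x i \<longleftrightarrow> M < i"
  using x_above_Q Q_above_x above_asym by (meson not_less)

lemma Q_step_unique:
  assumes "q \<in> Q" "\<gamma> \<in> \<Delta>" "refl \<gamma> (x M) = q"
  shows "\<gamma> \<in> D (e M) \<and> 0 < \<gamma> \<bullet> x M"
proof -
  obtain \<alpha> where \<alpha>: "\<alpha> \<in> D (e M)" "refl \<alpha> (x M) = q" "0 < \<alpha> \<bullet> x M" using Q_step assms by blast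
  have "q \<noteq> x M" using M_above_Q assms above_irrefl by blast
  then have "\<gamma> = \<alpha>" using simple_unique[of \<gamma> \<alpha> "x M"] assms \<alpha> D_simples by auto
  then show ?thesis using \<alpha> by simp
qed

text \<open>The name refers to the index: a positive inner product lowers \<open>x i\<close> in the
  order and raises its index. The class is known because \<open>step\<close> and
  \<open>Q_step\<close> provide a simple reflection with the same effect, and there is only
  one.\<close>

lemma simple_up:
  assumes "1 \<le> i" "i \<le> N" "\<gamma> \<in> \<Delta>" "0 < \<gamma> \<bullet> x i"
  shows "i < N \<and> \<gamma> \<in> D (e i) \<and>
    ((Q = {} \<or> i \<noteq> M) \<and> refl \<gamma> (x i) = x (Suc i) \<or> i = M \<and> refl \<gamma> (x i) \<in> Q)"
proof -
  consider j where "1 \<le> j" "j < N" "x i = x j" "refl \<gamma> (x i) = x (Suc j)" "Q = {} \<or> j \<noteq> M"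
    | "x i = x M" "refl \<gamma> (x i) \<in> Q" | "x i \<in> Q"
    using only[OF assms(3) x_in[OF assms(1,2)] assms(4)] by blast
  then show ?thesis
  proof cases
    case j: (1 j)
    then have "j = i" using x_eq_iff[of i j] assms by auto
    note j = j[unfolded this]
    obtain \<alpha> where \<alpha>: "\<alpha> \<in> D (e i)" "refl \<alpha> (x i) = x (Suc i)" using step[OF j(1,2,5)] by blast
    have "x (Suc i) \<noteq> x i" using x_eq_iff[of i "Suc i"] j by auto
    then have "\<gamma> = \<alpha>" using simple_unique[of \<gamma> \<alpha> "x i"] assms \<alpha> j D_simples by auto
    then show ?thesis using \<alpha> j by auto
  next
    case a: 2
    then have M: "1 \<le> M" "M < N" using N_eq M_ge by fastforce+
    then have "i = M" using a x_eq_iff[of i M] assms by auto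
    moreover have "\<gamma> \<in> D (e M)" using Q_step_unique[OF a(2) assms(3)] \<open>i = M\<close> by blast
    ultimately show ?thesis using a(2) M by blast
  qed (use x_notin_Q assms in auto)
qed

text \<open>The reflected point has positive inner product and falls under \<open>simple_up\<close>.
  If it lies in \<open>Q\<close>, negation turns the step from \<open>Q\<close> to
  \<open>x (Suc M)\<close> into one from \<open>x M\<close> to \<open>Q\<close>.\<close>

lemma simple_down:
  assumes "1 \<le> i" "i \<le> N" "\<gamma> \<in> \<Delta>" "\<gamma> \<bullet> x i < 0"
  shows "1 < i \<and> \<gamma> \<in> D (e (i - 1))"
proof -
  let ?y = "refl \<gamma> (x i)"
  have y: "?y \<in> Orb" "0 < \<gamma> \<bullet> ?y" using refl_simple_Orb x_in assms by (auto simp: inner_refl_self)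
  show ?thesis
    using y(1)
  proof (cases rule: Orb_cases)
    case (x j)
    have "x j \<succ> x i" using descend[OF assms(3) y(2)] unfolding x(3)[symmetric] by simp
    then have "j < i" using above_x_iff[of j i] x assms by auto
    have "j < N" "\<gamma> \<in> D (e j)" "(Q = {} \<or> j \<noteq> M) \<and> refl \<gamma> (x j) = x (Suc j) \<or> j = M \<and> refl \<gamma> (x j) \<in> Q"
      using simple_up[of j \<gamma>] x y assms by auto
    moreover have "refl \<gamma> (x j) = x i" using x by (metis refl_refl)
    ultimately have "x (Suc j) = x i" using x_notin_Q[OF assms(1,2)] by metis
    then have "Suc j = i" using x_eq_iff[of "Suc j" i] \<open>j < N\<close> assms by simp
    then show ?thesis using \<open>\<gamma> \<in> D (e j)\<close> x(1) by auto
  next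
    case Q
    then have M: "1 \<le> M" "M < N" using N_eq M_ge by fastforce+
    have "x i = x (Suc M)"
      using only[OF assms(3) y] Q x_notin_Q[of M] x_notin_Q M by auto
    then have i: "i = Suc M" using x_eq_iff[of i "Suc M"] assms(1,2) M by simp
    then have "refl \<gamma> (x M) = - ?y" using x_Suc_M[OF Q] by (simp add: refl_minus)
    then have "\<gamma> \<in> D (e M)" using Q_step_unique[of "- ?y" \<gamma>] Q_uminus Q assms by auto
    then show ?thesis using i M by auto
  qed
qed

lemma e_diff_1: "1 \<le> i \<Longrightarrow> e i = opp (e (i - 1))"
  using e_Suc[of "i - 1"] by simp

lemma simple_move:
  assumes "1 \<le> i" "i \<le> N" "\<gamma> \<in> D (e i)" "refl \<gamma> (x i) \<noteq> x i"
  shows "0 < \<gamma> \<bullet> x i"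
proof -
  have "\<not> \<gamma> \<bullet> x i < 0"
  proof
    assume "\<gamma> \<bullet> x i < 0"
    then have "\<gamma> \<in> D (e (i - 1))" using simple_down assms D_simples by blast
    then show False using D_disjoint[OF assms(3)] e_diff_1 assms by (metis opp_neq(1))
  qed
  moreover have "\<gamma> \<bullet> x i \<noteq> 0" using assms refl_fix_iff by blast
  ultimately show ?thesis by simp
qed

lemma cox_x: 
  assumes "1 \<le> i" "i < N"
  shows "cox D (e i) (x i) = x (Suc i)"
proof (cases "Q = {} \<or> i \<noteq> M")
  case True
  obtain \<alpha> where \<alpha>: "\<alpha> \<in> D (e i)" "refl \<alpha> (x i) = x (Suc i)" "0 < \<alpha> \<bullet> x i" using step assms True by blast
  have "cox D (e i) (x i) = refl \<alpha> (x i)"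
  proof (rule cox_single[OF \<alpha>(1)])
    fix \<gamma> assume \<gamma>: "\<gamma> \<in> D (e i)" "\<gamma> \<noteq> \<alpha>"
    show "refl \<gamma> (x i) = x i"
    proof (rule ccontr)
      assume m: "refl \<gamma> (x i) \<noteq> x i"
      then have "refl \<gamma> (x i) = x (Suc i)"
        using simple_up[of i \<gamma>] simple_move[of i \<gamma>] assms \<gamma> D_simples True by auto
      then show False using simple_unique[of \<gamma> \<alpha> "x i"] m \<alpha> \<gamma> D_simples by auto
    qed
  qed
  then show ?thesis using \<alpha> by simp
next
  case False
  then obtain q where q: "q \<in> Q" and i: "i = M" by auto
  obtain \<alpha> where \<alpha>: "\<alpha> \<in> D (e M)" "refl \<alpha> (x M) = q" using Q_step q by blast
  obtain \<delta> where \<delta>: "\<delta> \<in> D (e M)" "refl \<delta> (x M) = - q" using Q_step Q_uminus q by blast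
  \<comment> \<open>Two simple reflections of this class move \<open>x M\<close>, to q and to -q.
    Their displacements add up to -2 \<open>x M\<close>, so the product yields - \<open>x M\<close>,
    which is \<open>x (Suc M)\<close>.\<close>
  have "cox D (e M) (x M) = refl \<alpha> (x M) + refl \<delta> (x M) - x M"
  proof (rule cox_double[OF \<alpha>(1) \<delta>(1)])
    show "\<alpha> \<noteq> \<delta>" using Q_neq_minus[OF q] \<alpha> \<delta> by auto
    fix \<gamma> assume \<gamma>: "\<gamma> \<in> D (e M)" "\<gamma> \<noteq> \<alpha>" "\<gamma> \<noteq> \<delta>"
    show "refl \<gamma> (x M) = x M"
    proof (rule ccontr)
      assume m: "refl \<gamma> (x M) \<noteq> x M"
      then have "refl \<gamma> (x M) \<in> Q"
        using simple_up[of i \<gamma>] simple_move[of i \<gamma>] assms \<gamma> D_simples False by auto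
      then have "refl \<gamma> (x M) = q \<or> refl \<gamma> (x M) = - q" using Q_cases q by blast
      then show False using simple_unique[of \<gamma> \<alpha> "x M"] simple_unique[of \<gamma> \<delta> "x M"] m \<alpha> \<delta> \<gamma> D_simples by auto
    qed
  qed
  then show ?thesis using \<alpha> \<delta> i x_Suc_M[OF q] by simp
qed

lemma cox_x_Suc: "1 \<le> i \<Longrightarrow> i < N \<Longrightarrow> cox D (e i) (x (Suc i)) = x i"
  using cox_x[of i] cox_cox by metis

text \<open>Every simple reflection that moves \<open>x 1\<close> has class \<open>e 1\<close>, the
  opposite of \<open>e 0\<close>. The fixed points at both ends later pin down the angle in the
  Coxeter plane.\<close>

lemma cox_first: "cox D (e 0) (x 1) = x 1"
proof (rule cox_no_move, rule ccontr)
  fix \<gamma> assume \<gamma>: "\<gamma> \<in> D (e 0)" "refl \<gamma> (x 1) \<noteq> x 1"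
  then have "0 < \<gamma> \<bullet> x 1 \<or> \<gamma> \<bullet> x 1 < 0" using refl_fix_iff[of \<gamma> "x 1"] by linarith
  then have "\<gamma> \<in> D (e 1)" using simple_up[of 1 \<gamma>] simple_down[of 1 \<gamma>] N_ge \<gamma> D_simples by fastforce
  then show False using D_disjoint[OF \<gamma>(1)] e_Suc[of 0] by (metis One_nat_def opp_neq(2))
qed

lemma cox_last: "cox D (e N) (x N) = x N"
proof (rule cox_no_move, rule ccontr)
  fix \<gamma> assume \<gamma>: "\<gamma> \<in> D (e N)" "refl \<gamma> (x N) \<noteq> x N"
  then have "0 < \<gamma> \<bullet> x N" using simple_move[of N \<gamma>] N_ge by auto
  then show False using simple_up[of N \<gamma>] N_ge \<gamma> D_simples by auto
qed

lemma simple_move_Q: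
  assumes "q \<in> Q" "\<gamma> \<in> \<Delta>" "refl \<gamma> q \<noteq> q"
  shows "\<gamma> \<in> D (e M) \<and> (refl \<gamma> (x M) = q \<or> refl \<gamma> (x M) = - q)"
proof (cases "0 < \<gamma> \<bullet> q")
  case True
  have "refl \<gamma> q = x (Suc M)"
    using only[OF assms(2) Q_in[OF assms(1)] True] x_notin_Q[of M] x_notin_Q assms N_eq M_ge by fastforce
  then have "refl \<gamma> (- q) = x M" using x_Suc_M assms by (simp add: refl_minus)
  then have "refl \<gamma> (x M) = - q" by (metis refl_refl)
  then show ?thesis using Q_step_unique[of "- q" \<gamma>] Q_uminus assms by auto
next
  case False
  then have "\<gamma> \<bullet> q < 0" using assms(3) refl_fix_iff[of \<gamma> q] by linarith
  then have pos: "0 < \<gamma> \<bullet> refl \<gamma> q" by (simp add: inner_refl_self)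
  have "q \<noteq> x (Suc M)" "\<And>i. 1 \<le> i \<Longrightarrow> i < N \<Longrightarrow> q \<noteq> x (Suc i)"
    using x_notin_Q[of "Suc _"] assms N_eq M_ge by fastforce+
  then have "refl \<gamma> q = x M"
    using only[OF assms(2) refl_simple_Orb[OF assms(2) Q_in[OF assms(1)]] pos] by auto
  then have "refl \<gamma> (x M) = q" by (metis refl_refl)
  then show ?thesis using Q_step_unique assms by auto
qed

lemma cox_Q_opp: "q \<in> Q \<Longrightarrow> cox D (opp (e M)) q = q"
  using simple_move_Q D_simples D_disjoint by (intro cox_no_move) (metis opp_neq(2))

text \<open>Two simple reflections move q, to \<open>x M\<close> and to - \<open>x M\<close>, so
  their displacements add up to -2q.\<close>

lemma cox_Q: 
  assumes q: "q \<in> Q"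
  shows "cox D (e M) q = - q"
proof -
  obtain \<alpha> where \<alpha>: "\<alpha> \<in> D (e M)" "refl \<alpha> (x M) = q" using Q_step q by blast
  obtain \<delta> where \<delta>: "\<delta> \<in> D (e M)" "refl \<delta> (x M) = - q" using Q_step Q_uminus q by blast
  have "refl \<alpha> q = x M" "refl \<delta> (- q) = x M" using \<alpha> \<delta> by (metis refl_refl)+
  then have r: "refl \<alpha> q = x M" "refl \<delta> q = - x M" by (auto simp: refl_minus) (metis minus_minus)
  have "cox D (e M) q = refl \<alpha> q + refl \<delta> q - q"
  proof (rule cox_double[OF \<alpha>(1) \<delta>(1)])
    show "\<alpha> \<noteq> \<delta>" using Q_neq_minus[OF q] \<alpha> \<delta> by auto
    fix \<gamma> assume \<gamma>: "\<gamma> \<in> D (e M)" "\<gamma> \<noteq> \<alpha>" "\<gamma> \<noteq> \<delta>"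
    show "refl \<gamma> q = q"
    proof (rule ccontr)
      assume "refl \<gamma> q \<noteq> q"
      then have "refl \<gamma> (x M) = q \<or> refl \<gamma> (x M) = - q" using simple_move_Q q \<gamma> D_simples by blast
      moreover have "q \<noteq> x M" "- q \<noteq> x M" using M_above_Q q Q_uminus above_irrefl by metis+
      ultimately show False using simple_unique[of \<gamma> \<alpha> "x M"] simple_unique[of \<gamma> \<delta> "x M"] \<alpha> \<delta> \<gamma> D_simples by auto
    qed
  qed
  then show ?thesis using r by simp
qed

lemma cox_Q_in: "q \<in> Q \<Longrightarrow> cox D \<epsilon> q \<in> Q"
  using cox_Q cox_Q_opp Q_uminus by (cases "\<epsilon> = e M") (metis, metis opp.elims pm.exhaust)

lemma cox_Orb: "y \<in> Orb \<Longrightarrow> cox D \<epsilon> y \<in> Orb"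
  using refl_simple_Orb D_simples by (intro cox_closed) auto

section \<open>Coefficients of simple roots along the chain\<close>

lemma cf_mono: "1 \<le> i \<Longrightarrow> i \<le> j \<Longrightarrow> j \<le> N \<Longrightarrow> \<alpha> \<in> \<Delta> \<Longrightarrow> cf \<alpha> (x j) \<le> cf \<alpha> (x i)"
  using x_above[of i j] by (cases "i = j") (auto simp: above_def)

lemma cf_refl_less: "\<alpha> \<in> \<Delta> \<Longrightarrow> 0 < \<alpha> \<bullet> y \<Longrightarrow> cf \<alpha> (refl \<alpha> y) < cf \<alpha> y"
  using simple_nonzero by (simp add: refl_def cf_diff cf_scale cf_simple)

lemma cf_refl_eq: "\<gamma> \<in> \<Delta> \<Longrightarrow> \<alpha> \<noteq> \<gamma> \<Longrightarrow> cf \<alpha> (refl \<gamma> y) = cf \<alpha> y"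
  by (simp add: refl_def cf_diff cf_scale cf_simple)

text \<open>Neighbours differ by a multiple of one simple root, so a drop in the coefficient of
  \<alpha> identifies it. This is the link between drops along the chain and segments in the diagram
  of -\<alpha>.\<close>

lemma cf_step:
  assumes "1 \<le> i" "i < N" "Q = {} \<or> i \<noteq> M" "\<alpha> \<in> \<Delta>" "cf \<alpha> (x (Suc i)) < cf \<alpha> (x i)"
  shows "\<alpha> \<in> D (e i) \<and> refl \<alpha> (x i) = x (Suc i) \<and> 0 < \<alpha> \<bullet> x i"
proof -
  obtain \<gamma> where \<gamma>: "\<gamma> \<in> D (e i)" "refl \<gamma> (x i) = x (Suc i)" "0 < \<gamma> \<bullet> x i" using step assms by blast
  then have "\<alpha> = \<gamma>" using cf_refl_eq[of \<gamma> \<alpha> "x i"] assms D_simples by force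
  then show ?thesis using \<gamma> by simp
qed

lemma cf_Q_step:
  assumes "q \<in> Q" "\<alpha> \<in> \<Delta>" "cf \<alpha> q < cf \<alpha> (x M)"
  shows "\<alpha> \<in> D (e M) \<and> refl \<alpha> (x M) = q \<and> 0 < \<alpha> \<bullet> x M"
proof -
  obtain \<gamma> where \<gamma>: "\<gamma> \<in> D (e M)" "refl \<gamma> (x M) = q" "0 < \<gamma> \<bullet> x M" using Q_step assms by blast
  then have "\<alpha> = \<gamma>" using cf_refl_eq[of \<gamma> \<alpha> "x M"] assms D_simples by force
  then show ?thesis using \<gamma> by simp
qed

lemma cf_drop:
  assumes "1 \<le> i" "i < j" "j \<le> N" "\<alpha> \<in> \<Delta>" "cf \<alpha> (x j) < cf \<alpha> (x i)"
  obtains l where "i \<le> l" "l < j" "cf \<alpha> (x (Suc l)) < cf \<alpha> (x l)"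
proof -
  have "\<exists>l. i \<le> l \<and> l < j \<and> cf \<alpha> (x (Suc l)) < cf \<alpha> (x l)"
  proof (rule ccontr)
    assume "\<not> ?thesis"
    then have n: "cf \<alpha> (x l) \<le> cf \<alpha> (x (Suc l))" if "i \<le> l" "l < j" for l using that by force
    have "cf \<alpha> (x i) \<le> cf \<alpha> (x k)" if "i \<le> k" "k \<le> j" for k
      using that by (induction k rule: dec_induct) (use n in \<open>force+\<close>)
    then show False using assms by (meson leD le_refl less_imp_le)
  qed
  then show ?thesis using that by blast
qed

text \<open>A positive root moves y to a lower element, and the cases record where the two lie
  relative to \<open>Q\<close>. Antipodal pairs are ruled out by \<open>Q_not\<close>, which
  accounts for i + j \<noteq> N + 1 and for the absence of a case with both elements in
  \<open>Q\<close>.\<close>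

lemma Pos_pair [consumes 3, case_names xx xQ Qx]:
  assumes \<beta>: "\<beta> \<in> Pos" and y: "y \<in> Orb" and pos: "0 < \<beta> \<bullet> y"
  obtains i j where "1 \<le> i" "i < j" "j \<le> N" "y = x i" "refl \<beta> y = x j" "Q = {} \<or> i + j \<noteq> Suc N"
  | i where "1 \<le> i" "i \<le> M" "i \<le> N" "y = x i" "refl \<beta> y \<in> Q"
  | j where "M < j" "1 \<le> j" "j \<le> N" "y \<in> Q" "refl \<beta> y = x j"
proof -
  have \<Phi>: "\<beta> \<in> \<Phi>" using PosD \<beta> by blast
  have z: "refl \<beta> y \<in> Orb" using refl_Orb root_refl \<Phi> y by blast
  have ab: "y \<succ> refl \<beta> y" using Pos_descend \<beta> pos by blast
  show ?thesis
    using y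
  proof (cases rule: Orb_cases)
    case (x i)
    show ?thesis
      using z
    proof (cases rule: Orb_cases)
      case j: (x j)
      have "i < j" using above_x_iff[of i j] ab x j by simp
      moreover have "Q = {} \<or> i + j \<noteq> Suc N"
      proof (rule ccontr)
        assume a: "\<not> ?thesis"
        then have "x (Suc N - i) = - x i" "Suc N - i = j" using Q_minus[of i] x by auto
        then have "refl \<beta> y = - y" using x j by simp
        then show False using Q_not[OF _ y \<Phi>] a by blast
      qed
      ultimately show ?thesis using that(1) x j by blast
    next
      case Q
      then show ?thesis using that(2) x_above_Q_iff[of i] x ab by blast
    qed
  next
    case Q
    show ?thesis
      using z
    proof (cases rule: Orb_cases)
      case (x j)
      then show ?thesis using that(3) Q_above_x_iff[of j] Q ab by metis
    next
      case z: Q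
      then have "refl \<beta> y = - y" using Q_cases[OF Q z] ab above_irrefl by auto
      then show ?thesis using Q_not[OF _ y \<Phi>] Q by blast
    qed
  qed
qed

lemma ex_Pos_pair:
  assumes "\<beta> \<in> Pos" obtains y where "y \<in> Orb" "0 < \<beta> \<bullet> y"
proof -
  have "\<beta> \<noteq> 0" using root_nonzero PosD assms by blast
  then obtain y where y: "y \<in> Orb" "\<beta> \<bullet> y \<noteq> 0" using total_Orb[of \<beta>] by blast
  show ?thesis
  proof (cases "0 < \<beta> \<bullet> y")
    case False
    then have "0 < \<beta> \<bullet> refl \<beta> y" using y by (simp add: inner_refl_self)
    moreover have "refl \<beta> y \<in> Orb" using refl_Orb root_refl PosD assms y by blast
    ultimately show ?thesis using that by blast
  qed (use that y in blast)
qed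

end

section \<open>The Coxeter plane\<close>

locale snake_plane = snake +
  fixes c :: "'a::euclidean_space \<Rightarrow> real" and \<omega> :: "'a \<Rightarrow> 'a"
  assumes eigenvector: "positive_smallest_eigenvector (simples D) c"
    and dual: "dual_basis (simples D) \<omega>"
begin

abbreviation pv where "pv \<equiv> plane_vec D c \<omega>"
abbreviation pr where "pr \<equiv> plane_proj D c \<omega>"

definition root_sum :: "pm \<Rightarrow> 'a" where "root_sum \<epsilon> = (\<Sum>\<alpha>\<in>D \<epsilon>. c \<alpha> *\<^sub>R sgn \<alpha>)"

lemma c_pos: "\<alpha> \<in> \<Delta> \<Longrightarrow> 0 < c \<alpha>"
  using eigenvector by (auto simp: positive_smallest_eigenvector_def)

lemma sum_simples: "(\<Sum>\<alpha>\<in>\<Delta>. g \<alpha>) = (\<Sum>\<alpha>\<in>D \<epsilon>. g \<alpha>) + (\<Sum>\<alpha>\<in>D (opp \<epsilon>). g \<alpha>)"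
proof -
  have "\<Delta> = D \<epsilon> \<union> D (opp \<epsilon>)" by (cases \<epsilon>) (auto simp: simples_def)
  moreover have "D \<epsilon> \<inter> D (opp \<epsilon>) = {}" using D_disjoint opp_neq(2) by blast
  ultimately show ?thesis using sum.union_disjoint[OF finite_D finite_D, of \<epsilon> "opp \<epsilon>" g] by simp
qed

lemma pv_sgn: "\<beta> \<in> \<Delta> \<Longrightarrow> pv \<epsilon> \<bullet> sgn \<beta> = (if \<beta> \<in> D \<epsilon> then c \<beta> else 0)"
proof -
  assume \<beta>: "\<beta> \<in> \<Delta>"
  have "pv \<epsilon> \<bullet> sgn \<beta> = (\<Sum>\<alpha>\<in>D \<epsilon>. c \<alpha> * (if \<alpha> = \<beta> then 1 else 0))"
    unfolding plane_vec_def inner_sum_left inner_scaleR_left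
    using dual \<beta> D_simples by (intro sum.cong refl) (auto simp: dual_basis_def)
  also have "\<dots> = (if \<beta> \<in> D \<epsilon> then c \<beta> else 0)" using finite_D by (simp add: if_distrib cong: if_cong)
  finally show ?thesis .
qed

lemma pv_simple: "\<beta> \<in> \<Delta> \<Longrightarrow> pv \<epsilon> \<bullet> \<beta> = (if \<beta> \<in> D \<epsilon> then c \<beta> * norm \<beta> else 0)"
proof -
  assume \<beta>: "\<beta> \<in> \<Delta>"
  have "\<beta> = norm \<beta> *\<^sub>R sgn \<beta>" using simple_nonzero[OF \<beta>] by (simp add: sgn_div_norm)
  then have "pv \<epsilon> \<bullet> \<beta> = norm \<beta> * (pv \<epsilon> \<bullet> sgn \<beta>)" by (metis inner_scaleR_right)
  then show ?thesis using pv_sgn[OF \<beta>] by simp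
qed

lemma root_sum_sgn: "\<alpha> \<in> D \<epsilon> \<Longrightarrow> sgn \<alpha> \<bullet> root_sum \<epsilon> = c \<alpha>"
proof -
  assume \<alpha>: "\<alpha> \<in> D \<epsilon>"
  have n: "sgn \<alpha> \<bullet> sgn \<alpha> = 1" using simple_nonzero D_simples \<alpha> by (metis norm_eq_1 norm_sgn)
  have "sgn \<alpha> \<bullet> root_sum \<epsilon> = (\<Sum>\<beta>\<in>D \<epsilon>. if \<beta> = \<alpha> then c \<alpha> else 0)"
    unfolding root_sum_def inner_sum_right
    using \<alpha> D_orthogonal n by (intro sum.cong refl) (auto simp: sgn_div_norm)
  then show ?thesis using \<alpha> finite_D by simp
qed

text \<open>The eigenvector equation says that the Coxeter plane also contains \<open>root_sum Pls\<close> and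
  \<open>root_sum Mns\<close>, which are orthogonal to \<open>\<mu>\<close> and \<open>\<lambda>\<close> respectively.\<close>

lemma root_sum_eq: "\<exists>k. \<forall>\<epsilon>. root_sum \<epsilon> = pv \<epsilon> + k *\<^sub>R pv (opp \<epsilon>)"
proof -
  obtain y where y: "\<And>\<alpha>. \<alpha> \<in> \<Delta> \<Longrightarrow> (\<Sum>\<beta>\<in>\<Delta>. (sgn \<alpha> \<bullet> sgn \<beta>) * c \<beta>) = y * c \<alpha>"
    using eigenvector unfolding positive_smallest_eigenvector_def gram_eigenvector_def by blast
  have "root_sum \<epsilon> = pv \<epsilon> + (y - 1) *\<^sub>R pv (opp \<epsilon>)" for \<epsilon>
  proof -
    let ?v = "root_sum \<epsilon> - (pv \<epsilon> + (y - 1) *\<^sub>R pv (opp \<epsilon>))"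
    have "?v \<bullet> \<alpha> = 0" if \<alpha>: "\<alpha> \<in> \<Delta>" for \<alpha>
    proof -
      have "sgn \<alpha> \<bullet> ?v = 0"
      proof (cases "\<alpha> \<in> D \<epsilon>")
        case True
        then have "\<alpha> \<notin> D (opp \<epsilon>)" using D_disjoint opp_neq(2) by blast
        then show ?thesis
          using root_sum_sgn[OF True] pv_sgn[OF \<alpha>] True
          by (simp add: inner_diff_right inner_add_right inner_commute)
      next
        case False
        then have \<alpha>': "\<alpha> \<in> D (opp \<epsilon>)" using simple_opp \<alpha> by blast
        have "sgn \<alpha> \<bullet> root_sum \<epsilon> + sgn \<alpha> \<bullet> root_sum (opp \<epsilon>) = y * c \<alpha>"
          using y[OF \<alpha>] unfolding sum_simples[of _ \<epsilon>] root_sum_def inner_sum_right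
          by (simp add: mult.commute)
        then have "sgn \<alpha> \<bullet> root_sum \<epsilon> = (y - 1) * c \<alpha>"
          using root_sum_sgn[OF \<alpha>'] by (simp add: algebra_simps)
        then show ?thesis using pv_sgn[OF \<alpha>] \<alpha>' False
          by (simp add: inner_diff_right inner_add_right inner_commute)
      qed
      then show ?thesis using simple_nonzero[OF \<alpha>] by (simp add: sgn_div_norm inner_commute)
    qed
    then have "?v \<bullet> ?v = 0" unfolding inner_cf[of ?v ?v] by simp
    then show ?thesis by simp
  qed
  then show ?thesis by blast
qed

lemma pv_root_sum: "pv \<epsilon> \<bullet> root_sum (opp \<epsilon>) = 0"
proof -
  have "pv \<epsilon> \<bullet> sgn \<alpha> = 0" if "\<alpha> \<in> D (opp \<epsilon>)" for \<alpha>
    using pv_sgn[of \<alpha> \<epsilon>] that D_simples D_disjoint opp_neq(1) by metis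
  then show ?thesis by (simp add: root_sum_def inner_sum_right)
qed

lemma D_nonempty: "D \<epsilon> \<noteq> {}"
proof -
  have ne: "D (e i) \<noteq> {}" if "1 \<le> i" "i < N" for i
  proof
    assume "D (e i) = {}"
    then have "cox D (e i) (x i) = x i" by (simp add: cox_eq)
    then show False using cox_x[OF that] x_eq_iff[of i "Suc i"] that by simp
  qed
  have "e 1 = \<epsilon> \<or> e 2 = \<epsilon>" using e_Suc[of 1] by (cases \<epsilon>; cases "e 1") (auto simp: numeral_2_eq_2)
  then show ?thesis using ne[of 1] ne[of 2] N_ge by auto
qed

lemma root_sum_nonzero: "root_sum \<epsilon> \<noteq> 0" and pv_nonzero: "pv \<epsilon> \<noteq> 0"
proof -
  obtain \<alpha> where \<alpha>: "\<alpha> \<in> D \<epsilon>" using D_nonempty by blast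
  then show "root_sum \<epsilon> \<noteq> 0" using root_sum_sgn[OF \<alpha>] c_pos[OF D_simples[OF \<alpha>]] by auto
  show "pv \<epsilon> \<noteq> 0" using pv_sgn[OF D_simples[OF \<alpha>], of \<epsilon>] \<alpha> c_pos[OF D_simples[OF \<alpha>]] by auto
qed

lemma cox_pv: "cox D \<epsilon> (pv (opp \<epsilon>)) = pv (opp \<epsilon>)"
proof (rule cox_fix)
  fix \<alpha> assume "\<alpha> \<in> D \<epsilon>"
  then show "\<alpha> \<bullet> pv (opp \<epsilon>) = 0"
    using pv_simple[of \<alpha> "opp \<epsilon>"] D_simples D_disjoint opp_neq(2) by (metis inner_commute)
qed

text \<open>Together with \<open>cox_pv\<close> this makes \<open>cox D \<epsilon>\<close> act on
  the Coxeter plane as the reflection fixing \<open>pv (opp \<epsilon>)\<close>.\<close>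

lemma cox_root_sum: "cox D \<epsilon> (root_sum \<epsilon>) = - root_sum \<epsilon>"
proof -
  have "cox D \<epsilon> (root_sum \<epsilon>) = (\<Sum>\<alpha>\<in>D \<epsilon>. cox D \<epsilon> (c \<alpha> *\<^sub>R sgn \<alpha>))"
    unfolding root_sum_def by (rule linear_sum[OF cox_linear])
  also have "\<dots> = (\<Sum>\<alpha>\<in>D \<epsilon>. - (c \<alpha> *\<^sub>R sgn \<alpha>))"
    using cox_simple by (intro sum.cong refl) (auto simp: linear_scale[OF cox_linear] sgn_div_norm)
  finally show ?thesis by (simp add: root_sum_def sum_negf)
qed

section \<open>Complex coordinates on the Coxeter plane\<close>

definition vu where "vu = sgn (pv Pls)"
definition vv where "vv = sgn (root_sum Mns)"

lemma vu_vv: "vu \<bullet> vu = 1" "vv \<bullet> vv = 1" "vu \<bullet> vv = 0"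
  using pv_nonzero root_sum_nonzero pv_root_sum[of Pls]
  by (auto simp: vu_def vv_def norm_sgn simp flip: norm_eq_1) (simp add: sgn_div_norm)

lemma pv_Pls: "pv Pls = norm (pv Pls) *\<^sub>R vu"
  using pv_nonzero by (simp add: vu_def sgn_div_norm)

text \<open>The Gram-Schmidt vector in \<open>plane_proj\<close> is \<open>root_sum Mns\<close>
  itself, which differs from \<mu> by a multiple of \<lambda> and is orthogonal to
  \<lambda>.\<close>

lemma pr_eq: "pr z = Complex (z \<bullet> vu) (z \<bullet> vv)"
proof -
  obtain k where k: "\<And>\<epsilon>. root_sum \<epsilon> = pv \<epsilon> + k *\<^sub>R pv (opp \<epsilon>)" using root_sum_eq by blast
  let ?l = "norm (pv Pls)"
  have "pv Mns \<bullet> vu + k * ?l = root_sum Mns \<bullet> vu"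
    using k[of Mns] pv_Pls vu_vv(1) by (simp add: inner_add_left) (metis inner_scaleR_left mult.right_neutral)
  also have "\<dots> = 0" using pv_root_sum[of Pls] by (simp add: vu_def sgn_div_norm inner_commute)
  finally have "(pv Mns \<bullet> vu) *\<^sub>R vu = - (k *\<^sub>R (?l *\<^sub>R vu))"
    by (metis add_eq_0_iff2 scaleR_minus_left scaleR_scaleR)
  then have "pv Mns - (pv Mns \<bullet> vu) *\<^sub>R vu = root_sum Mns"
    using k[of Mns] pv_Pls by simp
  then show ?thesis by (simp add: plane_proj_def Let_def vu_def vv_def)
qed

lemma pr_linear: "linear pr"
  by (rule linearI) (auto simp: pr_eq inner_add_left complex_eq_iff)

lemma in_plane: "pv \<epsilon> = (pv \<epsilon> \<bullet> vu) *\<^sub>R vu + (pv \<epsilon> \<bullet> vv) *\<^sub>R vv"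
  "root_sum \<epsilon> = (root_sum \<epsilon> \<bullet> vu) *\<^sub>R vu + (root_sum \<epsilon> \<bullet> vv) *\<^sub>R vv"
proof -
  obtain k where k: "\<And>\<epsilon>. root_sum \<epsilon> = pv \<epsilon> + k *\<^sub>R pv (opp \<epsilon>)" using root_sum_eq by blast
  let ?I = "\<lambda>g. g = (g \<bullet> vu) *\<^sub>R vu + (g \<bullet> vv) *\<^sub>R vv"
  have lin: "?I (a *\<^sub>R g + b *\<^sub>R h)" if "?I g" "?I h" for a b g h
  proof -
    let ?w = "a *\<^sub>R g + b *\<^sub>R h"
    have "(?w \<bullet> vu) *\<^sub>R vu + (?w \<bullet> vv) *\<^sub>R vv =
      a *\<^sub>R ((g \<bullet> vu) *\<^sub>R vu + (g \<bullet> vv) *\<^sub>R vv) + b *\<^sub>R ((h \<bullet> vu) *\<^sub>R vu + (h \<bullet> vv) *\<^sub>R vv)"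
      by (simp add: inner_add_left algebra_simps)
    also have "\<dots> = ?w" using that[symmetric] by simp
    finally show ?thesis by simp
  qed
  have 0: "?I vu" "?I vv" using vu_vv by (auto simp: inner_commute)
  have r: "root_sum Mns = norm (root_sum Mns) *\<^sub>R vv" using root_sum_nonzero by (simp add: vv_def sgn_div_norm)
  have 1: "?I (pv Pls)" using lin[OF 0, of "norm (pv Pls)" 0] pv_Pls by simp
  have 2: "?I (root_sum Mns)" using lin[OF 0, of 0 "norm (root_sum Mns)"] r by simp
  have "pv Mns = 1 *\<^sub>R root_sum Mns + (- k) *\<^sub>R pv Pls" using k[of Mns] by simp
  then have 3: "?I (pv Mns)" using lin[OF 2 1, of 1 "- k"] by metis
  show 4: "?I (pv \<epsilon>)" for \<epsilon> using 1 3 by (cases \<epsilon>) auto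
  have "root_sum \<epsilon> = 1 *\<^sub>R pv \<epsilon> + k *\<^sub>R pv (opp \<epsilon>)" using k by simp
  then show "?I (root_sum \<epsilon>)" using lin[OF 4 4, of 1 \<epsilon> k "opp \<epsilon>"] by metis
qed

lemma inner_plane:
  assumes "g = (g \<bullet> vu) *\<^sub>R vu + (g \<bullet> vv) *\<^sub>R vv"
  shows "z \<bullet> g = Re (pr z * cnj (pr g))"
proof -
  have "z \<bullet> g = z \<bullet> ((g \<bullet> vu) *\<^sub>R vu + (g \<bullet> vv) *\<^sub>R vv)"
    by (rule arg_cong[OF assms])
  then show ?thesis by (simp add: pr_eq inner_add_right)
qed

lemma inner_pv: "z \<bullet> pv \<epsilon> = Re (pr z * cnj (pr (pv \<epsilon>)))"
  and inner_root_sum: "z \<bullet> root_sum \<epsilon> = Re (pr z * cnj (pr (root_sum \<epsilon>)))"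
  using inner_plane in_plane by metis+

text \<open>The angle from \<lambda> to \<mu>. Its value is established only in
  \<open>theta_eq\<close>.\<close>

definition \<theta> where "\<theta> = Arg (pr (pv Mns))"

lemma pr_Pls: "pr (pv Pls) = complex_of_real (norm (pv Pls))"
  using pv_Pls vu_vv by (simp add: pr_eq complex_eq_iff) (metis inner_scaleR_left mult_cancel_left1 mult_zero_right)

lemma Im_pr_Mns: "Im (pr (pv Mns)) > 0"
proof -
  obtain k where k: "\<And>\<epsilon>. root_sum \<epsilon> = pv \<epsilon> + k *\<^sub>R pv (opp \<epsilon>)" using root_sum_eq by blast
  have "pv Mns = root_sum Mns - k *\<^sub>R pv Pls" using k[of Mns] by simp
  then have "pv Mns \<bullet> root_sum Mns = root_sum Mns \<bullet> root_sum Mns"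
    using pv_root_sum[of Pls] by (simp add: inner_diff_left)
  also have "\<dots> > 0" using root_sum_nonzero by simp
  finally show ?thesis using root_sum_nonzero by (simp add: pr_eq vv_def sgn_div_norm zero_less_mult_iff)
qed

lemma theta: "0 < \<theta>" "\<theta> < pi" "0 < sin \<theta>"
proof -
  show "0 < \<theta>" "\<theta> < pi" using Im_pr_Mns Arg_lt_pi[of "pr (pv Mns)"] by (auto simp: \<theta>_def)
  then show "0 < sin \<theta>" by (rule sin_gt_zero)
qed

lemma pr_Mns: "pr (pv Mns) = complex_of_real (cmod (pr (pv Mns))) * cis \<theta>" and cmod_Mns: "0 < cmod (pr (pv Mns))"
proof -
  show "pr (pv Mns) = complex_of_real (cmod (pr (pv Mns))) * cis \<theta>"
    using rcis_cmod_Arg[of "pr (pv Mns)"] by (simp add: \<theta>_def rcis_def)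
  show "0 < cmod (pr (pv Mns))" using Im_pr_Mns by auto
qed

lemma inner_Pls: "z \<bullet> pv Pls = norm (pv Pls) * Re (pr z)"
  unfolding inner_pv pr_Pls by simp

lemma inner_Mns: "z \<bullet> pv Mns = cmod (pr (pv Mns)) * Re (pr z * cis (- \<theta>))"
  unfolding inner_pv by (subst pr_Mns) (simp add: cis_cnj algebra_simps)

text \<open>The angle of the line in the plane that \<open>cox D \<epsilon>\<close> fixes: the class
  \<open>Pls\<close> fixes \<mu> and the class \<open>Mns\<close> fixes \<lambda>.\<close>

definition mirror :: "pm \<Rightarrow> real" where "mirror \<epsilon> = (if \<epsilon> = Pls then \<theta> else 0)"

text \<open>For \<open>Mns\<close> the basis vectors \<open>vu\<close> and \<open>vv\<close> are
  eigenvectors. For \<open>Pls\<close> the image is determined by its inner products with \<mu>,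
  which is fixed, and with \<open>root_sum Pls\<close>, which is negated and perpendicular to
  \<mu>.\<close>

lemma pr_cox: "pr (cox D \<epsilon> z) = cis (2 * mirror \<epsilon>) * cnj (pr z)"
proof (cases \<epsilon>)
  case Mns
  have "cox D Mns vu = vu" using cox_pv[of Mns] by (simp add: vu_def sgn_div_norm linear_scale[OF cox_linear])
  moreover have "cox D Mns vv = - vv"
    using cox_root_sum[of Mns] by (simp add: vv_def sgn_div_norm linear_scale[OF cox_linear])
  ultimately show ?thesis using Mns by (simp add: pr_eq complex_eq_iff cox_adjoint mirror_def)
next
  case Pls
  let ?w = "pr (cox D Pls z)" and ?p = "pr z" and ?d = "cis \<theta>" and ?q = "pr (root_sum Pls)"
  have "cox D Pls z \<bullet> pv Mns = z \<bullet> pv Mns" using cox_pv[of Pls] by (simp add: cox_adjoint)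
  then have re: "Re (?w * cnj ?d) = Re (?p * cnj ?d)"
    unfolding inner_Mns using cmod_Mns by (simp add: cis_cnj)
  have "root_sum Pls \<bullet> pv Mns = 0" using pv_root_sum[of Mns] by (simp add: inner_commute)
  then have q: "Re (?q * cnj ?d) = 0" unfolding inner_Mns using cmod_Mns by (simp add: cis_cnj)
  define s where "s = Im (?q * cnj ?d)"
  have "?q = (?q * cnj ?d) * ?d" by (simp add: cis_cnj cis_mult)
  also have "?q * cnj ?d = \<i> * complex_of_real s" using q by (simp add: s_def complex_eq_iff)
  finally have qs: "?q = \<i> * complex_of_real s * ?d" .
  have ip: "u \<bullet> root_sum Pls = s * Im (pr u * cnj ?d)" for u
    unfolding inner_root_sum by (subst qs) (simp add: algebra_simps)
  have "root_sum Pls \<bullet> root_sum Pls > 0" using root_sum_nonzero by simp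
  then have "s \<noteq> 0" using ip[of "root_sum Pls"] by auto
  moreover have "cox D Pls z \<bullet> root_sum Pls = - (z \<bullet> root_sum Pls)"
    using cox_root_sum[of Pls] by (simp add: cox_adjoint)
  then have "s * Im (?w * cnj ?d) = s * (- Im (?p * cnj ?d))" by (simp only: ip mult_minus_right)
  ultimately have "Im (?w * cnj ?d) = - Im (?p * cnj ?d)" using mult_left_cancel by blast
  then have "?w * cnj ?d = cnj (?p * cnj ?d)" using re by (simp add: complex_eq_iff)
  then have "?w * (cnj ?d * ?d) = cnj ?p * (?d * ?d)" by (simp add: mult_ac)
  then show ?thesis using Pls by (simp add: cis_cnj cis_mult mirror_def mult.commute)
qed

text \<open>The angle of the projection of \<open>x i\<close> in units of \<theta>. Alternating
  reflections in the lines at angles \<theta> and 0 produce two interleaved progressions, one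
  ascending and one descending.\<close>

definition K :: "nat \<Rightarrow> int" where "K i = (if e i = Pls then 1 - int i else int i)"
text \<open>The projection of \<open>x 1\<close> lies on the mirror of class \<open>e 0\<close>, and
  \<open>\<rho>\<close> is its signed coordinate there. That it is a radius, that is, positive, is
  shown in \<open>rho\<close>.\<close>

definition \<rho> where "\<rho> = Re (pr (x 1) * cis (- mirror (e 0)))"

lemma pr_x_theta: "1 \<le> i \<Longrightarrow> i \<le> N \<Longrightarrow> pr (x i) = complex_of_real \<rho> * cis (K i * \<theta>)"
proof (induction i rule: dec_induct)
  case base
  let ?m = "mirror (e 0)"
  have "pr (x 1) = cis (2 * ?m) * cnj (pr (x 1))" using pr_cox[of "e 0" "x 1"] cox_first by simp
  then have "pr (x 1) * cis (- ?m) = cis (2 * ?m) * cnj (pr (x 1)) * cis (- ?m)" by (rule arg_cong)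
  also have "\<dots> = cnj (pr (x 1)) * (cis (2 * ?m) * cis (- ?m))" by (simp only: mult_ac)
  also have "\<dots> = cnj (pr (x 1) * cis (- ?m))" by (simp add: cis_mult cis_cnj)
  finally have "Im (pr (x 1) * cis (- ?m)) = 0" by (metis cnj.sel(2) equal_neg_zero)
  then have "pr (x 1) * cis (- ?m) = complex_of_real \<rho>" by (simp add: \<rho>_def complex_eq_iff)
  then have "pr (x 1) * (cis (- ?m) * cis ?m) = complex_of_real \<rho> * cis ?m" by (simp add: mult.assoc)
  then have "pr (x 1) = complex_of_real \<rho> * cis ?m" by (simp add: cis_mult)
  moreover have "?m = K 1 * \<theta>" using e_Suc[of 0] by (cases "e 0") (auto simp: mirror_def K_def)
  ultimately show ?case by simp
next
  case (step i)
  have "pr (x (Suc i)) = cis (2 * mirror (e i)) * cnj (pr (x i))"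
    using pr_cox[of "e i" "x i"] cox_x[of i] step by simp
  also have "\<dots> = complex_of_real \<rho> * cis (2 * mirror (e i) - K i * \<theta>)"
    using step by (simp add: cis_cnj cis_mult)
  also have "2 * mirror (e i) - K i * \<theta> = K (Suc i) * \<theta>"
    using e_Suc[of i] by (cases "e i") (auto simp: mirror_def K_def algebra_simps)
  finally show ?case .
qed

text \<open>\<open>cox D (e i)\<close> takes \<open>x i\<close> to \<open>x (Suc i)\<close> and
  changes only coordinates of its own class, so one of these drops. On the simple roots of this
  class \<open>pv (e i)\<close> is positive, on the others it vanishes.\<close>

lemma pv_drop:
  assumes "1 \<le> i" "i < N"
  shows "x (Suc i) \<bullet> pv (e i) < x i \<bullet> pv (e i)"
proof -
  have ab: "x i \<succ> x (Suc i)" using x_above assms by simp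
  obtain \<alpha> where \<alpha>: "\<alpha> \<in> \<Delta>" "cf \<alpha> (x (Suc i)) < cf \<alpha> (x i)" using above_cf_strict[OF ab] by blast
  then have "\<alpha> \<in> D (e i)" using cf_cox[of \<alpha> "e i" "x i"] cox_x[OF assms] by force
  moreover have nn: "0 \<le> cf \<gamma> (x i - x (Suc i)) * (pv (e i) \<bullet> \<gamma>)" if "\<gamma> \<in> \<Delta>" for \<gamma>
    using that ab c_pos[OF that] pv_simple[OF that] by (auto simp: above_def cf_diff)
  ultimately have "0 < (\<Sum>\<gamma>\<in>\<Delta>. cf \<gamma> (x i - x (Suc i)) * (pv (e i) \<bullet> \<gamma>))"
    using \<alpha> c_pos[of \<alpha>] pv_simple[of \<alpha>] simple_nonzero
    by (intro sum_pos2[OF finite_simples, of \<alpha>]) (auto simp: cf_diff)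
  also have "\<dots> = pv (e i) \<bullet> (x i - x (Suc i))" by (rule inner_cf[symmetric])
  finally show ?thesis by (simp add: inner_diff_right inner_commute)
qed

text \<open>This is \<open>pv_drop\<close> read in the plane: cos((i - 1) \<theta>) - cos((i + 1)
  \<theta>) equals 2 sin(i \<theta>) sin \<theta>, and sin \<theta> is positive.\<close>

lemma rho_sin: 
  assumes "1 \<le> i" "i < N"
  shows "0 < \<rho> * sin (i * \<theta>)"
proof -
  have i: "pr (x i) = complex_of_real \<rho> * cis (K i * \<theta>)" "pr (x (Suc i)) = complex_of_real \<rho> * cis (K (Suc i) * \<theta>)"
    using pr_x_theta assms by auto
  have "\<rho> * cos ((real i + 1) * \<theta>) < \<rho> * cos ((real i - 1) * \<theta>)"
  proof (cases "e i")
    case Pls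
    then have "Re (pr (x (Suc i))) < Re (pr (x i))"
      using pv_drop[OF assms] pv_nonzero by (simp add: inner_Pls)
    moreover have "K i * \<theta> = - ((real i - 1) * \<theta>)" "K (Suc i) * \<theta> = (real i + 1) * \<theta>"
      using Pls e_Suc[of i] by (auto simp: K_def algebra_simps)
    ultimately show ?thesis unfolding i by simp
  next
    case Mns
    then have "Re (pr (x (Suc i)) * cis (- \<theta>)) < Re (pr (x i) * cis (- \<theta>))"
      using pv_drop[OF assms] cmod_Mns by (simp add: inner_Mns)
    moreover have "pr (x i) * cis (- \<theta>) = complex_of_real \<rho> * cis ((real i - 1) * \<theta>)"
      "pr (x (Suc i)) * cis (- \<theta>) = complex_of_real \<rho> * cis (- ((real i + 1) * \<theta>))"
      unfolding i mult.assoc cis_mult using Mns e_Suc[of i] by (auto simp: K_def algebra_simps)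
    ultimately show ?thesis by simp
  qed
  moreover have "cos ((real i - 1) * \<theta>) - cos ((real i + 1) * \<theta>) = 2 * sin (i * \<theta>) * sin \<theta>"
    by (simp add: algebra_simps cos_add cos_diff)
  ultimately have "0 < \<rho> * (2 * sin (i * \<theta>) * sin \<theta>)"
    by (metis diff_gt_0_iff_gt right_diff_distrib)
  then have "0 < (\<rho> * sin (i * \<theta>)) * (2 * sin \<theta>)" by (simp add: mult_ac)
  then show ?thesis using theta by (simp add: zero_less_mult_iff)
qed

lemma rho: "0 < \<rho>"
  using rho_sin[of 1] N_ge theta by (simp add: zero_less_mult_iff)

text \<open>One more step keeps the angle below 2 pi, and the positive sine then keeps it below
  pi.\<close>

lemma theta_bound: "1 \<le> i \<Longrightarrow> i < N \<Longrightarrow> i * \<theta> < pi"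
proof (induction i rule: dec_induct)
  case base
  then show ?case using theta by simp
next
  case (step i)
  then have lt: "real (Suc i) * \<theta> < 2 * pi" using theta by (simp add: algebra_simps)
  have pos: "0 < sin (real (Suc i) * \<theta>)" using rho_sin[of "Suc i"] step rho by (simp add: zero_less_mult_iff)
  show ?case
  proof (rule ccontr)
    assume "\<not> ?thesis"
    then have "sin (real (Suc i) * \<theta>) \<le> 0" using lt by (intro sin_le_zero) auto
    then show False using pos by simp
  qed
qed

text \<open>\<open>x N\<close> is fixed by the reflection of class \<open>e N\<close>, so its
  projection lies on that mirror and sin(N \<theta>) = 0. Since (N - 1) \<theta> < pi, the angle N
  \<theta> lies strictly between 0 and 2 pi.\<close>

lemma theta_eq: "\<theta> = pi / N"
proof -
  have "pr (x N) = cis (2 * mirror (e N)) * cnj (pr (x N))" using pr_cox[of "e N" "x N"] cox_last by simp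
  moreover have "pr (x N) = complex_of_real \<rho> * cis (K N * \<theta>)" using pr_x_theta[of N] N_ge by simp
  ultimately have "complex_of_real \<rho> * cis (K N * \<theta>) = complex_of_real \<rho> * cis (2 * mirror (e N) - K N * \<theta>)"
    by (simp add: cis_cnj cis_mult)
  then have "cis (K N * \<theta>) = cis (2 * mirror (e N) - K N * \<theta>)" using rho by simp
  then have "cis (K N * \<theta>) * cis (- mirror (e N)) = cis (2 * mirror (e N) - K N * \<theta>) * cis (- mirror (e N))"
    by simp
  then have "cis (N * \<theta>) = cis (- (N * \<theta>))"
    unfolding cis_mult by (cases "e N") (auto simp: K_def mirror_def algebra_simps)
  then have s: "sin (N * \<theta>) = 0" by (simp add: complex_eq_iff)
  have "real (N - 1) * \<theta> < pi" using theta_bound[of "N - 1"] N_ge by simp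
  then have lt: "N * \<theta> < 2 * pi" using theta N_ge by (simp add: of_nat_diff algebra_simps)
  have pos: "0 < N * \<theta>" using theta N_ge by simp
  have "N * \<theta> = pi"
    using s lt pos sin_gt_zero[of "N * \<theta>"] sin_lt_zero[of "N * \<theta>"] by (metis less_irrefl linorder_neqE_linordered_idom)
  then show ?thesis using N_ge by (simp add: field_simps)
qed

lemma pr_x: "1 \<le> i \<Longrightarrow> i \<le> N \<Longrightarrow> pr (x i) = rcis \<rho> (K i * pi / N)"
  using pr_x_theta theta_eq by (simp add: rcis_def)

text \<open>One class fixes q and the other negates it, so its projection lies on one mirror and is
  perpendicular to the other. As 2 \<theta> < pi, the mirrors are not perpendicular; here N \<ge> 3
  enters.\<close>

lemma pr_Q:
  assumes q: "q \<in> Q"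
  shows "pr q = 0"
proof -
  let ?p = "pr q"
  have eqs: "cis (2 * mirror (e M)) * cnj ?p = - ?p" "cis (2 * mirror (opp (e M))) * cnj ?p = ?p"
    using pr_cox[of "e M" q] pr_cox[of "opp (e M)" q] cox_Q[OF q] cox_Q_opp[OF q]
    by (simp_all add: linear_neg[OF pr_linear])
  have "cis (2 * \<theta>) * cnj ?p = - cnj ?p"
  proof (cases "e M")
    case Pls
    then show ?thesis using eqs by (simp add: mirror_def)
  next
    case Mns
    then have "cnj ?p = - ?p" "cis (2 * \<theta>) * cnj ?p = ?p" using eqs by (simp_all add: mirror_def)
    then show ?thesis by simp
  qed
  then have "(cis (2 * \<theta>) + 1) * cnj ?p = 0" by (simp add: algebra_simps)
  moreover have "cis (2 * \<theta>) + 1 \<noteq> 0"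
  proof
    assume "cis (2 * \<theta>) + 1 = 0"
    then have "sin (2 * \<theta>) = 0" by (simp add: complex_eq_iff)
    moreover have "2 * \<theta> < pi" using theta_bound[of 2] N_ge by simp
    then have "0 < sin (2 * \<theta>)" using theta by (intro sin_gt_zero) auto
    ultimately show False by simp
  qed
  ultimately show ?thesis by simp
qed

section \<open>The order of the Coxeter element\<close>

abbreviation cc where "cc \<equiv> cox D Mns \<circ> cox D Pls"

lemma pr_cc: "pr ((cc ^^ k) z) = cis (- (2 * real k * \<theta>)) * pr z"
proof (induction k)
  case (Suc k)
  have "pr (cc y) = cis (- (2 * \<theta>)) * pr y" for y
    by (simp add: pr_cox mirror_def cis_cnj)
  then have "pr ((cc ^^ Suc k) z) = cis (- (2 * \<theta>)) * (cis (- (2 * real k * \<theta>)) * pr z)"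
    by (simp only: funpow.simps comp_apply Suc.IH)
  also have "\<dots> = cis (- (2 * \<theta>) + - (2 * real k * \<theta>)) * pr z"
    by (simp only: mult.assoc[symmetric] cis_mult)
  also have "- (2 * \<theta>) + - (2 * real k * \<theta>) = - (2 * real (Suc k) * \<theta>)" by (simp add: algebra_simps)
  finally show ?case .
qed simp

lemma K_inj:
  assumes "1 \<le> i" "i \<le> N" "1 \<le> j" "j \<le> N" "pr (x i) = pr (x j)"
  shows "i = j"
proof -
  have "cis (K i * \<theta>) = cis (K j * \<theta>)" using assms pr_x_theta rho by simp
  then have "cis (K i * \<theta>) * cis (- (K j * \<theta>)) = cis (K j * \<theta>) * cis (- (K j * \<theta>))" by simp
  then have "cos ((K i - K j) * \<theta>) = 1" unfolding cis_mult by (simp add: complex_eq_iff algebra_simps)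
  then obtain n :: int where n: "(K i - K j) * \<theta> = n * 2 * pi" using cos_one_2pi_int by auto
  then have "pi * real_of_int (K i - K j) = pi * real_of_int (n * 2 * int N)"
    using theta_eq N_ge by (simp add: field_simps)
  then have "real_of_int (K i - K j) = real_of_int (n * 2 * int N)"
    using pi_neq_zero mult_left_cancel by blast
  then have "K i - K j = n * (2 * int N)" by linarith
  moreover have "\<bar>K i - K j\<bar> < 2 * int N" using assms by (auto simp: K_def)
  ultimately have "\<bar>n\<bar> * (2 * int N) < 1 * (2 * int N)" by (simp add: abs_mult)
  then have "\<bar>n\<bar> < 1" using N_ge by (subst (asm) mult_less_cancel_right) auto
  then have "n = 0" by simp
  then have "K i = K j" using \<open>K i - K j = n * (2 * int N)\<close> by simp
  then show ?thesis using assms by (auto simp: K_def split: if_splits)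
qed

text \<open>In the plane the power is a full turn, and projections tell the elements of the chain
  from each other and from \<open>Q\<close>; on \<open>Q\<close> the Coxeter element is negation and
  N is even. The power thus fixes the orbit. As it preserves inner products, the difference of a
  vector and its image is orthogonal to the orbit, hence zero.\<close>

lemma cc_power_N: "cc ^^ N = id"
proof
  fix v
  have inn: "(cc ^^ k) u \<bullet> (cc ^^ k) w = u \<bullet> w" for u w k by (induction k) (auto simp: cox_inner)
  have in_Orb: "(cc ^^ k) y \<in> Orb" if "y \<in> Orb" for y k by (induction k) (use that cox_Orb in auto)
  have fixed: "(cc ^^ N) y = y" if y: "y \<in> Orb" for y
    using y
  proof (cases rule: Orb_cases)
    case (x i)
    have p: "pr ((cc ^^ N) y) = pr y" using pr_cc[of N y] theta_eq N_ge by (simp add: complex_eq_iff)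
    show ?thesis using in_Orb[OF y, of N]
    proof (cases rule: Orb_cases)
      case j: (x j)
      then show ?thesis using K_inj[of j i] p x by simp
    next
      case Q
      then have "pr (x i) = 0" using p pr_Q x by simp
      then show ?thesis using pr_x_theta[of i] x rho by simp
    qed
  next
    case Q
    have one: "cc q = - q" if "q \<in> Q" for q
      using cox_Q[OF that] cox_Q_opp[OF that] by (cases "e M") (auto simp: cox_minus)
    have it: "(cc ^^ (2 * k)) y = y" for k
      by (induction k) (use one[OF Q] one[OF Q_uminus[OF Q]] in auto)
    show ?thesis using it[of M] N_eq[OF Q] by simp
  qed
  have "(cc ^^ N) v - v = 0"
  proof (rule total_Orb)
    fix y assume "y \<in> Orb"
    then show "((cc ^^ N) v - v) \<bullet> y = 0" using inn[of N v y] fixed by (simp add: inner_diff_left)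
  qed
  then show "(cc ^^ N) v = id v" by simp
qed

lemma coxeter_number_eq: "coxeter_number D = N"
  unfolding coxeter_number_def
proof (rule Least_equality)
  show "0 < N \<and> cc ^^ N = id" using cc_power_N N_ge by simp
  fix k assume k: "0 < k \<and> cc ^^ k = id"
  have "pr (x 1) = cis (- (2 * real k * \<theta>)) * pr (x 1)" using pr_cc[of k "x 1"] k by simp
  moreover have "pr (x 1) \<noteq> 0" using pr_x_theta[of 1] rho N_ge by simp
  ultimately have "cis (- (2 * real k * \<theta>)) = 1" by simp
  then have "cos (2 * real k * \<theta>) = 1" by (simp add: complex_eq_iff)
  then obtain n :: int where n: "2 * real k * \<theta> = n * 2 * pi" using cos_one_2pi_int by auto
  then have "real k = n * real N" using theta_eq N_ge by (simp add: field_simps)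
  then have "int k = n * int N" by (metis of_int_eq_iff of_int_mult of_int_of_nat_eq)
  then have "int N dvd int k" by simp
  then show "N \<le> k" using k by (simp add: dvd_imp_le)
qed

end

section \<open>The enlarged polygon\<close>

lemma cis_shift_eq_iff:
  assumes "1 \<le> k" "k \<le> 2 * h" "1 \<le> j" "j \<le> 2 * h"
  shows "cis (real k * pi / real h) = cis (real j * pi / real h) \<longleftrightarrow> k = j"
proof
  assume eq: "cis (real k * pi / real h) = cis (real j * pi / real h)"
  have h: "h > 0" using assms by simp
  have "cis (real k * pi / real h) * cis (- (real j * pi / real h)) = 1"
    unfolding eq by (simp add: cis_mult)
  then have "cos (real k * pi / real h - real j * pi / real h) = 1"
    unfolding cis_mult by (simp add: complex_eq_iff)
  then obtain n :: int where n: "real k * pi / real h - real j * pi / real h = n * 2 * pi"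
    using cos_one_2pi_int by auto
  then have "pi * real_of_int (int k - int j) = pi * real_of_int (n * (2 * int h))"
    using h by (simp add: field_simps)
  then have "real_of_int (int k - int j) = real_of_int (n * (2 * int h))"
    using pi_neq_zero mult_left_cancel by blast
  then have eq: "int k - int j = n * (2 * int h)" by linarith
  moreover have "\<bar>int k - int j\<bar> < 2 * int h" using assms by linarith
  ultimately have "\<bar>n\<bar> * (2 * int h) < 1 * (2 * int h)" by (simp add: abs_mult)
  then have "\<bar>n\<bar> < 1" using h by (subst (asm) mult_less_cancel_right) auto
  then show "k = j" using eq by simp
qed simp

lemma enlarge_rcis:
  assumes "0 < r" "1 \<le> k" "k \<le> 2 * h"
  shows "enlarge h (rcis r (real k * pi / real h)) =
    rcis r (real (if k \<le> h then k + 2 else k + 4) * pi / real (h + 2))"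
proof -
  let ?z = "rcis r (real k * pi / real h)"
  have m: "cmod ?z = r" using assms by (simp add: norm_mult rcis_def)
  have "(THE j. 1 \<le> j \<and> j \<le> 2 * h \<and> ?z = rcis (cmod ?z) (real j * pi / real h)) = k"
  proof (rule the_equality)
    show "1 \<le> k \<and> k \<le> 2 * h \<and> ?z = rcis (cmod ?z) (real k * pi / real h)" using assms m by simp
    fix j assume j: "1 \<le> j \<and> j \<le> 2 * h \<and> ?z = rcis (cmod ?z) (real j * pi / real h)"
    then have "cis (real k * pi / real h) = cis (real j * pi / real h)"
      using assms m by (simp add: rcis_def)
    then show "j = k" using cis_shift_eq_iff assms j by metis
  qed
  then show ?thesis unfolding enlarge_def Let_def m by simp
qed

section \<open>Intersections of segments in the plane\<close>

lemma unlabeled_pair: "unlabeled {A, B} = closed_segment (pos A) (pos B)"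
  by (simp add: unlabeled_def segment_convex_hull)

lemma segments_cross_iff:
  assumes "pos A \<noteq> pos B" "pos A' \<noteq> pos B'"
  shows "segments_cross {A, B} {A', B'} \<longleftrightarrow>
    open_segment (pos A) (pos B) \<inter> open_segment (pos A') (pos B') \<noteq> {}"
  using assms by (simp add: segments_cross_def unlabeled_pair rel_interior_closed_segment)

lemma orthogonal_complex_multiple:
  fixes a b d :: complex
  assumes "a \<bullet> d = 0" "b \<bullet> d = 0" "d \<noteq> 0" "b \<noteq> 0"
  shows "\<exists>s. a = s *\<^sub>R b"
proof -
  have a: "Re a * Re d = - (Im a * Im d)" and b: "Re b * Re d = - (Im b * Im d)"
    using assms by (auto simp: inner_complex_def)
  have "(Re a * Im b - Im a * Re b) * Re d = Im b * (Re a * Re d) - Im a * (Re b * Re d)"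
    by (simp add: algebra_simps)
  also have "\<dots> = 0" unfolding a b by simp
  finally have 1: "(Re a * Im b - Im a * Re b) * Re d = 0" .
  have "(Re a * Im b - Im a * Re b) * Im d = Re a * (Im b * Im d) - Re b * (Im a * Im d)"
    by (simp add: algebra_simps)
  also have "\<dots> = Re a * (- (Re b * Re d)) - Re b * (- (Re a * Re d))" unfolding a b by simp
  also have "\<dots> = 0" by simp
  finally have 2: "(Re a * Im b - Im a * Re b) * Im d = 0" .
  have c: "Re a * Im b = Im a * Re b" using 1 2 assms(3) by (auto simp: complex_eq_iff)
  show ?thesis
  proof (cases "Re b = 0")
    case True
    then have "Im b \<noteq> 0" using assms(4) by (simp add: complex_eq_iff)
    then show ?thesis using True c by (intro exI[of _ "Im a / Im b"]) (simp add: complex_eq_iff)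
  next
    case False
    then show ?thesis using c by (intro exI[of _ "Re a / Re b"]) (simp add: complex_eq_iff field_simps)
  qed
qed

text \<open>The segment from A to B meets the line through C and E strictly inside the disc of
  radius r, and this line meets the open disc exactly in the open chord. A and B range over the
  closed disc so that B may be the centre.\<close>

lemma chord_cross:
  fixes A B C E d :: complex
  assumes CE: "norm C = r" "norm E = r" "C \<bullet> d = t" "E \<bullet> d = t" "C \<noteq> E"
    and AB: "norm A \<le> r" "norm B \<le> r" "B \<bullet> d < t" "t < A \<bullet> d"
  obtains P where "P \<in> open_segment A B" "P \<in> open_segment C E"
proof -
  \<comment> \<open>The parameter at which the segment from A to B reaches level t.\<close>
  define u where "u = (A \<bullet> d - t) / (A \<bullet> d - B \<bullet> d)"
  have u: "0 < u" "u < 1" using AB by (auto simp: u_def field_simps)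
  define P where "P = (1 - u) *\<^sub>R A + u *\<^sub>R B"
  have "A \<noteq> B" using AB by auto
  then have P: "P \<in> open_segment A B" using u by (auto simp: in_segment P_def)
  have "u * (A \<bullet> d - B \<bullet> d) = A \<bullet> d - t" using AB by (simp add: u_def)
  then have Pd: "P \<bullet> d = t" by (simp add: P_def inner_add_left algebra_simps)
  have "norm P < r" using dist_decreases_open_segment[OF P, of 0] AB by (auto simp: dist_norm)
  then have nP: "P \<bullet> P < r\<^sup>2"
    by (simp add: dot_square_norm power_strict_mono)
  \<comment> \<open>Positions on the line are measured from the midpoint of the chord, so that
    Pythagoras compares their norms.\<close>
  define m where "m = (1/2) *\<^sub>R (C + E)"
  have "(P - m) \<bullet> d = 0" using Pd CE by (simp add: m_def inner_diff_left inner_add_left)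
  moreover have "(C - E) \<bullet> d = 0" using CE by (simp add: inner_diff_left)
  moreover have "d \<noteq> 0" using AB by auto
  ultimately obtain s where s: "P - m = s *\<^sub>R (C - E)"
    using orthogonal_complex_multiple[of "P - m" d "C - E"] CE by auto
  have CC: "C \<bullet> C = r\<^sup>2" "E \<bullet> E = r\<^sup>2" using CE by (auto simp: dot_square_norm)
  have mo: "m \<bullet> (C - E) = 0" using CC by (simp add: m_def inner_add_left inner_add_right inner_diff_left inner_diff_right inner_commute[of E C])
  have P_eq: "P = m + s *\<^sub>R (C - E)" using s by (simp add: algebra_simps)
  have pyth: "(m + k *\<^sub>R (C - E)) \<bullet> (m + k *\<^sub>R (C - E)) = m \<bullet> m + k\<^sup>2 * ((C - E) \<bullet> (C - E))" for k
  proof -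
    have "(m + k *\<^sub>R v) \<bullet> (m + k *\<^sub>R v) = m \<bullet> m + k\<^sup>2 * (v \<bullet> v)" if "m \<bullet> v = 0" for v
      using that by (simp add: inner_add_left inner_add_right inner_commute power2_eq_square)
    then show ?thesis using mo by blast
  qed
  have "P \<bullet> P = m \<bullet> m + s\<^sup>2 * ((C - E) \<bullet> (C - E))"
    unfolding P_eq by (rule pyth)
  moreover have "C = m + (1/2) *\<^sub>R (C - E)"
    by (simp add: m_def complex_eq_iff field_simps)
  then have "C \<bullet> C = m \<bullet> m + (1/2)\<^sup>2 * ((C - E) \<bullet> (C - E))"
    using pyth[of "1/2"] by simp
  ultimately have "s\<^sup>2 * ((C - E) \<bullet> (C - E)) < (1/2)\<^sup>2 * ((C - E) \<bullet> (C - E))" using nP CC by simp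
  then have "s\<^sup>2 < (1/2)\<^sup>2" using CE by (simp add: mult_less_cancel_right)
  then have "\<bar>s\<bar> < 1/2" using abs_le_square_iff[of "1/2" s] by (simp add: not_le[symmetric])
  then have "P = (1 - (1/2 - s)) *\<^sub>R C + (1/2 - s) *\<^sub>R E" "0 < 1/2 - s" "1/2 - s < 1"
    unfolding P_eq m_def by (auto simp: algebra_simps)
  then have "P \<in> open_segment C E" using CE(5) unfolding in_segment by blast
  then show ?thesis using that P by blast
qed

lemma open_segment_side:
  fixes A B d :: "'a::real_inner"
  assumes "A \<bullet> d \<le> t" "B \<bullet> d \<le> t" "A \<bullet> d < t \<or> B \<bullet> d < t" "z \<in> open_segment A B"
  shows "z \<bullet> d < t"
proof -
  obtain u where u: "0 < u" "u < 1" "z = (1 - u) *\<^sub>R A + u *\<^sub>R B" using assms(4) by (auto simp: in_segment)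
  have "z \<bullet> d = (1 - u) * (A \<bullet> d) + u * (B \<bullet> d)" using u by (simp add: inner_add_left)
  also have "\<dots> < (1 - u) * t + u * t"
    using assms(3)
  proof
    assume "A \<bullet> d < t"
    then show ?thesis using u assms by (intro add_less_le_mono mult_strict_left_mono mult_left_mono) auto
  next
    assume "B \<bullet> d < t"
    then show ?thesis using u assms by (intro add_le_less_mono mult_strict_left_mono mult_left_mono) auto
  qed
  finally show ?thesis by (simp add: algebra_simps)
qed

lemma closed_segment_level:
  fixes A B d :: "'a::real_inner"
  assumes "A \<bullet> d = t" "B \<bullet> d = t" "z \<in> closed_segment A B"
  shows "z \<bullet> d = t"
proof -
  obtain u where "z = (1 - u) *\<^sub>R A + u *\<^sub>R B" using assms(3) by (auto simp: in_segment)
  then have "z \<bullet> d = (1 - u) * t + u * t" by (simp add: inner_add_left assms(1,2))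
  then show ?thesis by (simp add: algebra_simps)
qed

lemma one_side_disjoint:
  fixes A B C E d :: "'a::real_inner"
  assumes "C \<bullet> d = t" "E \<bullet> d = t"
    and "A \<bullet> d \<le> t \<and> B \<bullet> d \<le> t \<or> t \<le> A \<bullet> d \<and> t \<le> B \<bullet> d" "A \<bullet> d \<noteq> t \<or> B \<bullet> d \<noteq> t"
  shows "open_segment A B \<inter> open_segment C E = {}"
proof -
  have "z \<bullet> d \<noteq> t" if "z \<in> open_segment A B" for z
    using assms(3)
  proof
    assume "A \<bullet> d \<le> t \<and> B \<bullet> d \<le> t"
    then show ?thesis using open_segment_side[of A d t B z] assms(4) that by force
  next
    assume "t \<le> A \<bullet> d \<and> t \<le> B \<bullet> d"
    then show ?thesis using open_segment_side[of A "- d" "- t" B z] assms(4) that by force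
  qed
  moreover have "z \<bullet> d = t" if "z \<in> open_segment C E" for z
    using closed_segment_level[OF assms(1,2)] that open_closed_segment by blast
  ultimately show ?thesis by blast
qed

lemma rays_disjoint:
  fixes A B :: "'a::real_normed_vector"
  assumes "norm A = norm B" "A \<noteq> B" "A \<noteq> 0"
  shows "open_segment A 0 \<inter> open_segment B 0 = {}"
proof -
  have False if z: "z \<in> open_segment A 0" "z \<in> open_segment B 0" for z
  proof -
    obtain u where u: "0 < u" "u < 1" "z = (1 - u) *\<^sub>R A" using z(1) by (auto simp: in_segment)
    obtain w where w: "0 < w" "w < 1" "z = (1 - w) *\<^sub>R B" using z(2) by (auto simp: in_segment)
    have "(1 - u) * norm A = (1 - w) * norm A" using u w assms(1) by (metis abs_of_pos diff_gt_0_iff_gt norm_scaleR)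
    then have "u = w" using assms(3) by simp
    then show False using u w assms(2) by simp
  qed
  then show ?thesis by blast
qed

section \<open>The zigzag of vertices in coordinates\<close>

context snake_plane
begin

text \<open>The angle of vertex i in units of \<open>\<delta>\<close>, modulo a full turn. For
  \<open>Mns\<close>, \<open>enlarge\<close> adds 2 to \<open>K i\<close>. For \<open>Pls\<close>
  its shift by 4, added to a full turn 2N of the h-gon, is a full turn 2N + 4 of the new polygon, so
  \<open>K i\<close> is unchanged. At 0 and N + 1 the formula gives the two new vertices.\<close>

definition J :: "nat \<Rightarrow> int" where "J i = (if e i = Pls then 1 - int i else int i + 2)"
definition \<delta> :: real where "\<delta> = pi / real (N + 2)"
definition pt :: "nat \<Rightarrow> complex" where "pt i = rcis \<rho> (J i * \<delta>)"
abbreviation X :: "nat \<Rightarrow> 'a lpoint" where "X i \<equiv> Vertex (pt i)"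
abbreviation dir where "dir \<equiv> mirror_dir N"

lemma delta: "(real N + 2) * \<delta> = pi"
  by (simp add: \<delta>_def field_simps)

lemma hat_x:
  assumes "1 \<le> i" "i \<le> N"
  shows "hat D c \<omega> (x i) = X i"
proof -
  have ne: "pr (x i) \<noteq> 0" using pr_x_theta[OF assms] rho by simp
  have "enlarge N (pr (x i)) = pt i"
  proof (cases "e i")
    case Pls
    \<comment> \<open>\<open>K i\<close> is at most 0 for this class; a full turn of 2N units brings
      it into the range N + 1 to 2N, the second branch of \<open>enlarge\<close>.\<close>
    have "K i * pi / N = real (2 * N + 1 - i) * pi / real N - 2 * pi"
      using Pls assms N_ge by (simp add: K_def field_simps of_nat_diff)
    then have "pr (x i) = rcis \<rho> (real (2 * N + 1 - i) * pi / real N)"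
      using pr_x[OF assms] by (simp add: complex_eq_iff cos_diff sin_diff)
    moreover have "1 \<le> 2 * N + 1 - i" "2 * N + 1 - i \<le> 2 * N" "\<not> 2 * N + 1 - i \<le> N" using assms by auto
    ultimately have "enlarge N (pr (x i)) = rcis \<rho> (real (2 * N + 1 - i + 4) * pi / real (N + 2))"
      using enlarge_rcis[of \<rho> "2 * N + 1 - i" N] rho by presburger
    also have "real (2 * N + 1 - i + 4) * pi / real (N + 2) = J i * \<delta> + 2 * pi"
      using Pls assms by (simp add: J_def \<delta>_def field_simps of_nat_diff)
    finally show ?thesis by (simp add: pt_def complex_eq_iff cos_add sin_add)
  next
    case Mns
    have "pr (x i) = rcis \<rho> (real i * pi / real N)"
      using pr_x[OF assms] Mns by (simp add: K_def)
    then have "enlarge N (pr (x i)) = rcis \<rho> (real (i + 2) * pi / real (N + 2))"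
      using enlarge_rcis[of \<rho> i N] rho assms by simp
    then show ?thesis using Mns by (simp add: pt_def J_def \<delta>_def add.commute)
  qed
  then show ?thesis using ne by (simp add: hat_def Let_def coxeter_number_eq)
qed

lemma hat_Q: "q \<in> Q \<Longrightarrow> hat D c \<omega> q = Origin q"
  by (simp add: hat_def pr_Q)

lemma norm_pt: "norm (pt i) = \<rho>"
  using rho by (simp add: pt_def rcis_def norm_mult)

lemma pt_nonzero: "pt i \<noteq> 0"
  using norm_pt[of i] rho by auto

text \<open>The angle between vertex i and the direction of \<open>L'_\<epsilon>\<close>, in units
  of \<open>\<delta>\<close>. For i up to N + 1 this angle lies between 0 and pi, where cosine
  decreases, so comparisons of inner products become comparisons of integers.\<close>

definition gap where "gap \<epsilon> i = (if e i = \<epsilon> then i else Suc i)"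

lemma pt_dir: "pt i \<bullet> dir \<epsilon> = \<rho> * cos (gap \<epsilon> i * \<delta>)"
proof -
  have *: "rcis r a \<bullet> cis b = r * cos (a - b)" for r a b
    by (simp add: inner_complex_def cos_diff algebra_simps)
  have d: "dir Pls = cis (1 * \<delta>)" "dir Mns = cis (2 * \<delta>)"
    by (simp_all add: \<delta>_def)
  show ?thesis
  proof (cases "\<epsilon>"; cases "e i")
    assume a: "\<epsilon> = Pls" "e i = Pls"
    have "(1 - real i) * \<delta> - 1 * \<delta> = - (real i * \<delta>)"
      by (simp add: left_diff_distrib distrib_right)
    then show ?thesis unfolding pt_def a d * by (simp add: J_def gap_def a(2))
  next
    assume a: "\<epsilon> = Pls" "e i = Mns"
    have "(real i + 2) * \<delta> - 1 * \<delta> = real (Suc i) * \<delta>"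
      by (simp add: left_diff_distrib distrib_right)
    then show ?thesis unfolding pt_def a d * by (simp add: J_def gap_def a(2))
  next
    assume a: "\<epsilon> = Mns" "e i = Pls"
    have "(1 - real i) * \<delta> - 2 * \<delta> = - (real (Suc i) * \<delta>)"
      by (simp add: left_diff_distrib distrib_right)
    then show ?thesis unfolding pt_def a d * by (simp add: J_def gap_def a(2))
  next
    assume a: "\<epsilon> = Mns" "e i = Mns"
    have "(real i + 2) * \<delta> - 2 * \<delta> = real i * \<delta>"
      by (simp add: left_diff_distrib distrib_right)
    then show ?thesis unfolding pt_def a d * by (simp add: J_def gap_def a(2))
  qed
qed

lemma cos_gap_less:
  assumes "a < b" "b \<le> N + 2"
  shows "\<rho> * cos (real b * \<delta>) < \<rho> * cos (real a * \<delta>)"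
proof -
  have "real b * pi \<le> real (N + 2) * pi" using assms by (intro mult_right_mono) auto
  then have "real b * \<delta> \<le> pi" by (simp add: \<delta>_def field_simps)
  moreover have "real a * \<delta> < real b * \<delta>"
    using assms by (intro mult_strict_right_mono) (auto simp: \<delta>_def)
  ultimately have "cos (real b * \<delta>) < cos (real a * \<delta>)"
    by (intro cos_monotone_0_pi) (auto simp: \<delta>_def)
  then show ?thesis using rho by simp
qed

text \<open>The mirror of the class opposite to \<open>e l\<close> swaps vertices l and l + 1, so
  its direction is perpendicular to the segment joining them and that segment lies on a level
  line.\<close>

definition level where "level l z = z \<bullet> dir (opp (e l))"

lemma level_pt: "level l (pt i) = \<rho> * cos (gap (opp (e l)) i * \<delta>)"
  by (simp add: level_def pt_dir)

lemma gap_l: "gap (opp (e l)) l = Suc l" "gap (opp (e l)) (Suc l) = Suc l"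
  by (auto simp: gap_def e_Suc)

lemma level_Suc: "level l (pt (Suc l)) = level l (pt l)"
  by (simp add: level_pt gap_l)

lemma level_less: "i < l \<Longrightarrow> l \<le> N \<Longrightarrow> level l (pt l) < level l (pt i)"
  unfolding level_pt gap_l by (rule cos_gap_less) (auto simp: gap_def)

lemma level_greater: "Suc l < i \<Longrightarrow> i \<le> Suc N \<Longrightarrow> level l (pt i) < level l (pt l)"
  unfolding level_pt gap_l by (rule cos_gap_less) (auto simp: gap_def)

lemma level_le: "i \<le> Suc l \<Longrightarrow> l \<le> N \<Longrightarrow> level l (pt l) \<le> level l (pt i)"
  using level_less[of i l] level_Suc[of l] by (metis le_SucE le_neq_implies_less less_imp_le order_refl)

lemma level_ge: "l \<le> i \<Longrightarrow> i \<le> Suc N \<Longrightarrow> level l (pt i) \<le> level l (pt l)"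
  using level_greater[of l i] level_Suc[of l] by (metis le_neq_implies_less less_imp_le order_refl Suc_lessI)

text \<open>The position determines both gaps. They are i and i + 1 in an order given by
  \<open>e i\<close>, so together they determine i.\<close>

lemma pt_inj:
  assumes "i \<le> Suc N" "j \<le> Suc N" "pt i = pt j"
  shows "i = j"
proof -
  have "gap \<epsilon> i = gap \<epsilon> j" for \<epsilon>
  proof (rule ccontr)
    assume "gap \<epsilon> i \<noteq> gap \<epsilon> j"
    moreover have "gap \<epsilon> i \<le> N + 2" "gap \<epsilon> j \<le> N + 2" using assms by (auto simp: gap_def)
    ultimately show False
      using cos_gap_less[of "gap \<epsilon> i" "gap \<epsilon> j"] cos_gap_less[of "gap \<epsilon> j" "gap \<epsilon> i"]
        pt_dir[of i \<epsilon>] pt_dir[of j \<epsilon>] assms(3) by (metis less_irrefl linorder_neqE_nat)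
  qed
  from this[of Pls] this[of Mns] show ?thesis by (cases "e i"; cases "e j") (simp_all add: gap_def)
qed

text \<open>The reflection in \<open>L'\<^sub>\<epsilon>\<close> acts on the zigzag of vertices by swapping neighbours.\<close>

definition swp :: "pm \<Rightarrow> nat \<Rightarrow> nat" where
  "swp \<epsilon> i = (if e i = \<epsilon> then i - 1 else if i = Suc N then i else Suc i)"

lemma line_refl_pt: 
  assumes "i \<le> Suc N"
  shows "line_refl (dir \<epsilon>) (pt i) = pt (swp \<epsilon> i)"
proof -
  let ?m = "if \<epsilon> = Pls then 1 else 2 :: int"
  have d: "dir \<epsilon> = cis (?m * \<delta>)" by (cases \<epsilon>) (auto simp: \<delta>_def)
  have cis: "(cis a)\<^sup>2 * cnj (rcis r b) = rcis r (2 * a - b)" for a b r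
    by (simp add: power2_eq_square rcis_def cis_cnj cis_mult mult.left_commute)
  have "line_refl (dir \<epsilon>) (pt i) = rcis \<rho> ((2 * ?m - J i) * \<delta>)"
    unfolding line_refl_def d pt_def cis by (simp add: left_diff_distrib)
  also have "\<dots> = pt (swp \<epsilon> i)"
  \<comment> \<open>Away from a fixed end, reflection takes \<open>J i\<close> exactly to
    \<open>J\<close> of the neighbour. A fixed end lies on the mirror: at 0 truncated subtraction
    returns 0, and at N + 1 the angle returns up to a full turn of 2(N + 2) units.\<close>
  proof (cases "e i = \<epsilon> \<and> 0 < i \<or> e i \<noteq> \<epsilon> \<and> i \<noteq> Suc N")
    case True
    then have "2 * ?m - J i = J (swp \<epsilon> i)"
      using e_Suc[of i] e_diff_1[of i] by (cases \<epsilon>; cases "e i"; cases "e (i - 1)") (auto simp: J_def swp_def of_nat_diff)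
    then show ?thesis by (simp add: pt_def)
  next
    case False
    show ?thesis
    proof (cases "i = 0")
      case True
      then have "2 * ?m - J i = J (swp \<epsilon> i)"
        using False by (cases \<epsilon>; cases "e 0") (auto simp: J_def swp_def)
      then show ?thesis by (simp add: pt_def)
    next
      case i: False
      then have [simp]: "i = Suc N" and ei: "e (Suc N) \<noteq> \<epsilon>" using False by auto
      have s: "swp \<epsilon> i = Suc N" using ei by (simp add: swp_def)
      have "2 * ?m - J i = J (Suc N) + 2 * (int N + 2) \<or> 2 * ?m - J i = J (Suc N) - 2 * (int N + 2)"
        using ei by (cases \<epsilon>; cases "e (Suc N)") (auto simp: J_def)
      then have "real_of_int (2 * ?m - J i) * \<delta> = J (Suc N) * \<delta> + 2 * ((real N + 2) * \<delta>) \<or>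
        real_of_int (2 * ?m - J i) * \<delta> = J (Suc N) * \<delta> - 2 * ((real N + 2) * \<delta>)"
        by (elim disj_forward) (simp_all only:, simp_all add: distrib_right left_diff_distrib)
      then show ?thesis unfolding s pt_def delta
        by (auto simp: complex_eq_iff cos_add sin_add cos_diff sin_diff)
    qed
  qed
  finally show ?thesis .
qed

lemma swp_le: "i \<le> Suc N \<Longrightarrow> swp \<epsilon> i \<le> Suc N"
  by (auto simp: swp_def)

section \<open>Central symmetry and the gray zone\<close>

lemma e_even: "e (i + 2 * k) = e i"
  by (induction k) (auto simp: e_Suc)

lemma e_antipode: "q \<in> Q \<Longrightarrow> i \<le> Suc N \<Longrightarrow> e (Suc N - i) = opp (e i)"
proof -
  assume q: "q \<in> Q" and i: "i \<le> Suc N"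
  show ?thesis
  proof (cases "i \<le> M")
    case True
    then have "Suc N - i = Suc (i + 2 * (M - i))" using N_eq[OF q] by simp
    then show ?thesis using e_even e_Suc by metis
  next
    case False
    then have "i = Suc ((Suc N - i) + 2 * (i - Suc M))" using N_eq[OF q] i by simp
    then show ?thesis using e_even e_Suc opp_opp by metis
  qed
qed

text \<open>With origin points present N is even, so the polygon is centrally symmetric, and i and N
  + 1 - i belong to opposite classes.\<close>

lemma pt_antipode:
  assumes "q \<in> Q" "i \<le> Suc N"
  shows "pt (Suc N - i) = - pt i"
proof -
  have "J (Suc N - i) = J i + (int N + 2) \<or> J (Suc N - i) = J i - (int N + 2)"
    using e_antipode[OF assms] assms by (cases "e i") (auto simp: J_def of_nat_diff)
  then have "real_of_int (J (Suc N - i)) * \<delta> = J i * \<delta> + (real N + 2) * \<delta> \<or>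
     real_of_int (J (Suc N - i)) * \<delta> = J i * \<delta> - (real N + 2) * \<delta>"
    by (elim disj_forward) (simp_all only:, simp_all add: distrib_right left_diff_distrib)
  then show ?thesis unfolding pt_def delta
    by (auto simp: complex_eq_iff cos_add sin_add cos_diff sin_diff)
qed

lemma cos_nonneg_iff:
  assumes "a \<le> N + 2"
  shows "0 \<le> \<rho> * cos (real a * \<delta>) \<longleftrightarrow> 2 * a \<le> N + 2"
proof
  assume "2 * a \<le> N + 2"
  then have "real (2 * a) * pi \<le> real (N + 2) * pi" by (intro mult_right_mono) auto
  then have "real a * \<delta> \<le> pi / 2" by (simp add: \<delta>_def field_simps)
  then show "0 \<le> \<rho> * cos (real a * \<delta>)" using rho by (intro mult_nonneg_nonneg cos_ge_zero) (auto simp: \<delta>_def intro: order_trans[of _ 0])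
next
  assume p: "0 \<le> \<rho> * cos (real a * \<delta>)"
  show "2 * a \<le> N + 2"
  proof (rule ccontr)
    assume "\<not> ?thesis"
    then have "real (N + 2) * pi < real (2 * a) * pi" by (intro mult_strict_right_mono) auto
    then have 1: "pi / 2 < real a * \<delta>" by (simp add: \<delta>_def field_simps)
    have "real a * pi \<le> real (N + 2) * pi" using assms by (intro mult_right_mono) auto
    then have "real a * \<delta> \<le> pi" by (simp add: \<delta>_def field_simps)
    then have "cos (real a * \<delta>) < cos (pi / 2)" using 1 by (intro cos_monotone_0_pi) (auto simp: \<delta>_def)
    then show False using p rho by (simp add: zero_le_mult_iff)
  qed
qed

text \<open>The gaps of vertex b are b and b + 1, and M + 1 units make a right angle. So both inner
  products are nonnegative exactly for b \<le> M, and the gray zone separates the indices up to M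
  from the rest.\<close>

lemma pt_obtuse:
  assumes "q \<in> Q" "a \<le> Suc N"
  shows "pt a \<in> obtuse_wedge N \<longleftrightarrow> a \<le> M" "pt a \<in> uminus ` obtuse_wedge N \<longleftrightarrow> M < a"
proof -
  have 1: "pt b \<in> obtuse_wedge N \<longleftrightarrow> b \<le> M" if "b \<le> Suc N" for b
  proof -
    have "pt b \<in> obtuse_wedge N \<longleftrightarrow> 2 * gap Pls b \<le> N + 2 \<and> 2 * gap Mns b \<le> N + 2"
      unfolding obtuse_wedge_def mem_Collect_eq pt_dir using that
      by (subst (1 2) cos_nonneg_iff) (auto simp: gap_def)
    then show ?thesis using N_eq[OF assms(1)] by (cases "e b") (auto simp: gap_def)
  qed
  show "pt a \<in> obtuse_wedge N \<longleftrightarrow> a \<le> M" using 1 assms by blast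
  have "pt a \<in> uminus ` obtuse_wedge N \<longleftrightarrow> pt (Suc N - a) \<in> obtuse_wedge N"
    using pt_antipode[OF assms] by (metis (no_types, lifting) add.inverse_inverse image_iff)
  then show "pt a \<in> uminus ` obtuse_wedge N \<longleftrightarrow> M < a" using 1[of "Suc N - a"] N_eq[OF assms(1)] by auto
qed

text \<open>Vertices M and M + 1 have gap M + 1, a right angle as N + 2 = 2(M + 1): the middle
  segment is a diameter.\<close>

lemma level_M_zero:
  assumes "q \<in> Q"
  shows "level M (pt M) = 0"
proof -
  have "real N = 2 * real M" using N_eq[OF assms] by simp
  then have "2 * (real (Suc M) * \<delta>) = (real N + 2) * \<delta>" by (simp only: of_nat_Suc) (simp add: algebra_simps)
  then have "real (Suc M) * \<delta> = pi / 2" unfolding delta by simp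
  then show ?thesis unfolding level_pt gap_l by (simp only: cos_pi_half mult_zero_right)
qed

lemma level_pos: "q \<in> Q \<Longrightarrow> l < M \<Longrightarrow> 0 < level l (pt l)"
proof -
  assume q: "q \<in> Q" and l: "l < M"
  have "level M (pt M) < level l (pt l)" unfolding level_pt gap_l
    by (rule cos_gap_less) (use l N_eq[OF q] in auto)
  then show ?thesis using level_M_zero[OF q] by simp
qed

lemma level_neg: "q \<in> Q \<Longrightarrow> M < l \<Longrightarrow> l \<le> N \<Longrightarrow> level l (pt l) < 0"
proof -
  assume q: "q \<in> Q" and l: "M < l" "l \<le> N"
  have "level l (pt l) < level M (pt M)" unfolding level_pt gap_l
    by (rule cos_gap_less) (use l N_eq[OF q] in auto)
  then show ?thesis using level_M_zero[OF q] by simp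
qed

section \<open>Which segments cross\<close>

lemma unlabeled_differ: "pos A \<in> unlabeled s \<Longrightarrow> pos A \<notin> unlabeled t \<Longrightarrow> unlabeled s \<noteq> unlabeled t"
  by blast

lemma pt_notin_side: "i < l \<Longrightarrow> l \<le> N \<Longrightarrow> pt i \<notin> unlabeled {X l, X (Suc l)}"
  using closed_segment_level[of "pt l" "dir (opp (e l))" "level l (pt l)" "pt (Suc l)" "pt i"]
    level_less[of i l] level_Suc[of l] by (auto simp: unlabeled_pair level_def)

lemma pt_neq: "i < j \<Longrightarrow> j \<le> Suc N \<Longrightarrow> pt i \<noteq> pt j"
  using pt_inj[of i j] by auto

text \<open>Indices below l and above l + 1 lie strictly on opposite sides of the level line through
  vertices l and l + 1.\<close>

lemma cross_XX:
  assumes "a < l" "Suc l < b" "b \<le> Suc N"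
  shows "segments_cross {X a, X b} {X l, X (Suc l)}" "unlabeled {X a, X b} \<noteq> unlabeled {X l, X (Suc l)}"
proof -
  obtain P where "P \<in> open_segment (pt a) (pt b)" "P \<in> open_segment (pt l) (pt (Suc l))"
    using chord_cross[of "pt l" \<rho> "pt (Suc l)" "dir (opp (e l))" "level l (pt l)" "pt a" "pt b"]
      level_less[of a l] level_greater[of l b] level_Suc[of l] pt_neq[of l "Suc l"] norm_pt assms
    by (auto simp: level_def)
  then show "segments_cross {X a, X b} {X l, X (Suc l)}"
    using pt_neq[of a b] pt_neq[of l "Suc l"] assms by (subst segments_cross_iff) auto
  have "pos (X a) \<in> unlabeled {X a, X b}" by (simp add: unlabeled_pair)
  then show "unlabeled {X a, X b} \<noteq> unlabeled {X l, X (Suc l)}"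
    using pt_notin_side[of a l] assms by (intro unlabeled_differ[of "X a"]) auto
qed

lemma nocross_XX:
  assumes "a < b" "b \<le> Suc N" "l \<le> N" "l \<le> a \<or> b \<le> Suc l" "a \<noteq> l \<or> b \<noteq> Suc l"
  shows "\<not> segments_cross {X a, X b} {X l, X (Suc l)}"
proof -
  let ?d = "dir (opp (e l))" and ?t = "level l (pt l)"
  have "open_segment (pt a) (pt b) \<inter> open_segment (pt l) (pt (Suc l)) = {}"
  proof (rule one_side_disjoint[of _ ?d ?t])
    show "pt l \<bullet> ?d = ?t" "pt (Suc l) \<bullet> ?d = ?t" using level_Suc[of l] by (auto simp: level_def)
    show "pt a \<bullet> ?d \<le> ?t \<and> pt b \<bullet> ?d \<le> ?t \<or> ?t \<le> pt a \<bullet> ?d \<and> ?t \<le> pt b \<bullet> ?d"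
      using level_ge[of l a] level_ge[of l b] level_le[of a l] level_le[of b l] assms
      by (auto simp: level_def)
    have "a < l \<or> Suc l < b" using assms by auto
    then show "pt a \<bullet> ?d \<noteq> ?t \<or> pt b \<bullet> ?d \<noteq> ?t"
      using level_less[of a l] level_greater[of l b] assms by (auto simp: level_def)
  qed
  then show ?thesis using pt_neq[of a b] pt_neq[of l "Suc l"] assms by (subst segments_cross_iff) auto
qed

lemma cross_XO:
  assumes "q \<in> Q" "a < l" "l < M"
  shows "segments_cross {X a, Origin y} {X l, X (Suc l)}" "unlabeled {X a, Origin y} \<noteq> unlabeled {X l, X (Suc l)}"
proof -
  have l: "l \<le> N" using assms N_eq by fastforce
  obtain P where "P \<in> open_segment (pt a) 0" "P \<in> open_segment (pt l) (pt (Suc l))"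
    using chord_cross[of "pt l" \<rho> "pt (Suc l)" "dir (opp (e l))" "level l (pt l)" "pt a" 0]
      level_less[of a l] level_pos[of q l] level_Suc[of l] pt_neq[of l "Suc l"] norm_pt assms l rho
    by (auto simp: level_def)
  then show "segments_cross {X a, Origin y} {X l, X (Suc l)}"
    using pt_nonzero[of a] pt_neq[of l "Suc l"] l by (subst segments_cross_iff) auto
  have "pos (X a) \<in> unlabeled {X a, Origin y}" by (simp add: unlabeled_pair)
  then show "unlabeled {X a, Origin y} \<noteq> unlabeled {X l, X (Suc l)}"
    using pt_notin_side[of a l] assms l by (intro unlabeled_differ[of "X a"]) auto
qed

lemma nocross_XO:
  assumes "q \<in> Q" "a \<le> Suc N" "l \<le> N" "l < M \<and> l \<le> a \<or> M < l \<and> a \<le> Suc l"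
  shows "\<not> segments_cross {X a, Origin y} {X l, X (Suc l)}"
proof -
  let ?d = "dir (opp (e l))" and ?t = "level l (pt l)"
  have "open_segment (pt a) 0 \<inter> open_segment (pt l) (pt (Suc l)) = {}"
  proof (rule one_side_disjoint[of _ ?d ?t])
    show "pt l \<bullet> ?d = ?t" "pt (Suc l) \<bullet> ?d = ?t" using level_Suc[of l] by (auto simp: level_def)
    show "pt a \<bullet> ?d \<le> ?t \<and> 0 \<bullet> ?d \<le> ?t \<or> ?t \<le> pt a \<bullet> ?d \<and> ?t \<le> 0 \<bullet> ?d"
      using level_ge[of l a] level_le[of a l] level_pos[of q l] level_neg[of q l] assms
      by (auto simp: level_def)
    show "pt a \<bullet> ?d \<noteq> ?t \<or> 0 \<bullet> ?d \<noteq> ?t"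
      using level_pos[of q l] level_neg[of q l] assms by (auto simp: level_def)
  qed
  then show ?thesis using pt_nonzero[of a] pt_neq[of l "Suc l"] assms by (subst segments_cross_iff) auto
qed

text \<open>The middle diameter is present only as two radii. The condition a + b \<noteq> N + 1
  keeps the chord from being a diameter, so it meets the middle one away from the centre and crosses
  one of the radii. Which one is left open, so the labels come from a function
  \<open>y\<close>.\<close>

lemma cross_XM:
  assumes q: "q \<in> Q" and a: "a < M" "Suc M < b" "b \<le> Suc N" "a + b \<noteq> Suc N"
  shows "\<exists>m\<in>{M, Suc M}. segments_cross {X a, X b} {X m, Origin (y m)} \<and>
    unlabeled {X a, X b} \<noteq> unlabeled {X m, Origin (y m)}"
proof -
  have M: "M \<le> N" using N_eq[OF q] by simp
  have anti: "pt (Suc M) = - pt M" using pt_antipode[OF q, of M] N_eq[OF q] by (simp add: Suc_diff_le)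
  obtain P where P: "P \<in> open_segment (pt a) (pt b)" "P \<in> open_segment (pt M) (pt (Suc M))"
    using chord_cross[of "pt M" \<rho> "pt (Suc M)" "dir (opp (e M))" "level M (pt M)" "pt a" "pt b"]
      level_less[of a M] level_greater[of M b] level_Suc[of M] pt_neq[of M "Suc M"] norm_pt a M
    by (auto simp: level_def)
  have ne: "0 \<notin> open_segment (pt a) (pt b)"
  proof
    assume "0 \<in> open_segment (pt a) (pt b)"
    then obtain u where u: "0 < u" "u < 1" "0 = (1 - u) *\<^sub>R pt a + u *\<^sub>R pt b" by (auto simp: in_segment)
    then have 0: "(1 - u) *\<^sub>R pt a = - (u *\<^sub>R pt b)" by (simp add: eq_neg_iff_add_eq_0)
    then have "norm ((1 - u) *\<^sub>R pt a) = norm (u *\<^sub>R pt b)" by simp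
    then have "(1 - u) * \<rho> = u * \<rho>" using u by (simp add: norm_pt)
    then have "u = 1/2" using rho by simp
    then have "(1/2) *\<^sub>R pt a = (1/2) *\<^sub>R (- pt b)" using 0 unfolding \<open>u = 1/2\<close> by simp
    then have "pt a = - pt b" unfolding scaleR_cancel_left by simp
    then have "pt b = - pt a" by simp
    then have "pt b = pt (Suc N - a)" using pt_antipode[OF q, of a] a M by simp
    then show False using pt_inj[of b "Suc N - a"] a by auto
  qed
  have nu: "unlabeled {X a, X b} \<noteq> unlabeled {X m, Origin (y m)}" if "m \<in> {M, Suc M}" for m
  proof (rule unlabeled_differ[of "X a"])
    show "pos (X a) \<in> unlabeled {X a, X b}" by (simp add: unlabeled_pair)
    have "level M (pt m) = 0" using that level_M_zero[OF q] level_Suc[of M] by auto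
    then show "pos (X a) \<notin> unlabeled {X m, Origin (y m)}"
      using closed_segment_level[of "pt m" "dir (opp (e M))" 0 0 "pt a"] level_less[of a M] level_M_zero[OF q] a M
      by (auto simp: unlabeled_pair level_def)
  qed
  obtain u where u: "0 < u" "u < 1" "P = (1 - u) *\<^sub>R pt M + u *\<^sub>R pt (Suc M)" using P(2) by (auto simp: in_segment)
  have Pu: "P = (1 - 2 * u) *\<^sub>R pt M" "P = (1 - 2 * (1 - u)) *\<^sub>R pt (Suc M)"
    unfolding u(3) anti by (simp_all add: algebra_simps scaleR_2 flip: scaleR_add_left)
  have "P = 0" if "u = 1/2" using Pu(1) that by simp
  then have "u \<noteq> 1/2" using P(1) ne by blast
  then consider "u < 1/2" | "1/2 < u" by linarith
  then have "\<exists>m\<in>{M, Suc M}. P \<in> open_segment (pt m) 0"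
  proof cases
    case 1
    then have "P \<in> open_segment (pt M) 0"
      using u Pu(1) pt_nonzero by (auto simp: in_segment intro!: exI[of _ "2 * u"])
    then show ?thesis by blast
  next
    case 2
    then have "P \<in> open_segment (pt (Suc M)) 0"
      using u Pu(2) pt_nonzero by (auto simp: in_segment intro!: exI[of _ "2 * (1 - u)"])
    then show ?thesis by blast
  qed
  then obtain m where m: "m \<in> {M, Suc M}" "P \<in> open_segment (pt m) 0" by blast
  have "segments_cross {X a, X b} {X m, Origin (y m)}"
    using m P(1) pt_neq[of a b] a pt_nonzero by (subst segments_cross_iff) auto
  then show ?thesis using m nu by blast
qed

lemma nocross_XM:
  assumes "q \<in> Q" "a < b" "b \<le> Suc N" "M \<le> a \<or> b \<le> Suc M" "a \<noteq> M \<or> b \<noteq> Suc M" "m = M \<or> m = Suc M"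
  shows "\<not> segments_cross {X a, X b} {X m, Origin y}"
proof -
  let ?d = "dir (opp (e M))"
  have M: "M \<le> N" using N_eq[OF assms(1)] by simp
  have "open_segment (pt a) (pt b) \<inter> open_segment (pt m) 0 = {}"
  proof (rule one_side_disjoint[of _ ?d 0])
    show "pt m \<bullet> ?d = 0" "0 \<bullet> ?d = 0" using level_Suc[of M] level_M_zero[OF assms(1)] assms(6) by (auto simp: level_def)
    show "pt a \<bullet> ?d \<le> 0 \<and> pt b \<bullet> ?d \<le> 0 \<or> 0 \<le> pt a \<bullet> ?d \<and> 0 \<le> pt b \<bullet> ?d"
      using level_ge[of M a] level_ge[of M b] level_le[of a M] level_le[of b M] level_M_zero[OF assms(1)] assms M
      by (auto simp: level_def)
    have "a < M \<or> Suc M < b" using assms by auto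
    then show "pt a \<bullet> ?d \<noteq> 0 \<or> pt b \<bullet> ?d \<noteq> 0"
      using level_less[of a M] level_greater[of M b] level_M_zero[OF assms(1)] assms M by (auto simp: level_def)
  qed
  then show ?thesis using pt_neq[of a b] pt_nonzero[of m] assms by (subst segments_cross_iff) auto
qed

lemma nocross_OO:
  assumes "a \<le> Suc N" "b \<le> Suc N" "a \<noteq> b"
  shows "\<not> segments_cross {X a, Origin y} {X b, Origin z}"
  using rays_disjoint[of "pt a" "pt b"] norm_pt pt_inj[of a b] pt_nonzero assms
  by (subst segments_cross_iff) auto

lemma gray_iff:
  assumes "q \<in> Q" "a \<le> Suc N" "b \<le> Suc N"
  shows "union_crosses_gray_zone N {X a, Origin y} {X b, Origin z} \<longleftrightarrow> (a \<le> M \<longleftrightarrow> M < b)"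
  using pt_obtuse[OF assms(1,2)] pt_obtuse[OF assms(1,3)] pt_nonzero
  by (auto simp: union_crosses_gray_zone_def)

text \<open>All vertices have the same norm, so collinear radii end at equal or opposite vertices,
  and central symmetry names the opposite index.\<close>

lemma collinear_OO_iff:
  assumes "q \<in> Q" "a \<le> Suc N" "b \<le> Suc N"
  shows "collinear (unlabeled {X a, Origin y} \<union> unlabeled {X b, Origin z}) \<longleftrightarrow> a = b \<or> a + b = Suc N"
proof
  assume "collinear (unlabeled {X a, Origin y} \<union> unlabeled {X b, Origin z})"
  then have "collinear {0, pt a, pt b}"
    by (rule collinear_subset) (auto simp: unlabeled_pair)
  then obtain k where k: "pt b = k *\<^sub>R pt a" using pt_nonzero by (auto simp: collinear_lemma)
  then have "\<bar>k\<bar> = 1" using norm_pt rho by (metis mult_cancel_right2 norm_scaleR less_irrefl)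
  then have "pt b = pt a \<or> pt b = - pt a" using k by (cases "k \<ge> 0") auto
  then have "pt b = pt a \<or> pt b = pt (Suc N - a)" using pt_antipode[OF assms(1,2)] by simp
  then show "a = b \<or> a + b = Suc N" using pt_inj[of b a] pt_inj[of b "Suc N - a"] assms by auto
next
  assume "a = b \<or> a + b = Suc N"
  then have "b = a \<or> b = Suc N - a" by auto
  then have "pt b = pt a \<or> pt b = - pt a" using pt_antipode[OF assms(1,2)] by auto
  then have "pt b \<in> span {pt a}" by (auto simp: span_base span_neg)
  then have "unlabeled {X a, Origin y} \<union> unlabeled {X b, Origin z} \<subseteq> span {pt a}"
    by (auto simp: unlabeled_pair in_segment span_base intro!: span_scale)
  then have "unlabeled {X a, Origin y} \<union> unlabeled {X b, Origin z} \<subseteq> range (\<lambda>k. k *\<^sub>R pt a)"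
    by (simp add: span_singleton)
  then show "collinear (unlabeled {X a, Origin y} \<union> unlabeled {X b, Origin z})"
    unfolding collinear_alt by (intro exI[of _ 0] exI[of _ "pt a"]) auto
qed

end

section \<open>Diagrams\<close>

lemma linear_line_refl: "linear (line_refl d)"
  by (rule linearI) (auto simp: line_refl_def algebra_simps scaleR_conv_of_real)

lemma line_refl_line_refl: "norm d = 1 \<Longrightarrow> line_refl d (line_refl d z) = z"
proof -
  assume "norm d = 1"
  then have "d * cnj d = 1" by (simp add: complex_norm_square[symmetric])
  then have "d\<^sup>2 * cnj (d\<^sup>2) = 1" by (simp add: power2_eq_square) (metis mult.assoc mult.left_commute mult.right_neutral)
  moreover have "line_refl d (line_refl d z) = (d\<^sup>2 * cnj (d\<^sup>2)) * z"
    by (simp add: line_refl_def mult.assoc)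
  ultimately show ?thesis by simp
qed

definition good :: "nat \<Rightarrow> 'a lpoint set set \<Rightarrow> 'a lpoint set set \<Rightarrow> bool" where
  "good h C1 C2 \<longleftrightarrow>
     (\<forall>s\<in>C1. \<forall>t\<in>C2. segments_cross s t \<longrightarrow> unlabeled s = unlabeled t) \<and>
     (\<forall>s\<in>C1. \<forall>t\<in>C2. same_origin_point s t \<longrightarrow>
        collinear (unlabeled s \<union> unlabeled t) \<or> \<not> union_crosses_gray_zone h s t)"

context snake_plane
begin

text \<open>The label of an origin point changes sign in passing from \<open>- \<alpha>\<close> to \<open>\<alpha> = \<tau>\<^sub>\<epsilon>(- \<alpha>)\<close>, because the simple
  reflections that move \<open>q\<close> all lie in \<open>S\<^sub>\<epsilon>\<close> with \<open>c\<^sub>\<epsilon> q = - q\<close>.\<close>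

definition idx where "idx y = (THE i. 1 \<le> i \<and> i \<le> N \<and> y = x i)"
definition mid where "mid y = (if y \<in> Q then Origin y else X (idx y))"
definition up where "up y = (if y \<in> Q then Origin (- y) else X (idx y - 1))"
definition down where "down y = (if y \<in> Q then Origin (- y) else X (Suc (idx y)))"

lemma idx_x: "1 \<le> i \<Longrightarrow> i \<le> N \<Longrightarrow> idx (x i) = i"
  unfolding idx_def by (rule the_equality) (auto simp: x_eq_iff)

lemma mid_x: "1 \<le> i \<Longrightarrow> i \<le> N \<Longrightarrow> mid (x i) = X i"
  and up_x: "1 \<le> i \<Longrightarrow> i \<le> N \<Longrightarrow> up (x i) = X (i - 1)"
  and down_x: "1 \<le> i \<Longrightarrow> i \<le> N \<Longrightarrow> down (x i) = X (Suc i)"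
  by (auto simp: mid_def up_def down_def x_notin_Q idx_x)

lemma mid_Q: "q \<in> Q \<Longrightarrow> mid q = Origin q"
  and up_Q: "q \<in> Q \<Longrightarrow> up q = Origin (- q)"
  and down_Q: "q \<in> Q \<Longrightarrow> down q = Origin (- q)"
  by (auto simp: mid_def up_def down_def)

lemma hat_mid: "y \<in> Orb \<Longrightarrow> hat D c \<omega> y = mid y"
  by (cases rule: Orb_cases) (auto simp: hat_x hat_Q mid_x mid_Q)

text \<open>The condition 0 < \<beta> \<bullet> y lists each swapped pair once, higher element
  first, so that \<open>up\<close> and \<open>down\<close> act on the proper ends.\<close>

definition posd where "posd \<beta> = {{up y, down (refl \<beta> y)} | y. y \<in> Orb \<and> 0 < \<beta> \<bullet> y}"
definition negd where "negd \<alpha> = {{mid y, mid (refl \<alpha> y)} | y. y \<in> Orb \<and> 0 < \<alpha> \<bullet> y}"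
definition dg where "dg \<beta> = (if \<beta> \<in> Pos then posd \<beta> else negd (- \<beta>))"

lemma neg_not_Pos: "\<alpha> \<in> \<Delta> \<Longrightarrow> - \<alpha> \<notin> Pos"
  using Pos_neg_simple by blast

lemma dg_Pos: "\<beta> \<in> Pos \<Longrightarrow> dg \<beta> = posd \<beta>" and dg_neg: "\<alpha> \<in> \<Delta> \<Longrightarrow> dg (- \<alpha>) = negd \<alpha>"
  by (auto simp: dg_def neg_not_Pos)

lemma neg_simple_diagram_eq:
  assumes "\<alpha> \<in> \<Delta>"
  shows "neg_simple_diagram D c \<omega> Orb \<alpha> = negd \<alpha>"
proof -
  have "{hat D c \<omega> y, hat D c \<omega> (refl \<alpha> y)} \<in> negd \<alpha>" if "y \<in> Orb" "refl \<alpha> y \<noteq> y" for y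
  proof (cases "0 < \<alpha> \<bullet> y")
    case True
    then show ?thesis using that hat_mid refl_simple_Orb assms by (auto simp: negd_def)
  next
    case False
    let ?z = "refl \<alpha> y"
    have "0 < \<alpha> \<bullet> ?z" "?z \<in> Orb"
      using False that refl_simple_Orb assms refl_fix_iff[of \<alpha> y] by (auto simp: inner_refl_self)
    then have "{mid ?z, mid (refl \<alpha> ?z)} \<in> negd \<alpha>" unfolding negd_def by blast
    then show ?thesis using hat_mid that \<open>?z \<in> Orb\<close> by (simp add: insert_commute)
  qed
  moreover have "{mid y, mid (refl \<alpha> y)} \<in> neg_simple_diagram D c \<omega> Orb \<alpha>" if "y \<in> Orb" "0 < \<alpha> \<bullet> y" for y
  proof -
    have "refl \<alpha> y \<noteq> y" using refl_fix_iff[of \<alpha> y] that by auto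
    then have "{hat D c \<omega> y, hat D c \<omega> (refl \<alpha> y)} \<in> neg_simple_diagram D c \<omega> Orb \<alpha>"
      using that unfolding neg_simple_diagram_def by blast
    then show ?thesis using hat_mid that refl_simple_Orb assms by simp
  qed
  ultimately show ?thesis unfolding neg_simple_diagram_def negd_def by blast
qed

text \<open>Radii come in opposite pairs: if \<alpha> swaps \<open>x M\<close> with q, it swaps -q
  with \<open>x (Suc M)\<close>. Each case records the partner because the symmetry of the drawing
  rests on it.\<close>

lemma negd_cases [consumes 2, case_names XX XO OX]:
  assumes "s \<in> negd \<alpha>" "\<alpha> \<in> \<Delta>"
  obtains i where "1 \<le> i" "i < N" "Q = {} \<or> i \<noteq> M" "\<alpha> \<in> D (e i)" "s = {X i, X (Suc i)}" "cf \<alpha> (x (Suc i)) < cf \<alpha> (x i)"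
  | q where "q \<in> Q" "\<alpha> \<in> D (e M)" "s = {X M, Origin q}" "cf \<alpha> q < cf \<alpha> (x M)" "{X (Suc M), Origin (- q)} \<in> negd \<alpha>"
  | q where "q \<in> Q" "\<alpha> \<in> D (e M)" "s = {X (Suc M), Origin q}" "cf \<alpha> (x (Suc M)) < cf \<alpha> q" "{X M, Origin (- q)} \<in> negd \<alpha>"
proof -
  obtain y where y: "s = {mid y, mid (refl \<alpha> y)}" "y \<in> Orb" "0 < \<alpha> \<bullet> y" using assms(1) by (auto simp: negd_def)
  have cf: "cf \<alpha> (refl \<alpha> y) < cf \<alpha> y" using cf_refl_less assms y by blast
  have negate: "{mid (- refl \<alpha> y), mid (- y)} \<in> negd \<alpha>" if "- refl \<alpha> y \<in> Orb"
  proof -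
    have "0 < \<alpha> \<bullet> (- refl \<alpha> y)" using y by (simp add: inner_refl_self)
    moreover have "refl \<alpha> (- refl \<alpha> y) = - y" by (simp add: refl_minus)
    ultimately show ?thesis using that unfolding negd_def by fastforce
  qed
  have M: "1 \<le> M \<and> Suc M \<le> N" if "q \<in> Q" for q using N_eq[OF that] M_ge[OF that] by simp
  from y(2) show ?thesis
  proof (cases rule: Orb_cases)
    case (x i)
    note u = simple_up[of i \<alpha>, OF x(1,2) assms(2) y(3)[unfolded x(3)]]
    show ?thesis
    proof (cases "(Q = {} \<or> i \<noteq> M) \<and> refl \<alpha> (x i) = x (Suc i)")
      case True
      then have "s = {X i, X (Suc i)}" using u x y(1) mid_x[of i] mid_x[of "Suc i"] by simp
      then show ?thesis using that(1)[of i] True u x cf by simp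
    next
      case False
      then have i: "i = M" and q: "refl \<alpha> y \<in> Q" using u x by auto
      have "s = {X M, Origin (refl \<alpha> y)}" using y(1) x i mid_x[of M] mid_Q[OF q] M[OF q] by simp
      moreover have "- y = x (Suc M)" using x i x_Suc_M[OF q] by simp
      then have "{X (Suc M), Origin (- refl \<alpha> y)} \<in> negd \<alpha>"
        using negate[OF Q_in[OF Q_uminus[OF q]]] mid_Q[OF Q_uminus[OF q]] mid_x[of "Suc M"] M[OF q]
        by (simp add: insert_commute)
      ultimately show ?thesis using that(2)[of "refl \<alpha> y"] q u i x cf by simp
    qed
  next
    case q: Q
    have r: "refl \<alpha> y = x (Suc M)"
      using only[OF assms(2) y(2,3)] q x_notin_Q[of M] x_notin_Q M[OF q] by auto
    then have "refl \<alpha> y \<noteq> y" using x_notin_Q[of "Suc M"] q M[OF q] by auto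
    then have "\<alpha> \<in> D (e M)" using simple_move_Q q assms(2) by blast
    moreover have "s = {X (Suc M), Origin y}"
      using y(1) r mid_x[of "Suc M"] mid_Q[OF q] M[OF q] by (simp add: insert_commute)
    moreover have "{X M, Origin (- y)} \<in> negd \<alpha>"
      using negate Q_uminus[OF q] r mid_Q mid_x[of M] M[OF q] x_Suc_M[OF q] x_in[of M] by simp
    ultimately show ?thesis using that(3)[of y] q cf r by simp
  qed
qed

lemma posd_cases [consumes 2, case_names XX XO OX]:
  assumes "s \<in> posd \<beta>" "\<beta> \<in> Pos"
  obtains i j where "1 \<le> i" "i < j" "j \<le> N" "Q = {} \<or> i + j \<noteq> Suc N" "refl \<beta> (x i) = x j" "s = {X (i - 1), X (Suc j)}"
  | i q where "1 \<le> i" "i \<le> M" "q \<in> Q" "refl \<beta> (x i) = q" "s = {X (i - 1), Origin (- q)}"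
  | j q where "M < j" "j \<le> N" "q \<in> Q" "refl \<beta> q = x j" "s = {X (Suc j), Origin (- q)}"
proof -
  obtain y where y: "s = {up y, down (refl \<beta> y)}" "y \<in> Orb" "0 < \<beta> \<bullet> y" using assms(1) by (auto simp: posd_def)
  from assms(2) y(2,3) show ?thesis
  proof (cases rule: Pos_pair)
    case (xx i j)
    then have "s = {X (i - 1), X (Suc j)}" using y(1) up_x[of i] down_x[of j] by simp
    then show ?thesis using that(1)[of i j] xx by simp
  next
    case (xQ i)
    have "up y = X (i - 1)" unfolding xQ(4) using xQ up_x by blast
    then have s: "s = {X (i - 1), Origin (- refl \<beta> y)}" unfolding y(1) down_Q[OF xQ(5)] by simp
    have "refl \<beta> (x i) = refl \<beta> y" unfolding xQ(4) ..
    then show ?thesis using that(2)[OF xQ(1,2,5)] s by blast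
  next
    case (Qx j)
    have "down (refl \<beta> y) = X (Suc j)" unfolding Qx(5) using Qx down_x by blast
    then have "s = {X (Suc j), Origin (- y)}" unfolding y(1) up_Q[OF Qx(4)] by (simp add: insert_commute)
    then show ?thesis using that(3)[OF Qx(1,3,4,5)] by blast
  qed
qed

lemma tau_point_X: "i \<le> Suc N \<Longrightarrow> tau_point D \<epsilon> (X i) = X (swp \<epsilon> i)"
  by (simp add: coxeter_number_eq line_refl_pt)

lemma norm_dir: "norm (dir \<epsilon>) = 1"
  by (cases \<epsilon>) auto

lemma tau_point_tau_point: "tau_point D \<epsilon> (tau_point D \<epsilon> A) = A"
  by (cases A) (simp_all add: coxeter_number_eq line_refl_line_refl[OF norm_dir])

lemma cox_x_eq:
  assumes "1 \<le> i" "i \<le> N"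
  shows "cox D \<epsilon> (x i) = (if e i = \<epsilon> then if i < N then x (Suc i) else x i else if 1 < i then x (i - 1) else x i)"
proof (cases "e i = \<epsilon>")
  case True
  then show ?thesis using cox_x[of i] cox_last assms by auto
next
  case False
  then have "e (i - 1) = \<epsilon>" using e_diff_1[OF assms(1)] by (cases \<epsilon>; cases "e i"; cases "e (i - 1)") auto
  then show ?thesis using cox_x_Suc[of "i - 1"] cox_first False assms by (cases "i = 1") auto
qed

text \<open>After the shift by one index, \<open>cox\<close> on the chain and \<open>swp\<close> on
  the vertices agree except at the bottom: class \<open>e N\<close> fixes \<open>x N\<close> but
  moves vertex N - 1. The higher element of a swapped pair is never \<open>x N\<close>. For
  \<open>tau_point_down\<close> the exception is \<open>x 1\<close>.\<close>

lemma tau_point_up: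
  assumes "y \<in> Q \<or> (\<exists>i. 1 \<le> i \<and> i < N \<and> y = x i)"
  shows "tau_point D \<epsilon> (up y) = up (cox D \<epsilon> y)"
  using assms
proof
  assume "y \<in> Q"
  then show ?thesis using cox_Q_in[of y \<epsilon>] by (simp add: up_Q cox_minus)
next
  assume "\<exists>i. 1 \<le> i \<and> i < N \<and> y = x i"
  then obtain i where i: "1 \<le> i" "i < N" "y = x i" by blast
  have e: "e i = opp (e (i - 1))" using e_diff_1 i by blast
  show ?thesis
  proof (cases "e i = \<epsilon>")
    case True
    then have "swp \<epsilon> (i - 1) = i" using e i by (auto simp: swp_def)
    then show ?thesis using i True by (simp add: up_x cox_x_eq tau_point_X del: tau_point.simps)
  next
    case False
    then have "e (i - 1) = \<epsilon>" using e by (cases \<epsilon>; cases "e i"; cases "e (i - 1)") auto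
    then have "swp \<epsilon> (i - 1) = i - 1 - 1" by (auto simp: swp_def)
    then show ?thesis using i False by (auto simp: up_x cox_x_eq tau_point_X simp del: tau_point.simps)
  qed
qed

lemma tau_point_down:
  assumes "y \<in> Q \<or> (\<exists>i. 1 < i \<and> i \<le> N \<and> y = x i)"
  shows "tau_point D \<epsilon> (down y) = down (cox D \<epsilon> y)"
  using assms
proof
  assume "y \<in> Q"
  then show ?thesis using cox_Q_in[of y \<epsilon>] by (simp add: down_Q cox_minus)
next
  assume "\<exists>i. 1 < i \<and> i \<le> N \<and> y = x i"
  then obtain i where i: "1 < i" "i \<le> N" "y = x i" by blast
  show ?thesis
  proof (cases "e i = \<epsilon>")
    case True
    then have "swp \<epsilon> (Suc i) = (if i = N then Suc N else Suc (Suc i))" using e_Suc[of i] by (auto simp: swp_def)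
    then show ?thesis using i True by (auto simp: down_x cox_x_eq tau_point_X simp del: tau_point.simps)
  next
    case False
    then have "e (Suc i) = \<epsilon>" using e_Suc[of i] by (cases \<epsilon>; cases "e i") auto
    then have "swp \<epsilon> (Suc i) = i" by (auto simp: swp_def)
    then show ?thesis using i False by (auto simp: down_x cox_x_eq tau_point_X simp del: tau_point.simps)
  qed
qed

lemma pt_dir_zero_iff:
  assumes "q \<in> Q" "a \<le> Suc N"
  shows "pt a \<bullet> dir \<epsilon> = 0 \<longleftrightarrow> gap \<epsilon> a = Suc M"
proof -
  have z: "\<rho> * cos (real (Suc M) * \<delta>) = 0" using level_M_zero[OF assms(1)] unfolding level_pt gap_l .
  have "gap \<epsilon> a \<le> N + 2" "Suc M \<le> N + 2" using assms N_eq[OF assms(1)] by (auto simp: gap_def)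
  then show ?thesis
    using cos_gap_less[of "gap \<epsilon> a" "Suc M"] cos_gap_less[of "Suc M" "gap \<epsilon> a"] z
    unfolding pt_dir by (cases "gap \<epsilon> a" "Suc M" rule: linorder_cases) auto
qed

lemma tau_segment_XX: "tau_segment D \<epsilon> {X a, X b} = tau_point D \<epsilon> ` {X a, X b}"
  by (simp add: tau_segment_def)

lemma tau_segment_XO:
  assumes "q \<in> Q" "a \<le> Suc N"
  shows "tau_segment D \<epsilon> {X a, Origin y} =
    (if gap \<epsilon> a = Suc M then {X a, Origin y} else tau_point D \<epsilon> ` {X a, Origin y})"
  using pt_dir_zero_iff[OF assms, of \<epsilon>]
  by (simp add: tau_segment_def coxeter_number_eq orthogonal_def inner_commute)

text \<open>The exceptional clause requires a radius with gap M + 1. In the diagram of a positive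
  root the radii end at indices up to M - 1 or from M + 2 on, whose gaps avoid this value.\<close>

lemma tau_segment_posd:
  assumes "s \<in> posd \<beta>" "\<beta> \<in> Pos"
  shows "tau_segment D \<epsilon> s = tau_point D \<epsilon> ` s"
  using assms
proof (cases rule: posd_cases)
  case (XX i j)
  then show ?thesis using tau_segment_XX by simp
next
  case (XO i q)
  then have "gap \<epsilon> (i - 1) \<noteq> Suc M" "i - 1 \<le> Suc N" using N_eq[OF XO(3)] by (auto simp: gap_def)
  then show ?thesis using XO tau_segment_XO[OF XO(3)] by simp
next
  case (OX j q)
  then have "gap \<epsilon> (Suc j) \<noteq> Suc M" "Suc j \<le> Suc N" by (auto simp: gap_def)
  then show ?thesis using OX tau_segment_XO[OF OX(3)] by simp
qed

lemma tau_segment_negd: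
  assumes "s \<in> negd \<alpha>" "\<alpha> \<in> D \<epsilon>"
  shows "tau_segment D \<epsilon> s = tau_point D \<epsilon> ` s"
  using assms(1) D_simples[OF assms(2)]
proof (cases rule: negd_cases)
  case (XX i)
  then show ?thesis using tau_segment_XX by simp
next
  case (XO q)
  then have "e M = \<epsilon>" using D_disjoint assms by blast
  then have "gap \<epsilon> M \<noteq> Suc M" "M \<le> Suc N" using N_eq[OF XO(1)] by (auto simp: gap_def)
  then show ?thesis using XO tau_segment_XO[OF XO(1)] by simp
next
  case (OX q)
  then have "e M = \<epsilon>" using D_disjoint assms by blast
  then have "gap \<epsilon> (Suc M) \<noteq> Suc M" "Suc M \<le> Suc N" using N_eq[OF OX(1)] by (auto simp: gap_def e_Suc)
  then show ?thesis using OX tau_segment_XO[OF OX(1)] by simp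
qed

text \<open>Segments between vertices are fixed because the mirror swaps their ends. The radii have
  gap M + 1, so the exceptional clause is exactly what fixes them.\<close>

lemma tau_segment_negd_fixed:
  assumes "s \<in> negd \<alpha>" "\<alpha> \<in> D (opp \<epsilon>)"
  shows "tau_segment D \<epsilon> s = s"
  using assms(1) D_simples[OF assms(2)]
proof (cases rule: negd_cases)
  case (XX i)
  then have "e i = opp \<epsilon>" using D_disjoint assms by blast
  then have "swp \<epsilon> i = Suc i" "swp \<epsilon> (Suc i) = i" using XX by (auto simp: swp_def e_Suc)
  then show ?thesis unfolding XX(5) tau_segment_XX image_insert image_empty
    using XX by (simp add: tau_point_X insert_commute del: tau_point.simps)
next
  case (XO q)
  then have "e M = opp \<epsilon>" using D_disjoint assms by blast
  then have "gap \<epsilon> M = Suc M" "M \<le> Suc N" using N_eq[OF XO(1)] by (auto simp: gap_def)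
  then show ?thesis using XO tau_segment_XO[OF XO(1)] by simp
next
  case (OX q)
  then have "e M = opp \<epsilon>" using D_disjoint assms by blast
  then have "gap \<epsilon> (Suc M) = Suc M" "Suc M \<le> Suc N" using N_eq[OF OX(1)] by (auto simp: gap_def e_Suc)
  then show ?thesis using OX tau_segment_XO[OF OX(1)] by simp
qed

lemma refl_cox: "refl (cox D \<epsilon> \<beta>) (cox D \<epsilon> y) = cox D \<epsilon> (refl \<beta> y)"
  by (rule refl_conj[OF cox_linear cox_inner])

text \<open>Conjugation by \<open>cox D \<epsilon>\<close> carries the reflection in \<beta> to that
  in its image, so swapped pairs go to swapped pairs.\<close>

lemma tau_posd_subset:
  assumes "\<beta> \<in> Pos"
  shows "tau_segment D \<epsilon> ` posd \<beta> \<subseteq> posd (cox D \<epsilon> \<beta>)"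
proof
  fix t assume "t \<in> tau_segment D \<epsilon> ` posd \<beta>"
  then obtain s where s: "s \<in> posd \<beta>" "t = tau_segment D \<epsilon> s" by blast
  then obtain y where y: "s = {up y, down (refl \<beta> y)}" "y \<in> Orb" "0 < \<beta> \<bullet> y" by (auto simp: posd_def)
  have "(y \<in> Q \<or> (\<exists>i. 1 \<le> i \<and> i < N \<and> y = x i)) \<and> (refl \<beta> y \<in> Q \<or> (\<exists>i. 1 < i \<and> i \<le> N \<and> refl \<beta> y = x i))"
    using assms y(2,3)
  proof (cases rule: Pos_pair)
    case (xx i j)
    then show ?thesis using order.strict_trans1[of 1 i j] order.strict_trans2[of i j N] by blast
  next
    case (xQ i)
    then have "i < N" using N_eq[OF xQ(5)] by simp
    then show ?thesis using xQ by blast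
  next
    case (Qx j)
    then have "1 < j" using M_ge[OF Qx(4)] by simp
    then show ?thesis using Qx by blast
  qed
  then have "t = {up (cox D \<epsilon> y), down (refl (cox D \<epsilon> \<beta>) (cox D \<epsilon> y))}"
    using s(2) tau_segment_posd[OF s(1) assms] y(1) tau_point_up tau_point_down refl_cox by auto
  moreover have "0 < cox D \<epsilon> \<beta> \<bullet> cox D \<epsilon> y" using y by (simp add: cox_inner)
  ultimately show "t \<in> posd (cox D \<epsilon> \<beta>)" using cox_Orb[OF y(2)] unfolding posd_def by blast
qed

lemma tau_segment_tau_segment_posd:
  assumes "s \<in> posd \<beta>" "\<beta> \<in> Pos" "cox D \<epsilon> \<beta> \<in> Pos"
  shows "tau_segment D \<epsilon> (tau_segment D \<epsilon> s) = s"
proof -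
  have "tau_segment D \<epsilon> s \<in> posd (cox D \<epsilon> \<beta>)" using tau_posd_subset assms by blast
  then have "tau_segment D \<epsilon> (tau_segment D \<epsilon> s) = tau_point D \<epsilon> ` tau_point D \<epsilon> ` s"
    using tau_segment_posd assms by metis
  then show ?thesis by (simp add: image_comp tau_point_tau_point comp_def)
qed

lemma tau_posd:
  assumes "\<beta> \<in> Pos" "cox D \<epsilon> \<beta> \<in> Pos"
  shows "tau_segment D \<epsilon> ` posd \<beta> = posd (cox D \<epsilon> \<beta>)"
proof
  show "posd (cox D \<epsilon> \<beta>) \<subseteq> tau_segment D \<epsilon> ` posd \<beta>"
  proof
    fix s assume s: "s \<in> posd (cox D \<epsilon> \<beta>)"
    then have "tau_segment D \<epsilon> s \<in> posd \<beta>" using tau_posd_subset[OF assms(2), of \<epsilon>] by auto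
    moreover have "s = tau_segment D \<epsilon> (tau_segment D \<epsilon> s)"
      using tau_segment_tau_segment_posd[OF s assms(2), of \<epsilon>] assms by simp
    ultimately show "s \<in> tau_segment D \<epsilon> ` posd \<beta>" by blast
  qed
qed (rule tau_posd_subset[OF assms(1)])

text \<open>The mirror of the class of \<alpha> moves both ends of a segment outward by one index,
  and \<open>cox D \<epsilon>\<close> negates the labels.\<close>

lemma tau_point_mid:
  assumes "\<alpha> \<in> D \<epsilon>" "y \<in> Orb" "0 < \<alpha> \<bullet> y"
  shows "tau_point D \<epsilon> (mid y) = up y" "tau_point D \<epsilon> (mid (refl \<alpha> y)) = down (refl \<alpha> y)"
proof -
  have "tau_point D \<epsilon> (mid y) = up y \<and> tau_point D \<epsilon> (mid (refl \<alpha> y)) = down (refl \<alpha> y)"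
    using assms(2)
  proof (cases rule: Orb_cases)
    case (x i)
    note u = simple_up[of i \<alpha>, OF x(1,2) D_simples[OF assms(1)] assms(3)[unfolded x(3)]]
    have e: "e i = \<epsilon>" using u D_disjoint assms by blast
    have s: "swp \<epsilon> i = i - 1" "swp \<epsilon> (Suc i) = Suc (Suc i)"
      using e u by (auto simp: swp_def e_Suc)
    have 1: "tau_point D \<epsilon> (mid y) = up y"
      using x s by (simp add: mid_x up_x tau_point_X del: tau_point.simps)
    show ?thesis
    proof (cases "refl \<alpha> (x i) = x (Suc i)")
      case True
      then show ?thesis using 1 x s u
        by (simp add: mid_x down_x tau_point_X del: tau_point.simps)
    next
      case False
      then have "i = M" "refl \<alpha> y \<in> Q" using u x by auto
      then show ?thesis using 1 cox_Q e by (simp add: mid_Q down_Q)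
    qed
  next
    case q: Q
    have M: "1 \<le> M" "Suc M \<le> N" using N_eq[OF q] M_ge[OF q] by auto
    have r: "refl \<alpha> y = x (Suc M)"
      using only[OF D_simples[OF assms(1)] assms(2,3)] q x_notin_Q[of M] x_notin_Q M by auto
    then have "refl \<alpha> y \<noteq> y" using x_notin_Q[of "Suc M"] q M by auto
    then have e: "e M = \<epsilon>" using simple_move_Q[OF q D_simples[OF assms(1)]] D_disjoint assms(1) by blast
    then have "swp \<epsilon> (Suc M) = Suc (Suc M)" using M by (auto simp: swp_def e_Suc)
    then have "tau_point D \<epsilon> (mid (x (Suc M))) = down (x (Suc M))"
      using M by (simp add: mid_x down_x tau_point_X del: tau_point.simps)
    moreover have "tau_point D \<epsilon> (mid y) = up y" using q e cox_Q by (simp add: mid_Q up_Q)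
    ultimately show ?thesis using r by simp
  qed
  then show "tau_point D \<epsilon> (mid y) = up y" "tau_point D \<epsilon> (mid (refl \<alpha> y)) = down (refl \<alpha> y)" by auto
qed

lemma tau_negd:
  assumes "\<alpha> \<in> D \<epsilon>"
  shows "tau_segment D \<epsilon> ` negd \<alpha> = posd \<alpha>"
proof -
  have "tau_segment D \<epsilon> {mid y, mid (refl \<alpha> y)} = {up y, down (refl \<alpha> y)}" if "y \<in> Orb" "0 < \<alpha> \<bullet> y" for y
  proof -
    have "{mid y, mid (refl \<alpha> y)} \<in> negd \<alpha>" using that by (auto simp: negd_def)
    then show ?thesis using tau_segment_negd[OF _ assms] tau_point_mid[OF assms that] by simp
  qed
  then show ?thesis unfolding negd_def posd_def by (auto simp: image_iff)
qed

lemma tau_posd_simple: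
  assumes "\<alpha> \<in> D \<epsilon>"
  shows "tau_segment D \<epsilon> ` posd \<alpha> = negd \<alpha>"
proof -
  have "tau_segment D \<epsilon> (tau_segment D \<epsilon> s) = s" if s: "s \<in> negd \<alpha>" for s
  proof -
    have "tau_segment D \<epsilon> s \<in> posd \<alpha>" using tau_negd assms s by blast
    then show ?thesis using tau_segment_posd simple_Pos D_simples assms tau_segment_negd[OF s assms]
      by (simp add: image_comp tau_point_tau_point comp_def)
  qed
  then have "tau_segment D \<epsilon> ` tau_segment D \<epsilon> ` negd \<alpha> = negd \<alpha>" by (force simp: image_iff)
  then show ?thesis using tau_negd assms by simp
qed

lemma dg_tau:
  assumes "\<beta> \<in> AP"
  shows "tau_segment D \<epsilon> ` dg \<beta> = dg (tau D \<epsilon> \<beta>)"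
  using assms
proof (cases rule: tau_cases[of \<beta> \<epsilon>])
  case simple
  then show ?thesis using tau_posd_simple simple_Pos D_simples by (simp add: dg_Pos dg_neg)
next
  case pos
  then show ?thesis using tau_posd by (simp add: dg_Pos)
next
  case (neg \<alpha>)
  then show ?thesis using tau_negd simple_Pos D_simples by (simp add: dg_Pos dg_neg)
next
  case (fixed \<alpha>)
  then have "tau_segment D \<epsilon> ` negd \<alpha> = id ` negd \<alpha>"
    using tau_segment_negd_fixed by (intro image_cong) auto
  then show ?thesis using fixed D_simples by (simp add: dg_neg)
qed

text \<open>\<open>is_diagram\<close> may reach a root along different sequences of involutions; the
  explicit \<open>dg\<close> shows that all of them give the same collection.\<close>

lemma is_diagram_dg: "is_diagram D c \<omega> Orb \<beta> C \<Longrightarrow> \<beta> \<in> AP \<and> C = dg \<beta>"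
proof (induction rule: is_diagram.induct)
  case (neg_simple \<alpha>)
  then show ?case using neg_simple_diagram_eq dg_neg neg_simple_AP by simp
next
  case (tau \<beta> C \<epsilon>)
  then show ?case using dg_tau tau_AP by simp
qed

end

section \<open>Compatibility\<close>

context snake_plane
begin

lemma inj_line_refl: "inj (line_refl (dir \<epsilon>))"
  by (rule inj_on_inverseI[of _ "line_refl (dir \<epsilon>)"]) (simp add: line_refl_line_refl[OF norm_dir])

lemma unlabeled_tau_point: "unlabeled (tau_point D \<epsilon> ` s) = line_refl (dir \<epsilon>) ` unlabeled s"
proof -
  have "pos (tau_point D \<epsilon> A) = line_refl (dir \<epsilon>) (pos A)" for A
    by (cases A) (simp_all add: coxeter_number_eq line_refl_def)
  then have "pos ` tau_point D \<epsilon> ` s = line_refl (dir \<epsilon>) ` pos ` s" by (simp add: image_image)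
  then show ?thesis unfolding unlabeled_def by (simp add: convex_hull_linear_image linear_line_refl)
qed

lemma unlabeled_XO: "unlabeled {X a, Origin y} = unlabeled {X a, Origin z}"
  by (simp add: unlabeled_pair)

text \<open>\<open>tau_segment\<close> leaves a perpendicular radius in place. Its reflection is the
  opposite radius, whose drawing is in the same diagram under the negated label.\<close>

lemma unlabeled_negd_fixed:
  assumes "s \<in> negd \<alpha>" "\<alpha> \<in> D (opp \<epsilon>)"
  shows "\<exists>s'\<in>negd \<alpha>. unlabeled s' = line_refl (dir \<epsilon>) ` unlabeled s"
  using assms(1) D_simples[OF assms(2)]
proof (cases rule: negd_cases)
  case (XX i)
  then have "tau_point D \<epsilon> ` s = s" using tau_segment_negd_fixed[OF assms] tau_segment_XX by metis
  then show ?thesis using assms(1) unlabeled_tau_point by metis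
next
  case (XO q)
  then have "e M = opp \<epsilon>" using D_disjoint assms by blast
  moreover have "M < Suc N" using N_eq[OF XO(1), symmetric] by simp
  ultimately have "swp \<epsilon> M = Suc M" "M \<le> Suc N" by (auto simp: swp_def)
  then have "tau_point D \<epsilon> ` s = {X (Suc M), Origin (cox D \<epsilon> q)}"
    unfolding XO(3) image_insert image_empty by (simp only: tau_point_X) simp
  then have "line_refl (dir \<epsilon>) ` unlabeled s = unlabeled {X (Suc M), Origin (- q)}"
    using unlabeled_tau_point[of \<epsilon> s] unlabeled_XO by metis
  then show ?thesis using XO(5) by metis
next
  case (OX q)
  then have "e M = opp \<epsilon>" using D_disjoint assms by blast
  moreover have "Suc M < Suc N" using N_eq[OF OX(1), symmetric] M_ge[OF OX(1)] by simp
  ultimately have "swp \<epsilon> (Suc M) = M" "Suc M \<le> Suc N" by (auto simp: swp_def e_Suc)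
  then have "tau_point D \<epsilon> ` s = {X M, Origin (cox D \<epsilon> q)}"
    unfolding OX(3) image_insert image_empty by (simp only: tau_point_X) simp
  then have "line_refl (dir \<epsilon>) ` unlabeled s = unlabeled {X M, Origin (- q)}"
    using unlabeled_tau_point[of \<epsilon> s] unlabeled_XO by metis
  then show ?thesis using OX(5) by metis
qed

lemma unlabeled_dg_tau:
  assumes "\<beta> \<in> AP"
  shows "unlabeled ` dg (tau D \<epsilon> \<beta>) = (`) (line_refl (dir \<epsilon>)) ` unlabeled ` dg \<beta>"
proof -
  have eq: "unlabeled ` dg (tau D \<epsilon> \<beta>) = (`) (line_refl (dir \<epsilon>)) ` unlabeled ` dg \<beta>"
    if "\<And>s. s \<in> dg \<beta> \<Longrightarrow> tau_segment D \<epsilon> s = tau_point D \<epsilon> ` s"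
    unfolding dg_tau[OF assms, symmetric] image_image using that unlabeled_tau_point by (intro image_cong) auto
  show ?thesis
    using assms
  proof (cases rule: tau_cases[of \<beta> \<epsilon>])
    case simple
    then show ?thesis using eq tau_segment_posd simple_Pos D_simples dg_Pos by metis
  next
    case pos
    then show ?thesis using eq tau_segment_posd dg_Pos by metis
  next
    case (neg \<alpha>)
    then show ?thesis using eq tau_segment_negd D_simples dg_neg by metis
  next
    case (fixed \<alpha>)
    let ?r = "line_refl (dir \<epsilon>)"
    have n: "dg \<beta> = negd \<alpha>" "dg (tau D \<epsilon> \<beta>) = negd \<alpha>" using fixed D_simples dg_neg by auto
    have sub: "(`) ?r ` unlabeled ` negd \<alpha> \<subseteq> unlabeled ` negd \<alpha>"
      using unlabeled_negd_fixed[OF _ fixed(1)] by (auto simp: image_iff) metis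
    have "?r ` ?r ` A = A" for A by (simp add: image_image line_refl_line_refl[OF norm_dir])
    then have "unlabeled ` negd \<alpha> = (`) ?r ` (`) ?r ` unlabeled ` negd \<alpha>"
      by (simp add: image_image)
    also have "\<dots> \<subseteq> (`) ?r ` unlabeled ` negd \<alpha>" using sub by (rule image_mono)
    finally show ?thesis using n sub by auto
  qed
qed

lemma crossings_iff:
  "(\<forall>s\<in>C1. \<forall>t\<in>C2. segments_cross s t \<longrightarrow> unlabeled s = unlabeled t) \<longleftrightarrow>
   (\<forall>A\<in>unlabeled ` C1. \<forall>B\<in>unlabeled ` C2. rel_interior A \<inter> rel_interior B \<noteq> {} \<longrightarrow> A = B)"
  by (simp add: segments_cross_def)

text \<open>The condition depends only on the drawings, which by \<open>unlabeled_dg_tau\<close> are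
  reflected even in the exceptional case. An injective linear map commutes with relative interiors
  and intersections.\<close>

lemma crossings_tau:
  assumes "\<beta> \<in> AP" "\<gamma> \<in> AP"
  shows "(\<forall>s\<in>dg (tau D \<epsilon> \<beta>). \<forall>t\<in>dg (tau D \<epsilon> \<gamma>). segments_cross s t \<longrightarrow> unlabeled s = unlabeled t) \<longleftrightarrow>
    (\<forall>s\<in>dg \<beta>. \<forall>t\<in>dg \<gamma>. segments_cross s t \<longrightarrow> unlabeled s = unlabeled t)"
proof -
  let ?r = "line_refl (dir \<epsilon>)"
  have ri: "rel_interior (?r ` A) = ?r ` rel_interior A" for A
    using rel_interior_injective_linear_image[of ?r A] inj_line_refl linear_line_refl by (simp add: linear_linear)
  have "rel_interior (?r ` A) \<inter> rel_interior (?r ` B) \<noteq> {} \<longleftrightarrow> rel_interior A \<inter> rel_interior B \<noteq> {}" for A B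
    unfolding ri image_Int[OF inj_line_refl, symmetric] by simp
  moreover have "?r ` A = ?r ` B \<longleftrightarrow> A = B" for A B by (rule inj_image_eq_iff[OF inj_line_refl])
  ultimately show ?thesis unfolding crossings_iff unlabeled_dg_tau[OF assms(1)] unlabeled_dg_tau[OF assms(2)] by simp
qed

text \<open>The label condition in terms of the outer indices of two radii: a common line, or the
  same side of the gray zone.\<close>

definition near :: "nat \<Rightarrow> nat \<Rightarrow> bool" where
  "near a b \<longleftrightarrow> a = b \<or> a + b = Suc N \<or> (a \<le> M \<longleftrightarrow> b \<le> M)"

definition lab :: "'a lpoint set set \<Rightarrow> 'a \<Rightarrow> nat \<Rightarrow> bool" where
  "lab C q a \<longleftrightarrow> q \<in> Q \<and> a \<le> Suc N \<and> {X a, Origin q} \<in> C"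

lemma dg_Origin:
  assumes "\<beta> \<in> AP" "s \<in> dg \<beta>" "Origin q \<in> s"
  obtains a where "lab (dg \<beta>) q a" "s = {X a, Origin q}"
  using assms(1)
proof (cases rule: AP_cases)
  case pos
  then have "s \<in> posd \<beta>" using assms dg_Pos by auto
  then show ?thesis using pos
  proof (cases rule: posd_cases)
    case (XO i q')
    then have "q = - q'" "i - 1 \<le> Suc N" using assms N_eq[OF XO(3), symmetric] by auto
    then show ?thesis using that[of "i - 1"] XO Q_uminus assms by (auto simp: lab_def)
  next
    case (OX j q')
    then have "q = - q'" using assms by auto
    then show ?thesis using that[of "Suc j"] OX Q_uminus assms by (auto simp: lab_def)
  qed (use assms in auto)
next
  case (neg \<alpha>)
  then have "s \<in> negd \<alpha>" using assms dg_neg by auto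
  then show ?thesis using neg(1)
  proof (cases rule: negd_cases)
    case (XO q')
    have "q = q'" using assms(3) unfolding XO(3) by simp
    then have sq: "s = {X M, Origin q}" using XO(3) by simp
    then have "lab (dg \<beta>) q M" using XO(1) assms(2) \<open>q = q'\<close> N_eq[OF XO(1)] unfolding lab_def by simp
    then show ?thesis using that sq by blast
  next
    case (OX q')
    have "q = q'" using assms(3) unfolding OX(3) by simp
    then have sq: "s = {X (Suc M), Origin q}" using OX(3) by simp
    then have "lab (dg \<beta>) q (Suc M)" using OX(1) assms(2) \<open>q = q'\<close> N_eq[OF OX(1)] unfolding lab_def by simp
    then show ?thesis using that sq by blast
  qed (use assms in auto)
qed

lemma near_iff:
  assumes "q \<in> Q" "a \<le> Suc N" "b \<le> Suc N"
  shows "collinear (unlabeled {X a, Origin y} \<union> unlabeled {X b, Origin z}) \<or>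
    \<not> union_crosses_gray_zone N {X a, Origin y} {X b, Origin z} \<longleftrightarrow> near a b"
  unfolding near_def collinear_OO_iff[OF assms] gray_iff[OF assms] by auto

lemma labels_iff:
  assumes "\<beta> \<in> AP" "\<gamma> \<in> AP"
  shows "(\<forall>s\<in>dg \<beta>. \<forall>t\<in>dg \<gamma>. same_origin_point s t \<longrightarrow>
      collinear (unlabeled s \<union> unlabeled t) \<or> \<not> union_crosses_gray_zone N s t) \<longleftrightarrow>
    (\<forall>q a b. lab (dg \<beta>) q a \<longrightarrow> lab (dg \<gamma>) q b \<longrightarrow> near a b)"
proof (intro iffI ballI allI impI)
  fix q a b
  assume "\<forall>s\<in>dg \<beta>. \<forall>t\<in>dg \<gamma>. same_origin_point s t \<longrightarrow>
      collinear (unlabeled s \<union> unlabeled t) \<or> \<not> union_crosses_gray_zone N s t"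
    and l: "lab (dg \<beta>) q a" "lab (dg \<gamma>) q b"
  moreover have "same_origin_point {X a, Origin q} {X b, Origin q}" by (auto simp: same_origin_point_def)
  ultimately show "near a b" using near_iff[of q a b q q] unfolding lab_def by blast
next
  fix s t
  assume n: "\<forall>q a b. lab (dg \<beta>) q a \<longrightarrow> lab (dg \<gamma>) q b \<longrightarrow> near a b"
    and st: "s \<in> dg \<beta>" "t \<in> dg \<gamma>" "same_origin_point s t"
  then obtain q where q: "Origin q \<in> s" "Origin q \<in> t" by (auto simp: same_origin_point_def)
  obtain a where a: "lab (dg \<beta>) q a" "s = {X a, Origin q}" using dg_Origin assms(1) st(1) q(1) by blast
  obtain b where b: "lab (dg \<gamma>) q b" "t = {X b, Origin q}" using dg_Origin assms(2) st(2) q(2) by blast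
  have "near a b" using n a b by blast
  then show "collinear (unlabeled s \<union> unlabeled t) \<or> \<not> union_crosses_gray_zone N s t"
    using near_iff[of q a b q q] a b unfolding lab_def by blast
qed

text \<open>The effect of \<open>tau_segment\<close> on the outer index of a radius, exceptional
  clause included.\<close>

definition shift where "shift \<epsilon> a = (if gap \<epsilon> a = Suc M then a else swp \<epsilon> a)"

lemma lab_tau:
  assumes "\<beta> \<in> AP" "lab (dg \<beta>) q a"
  shows "lab (dg (tau D \<epsilon> \<beta>)) (cox D \<epsilon> q) (shift \<epsilon> a)"
proof -
  have q: "q \<in> Q" "a \<le> Suc N" "{X a, Origin q} \<in> dg \<beta>" using assms by (auto simp: lab_def)
  have in_tau: "tau_segment D \<epsilon> {X a, Origin q} \<in> dg (tau D \<epsilon> \<beta>)" using dg_tau[OF assms(1)] q by blast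
  show ?thesis
  proof (cases "gap \<epsilon> a = Suc M")
    case True
    then have "a = M \<and> e M \<noteq> \<epsilon> \<or> a = Suc M \<and> e (Suc M) = \<epsilon>" by (auto simp: gap_def split: if_splits)
    then have "\<epsilon> = opp (e M)" using e_Suc[of M] by (cases \<epsilon>; cases "e M") auto
    then have "cox D \<epsilon> q = q" using cox_Q_opp q by simp
    then show ?thesis using True in_tau q tau_segment_XO[OF q(1,2)] by (simp add: lab_def shift_def)
  next
    case False
    then have "tau_segment D \<epsilon> {X a, Origin q} = {X (swp \<epsilon> a), Origin (cox D \<epsilon> q)}"
      unfolding tau_segment_XO[OF q(1,2)] using tau_point_X[OF q(2)] by simp
    then show ?thesis using False in_tau q swp_le cox_Q_in by (simp add: lab_def shift_def)
  qed
qed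

lemma swp_swp: "a \<le> Suc N \<Longrightarrow> swp \<epsilon> (swp \<epsilon> a) = a"
  using e_Suc[of a] e_Suc[of "a - 1"] by (cases \<epsilon>; cases "e a"; cases a) (auto simp: swp_def)

lemma gap_swp: "a \<le> Suc N \<Longrightarrow> gap \<epsilon> (swp \<epsilon> a) = gap \<epsilon> a \<or> a = Suc N"
  using e_Suc[of a] e_Suc[of "a - 1"] by (cases \<epsilon>; cases "e a"; cases a) (auto simp: swp_def gap_def)

text \<open>Only a swap of M and M + 1 could carry an index into the other half, and there the gap
  is M + 1, so the exceptional clause intervenes. These three properties preserve the three
  alternatives of \<open>near\<close>.\<close>

lemma shift_props:
  assumes q: "q \<in> Q" and a: "a \<le> Suc N"
  shows "shift \<epsilon> (shift \<epsilon> a) = a" "shift \<epsilon> a \<le> M \<longleftrightarrow> a \<le> M" "shift \<epsilon> (Suc N - a) = Suc N - shift \<epsilon> a"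
proof -
  have M: "2 * M = N" "2 \<le> M" using N_eq[OF q, symmetric] M_ge[OF q] by auto
  have last: "gap \<epsilon> (Suc N) \<noteq> Suc M" "gap \<epsilon> N \<noteq> Suc M" using M by (auto simp: gap_def)
  have "gap \<epsilon> (swp \<epsilon> a) = Suc M \<longleftrightarrow> gap \<epsilon> a = Suc M"
    using gap_swp[OF a, of \<epsilon>] last by (auto simp: swp_def)
  then show "shift \<epsilon> (shift \<epsilon> a) = a" using swp_swp[OF a] by (auto simp: shift_def)
  show "shift \<epsilon> a \<le> M \<longleftrightarrow> a \<le> M"
    using M by (auto simp: shift_def swp_def gap_def split: if_splits)
  have e: "e (Suc N - a) = opp (e a)" using e_antipode q a by blast
  have opp_eq: "opp (e a) = \<epsilon> \<longleftrightarrow> e a \<noteq> \<epsilon>" by (cases \<epsilon>; cases "e a") auto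
  have "gap \<epsilon> (Suc N - a) = Suc M \<longleftrightarrow> gap \<epsilon> a = Suc M"
    unfolding gap_def e opp_eq using M a by auto
  moreover have "swp \<epsilon> (Suc N - a) = Suc N - swp \<epsilon> a"
    unfolding swp_def e opp_eq using M a by auto
  ultimately show "shift \<epsilon> (Suc N - a) = Suc N - shift \<epsilon> a" by (simp add: shift_def)
qed

lemma near_shift:
  assumes "q \<in> Q" "a \<le> Suc N" "b \<le> Suc N" "near (shift \<epsilon> a) (shift \<epsilon> b)"
  shows "near a b"
proof -
  note pa = shift_props[OF assms(1,2), of \<epsilon>] and pb = shift_props[OF assms(1,3), of \<epsilon>]
  consider "shift \<epsilon> a = shift \<epsilon> b" | "shift \<epsilon> a + shift \<epsilon> b = Suc N" | "shift \<epsilon> a \<le> M \<longleftrightarrow> shift \<epsilon> b \<le> M"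
    using assms(4) by (auto simp: near_def)
  then show ?thesis
  proof cases
    case 1
    then have "a = b" using pa(1) pb(1) by metis
    then show ?thesis by (simp add: near_def)
  next
    case 2
    then have "shift \<epsilon> b = shift \<epsilon> (Suc N - a)" unfolding pa(3) by simp
    then have "shift \<epsilon> (shift \<epsilon> b) = shift \<epsilon> (shift \<epsilon> (Suc N - a))" by (rule arg_cong)
    then have "b = Suc N - a" unfolding pb(1) shift_props(1)[OF assms(1) diff_le_self] .
    then show ?thesis using assms(2) by (simp add: near_def)
  next
    case 3
    then show ?thesis unfolding pa(2) pb(2) by (simp add: near_def)
  qed
qed

lemma labels_tau:
  assumes "\<beta> \<in> AP" "\<gamma> \<in> AP"
    and "\<forall>q a b. lab (dg (tau D \<epsilon> \<beta>)) q a \<longrightarrow> lab (dg (tau D \<epsilon> \<gamma>)) q b \<longrightarrow> near a b"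
  shows "\<forall>q a b. lab (dg \<beta>) q a \<longrightarrow> lab (dg \<gamma>) q b \<longrightarrow> near a b"
proof (intro allI impI)
  fix q a b assume l: "lab (dg \<beta>) q a" "lab (dg \<gamma>) q b"
  then have "near (shift \<epsilon> a) (shift \<epsilon> b)" using lab_tau assms by blast
  then show "near a b" using near_shift l by (auto simp: lab_def)
qed

lemma good_tau:
  assumes "\<beta> \<in> AP" "\<gamma> \<in> AP"
  shows "good N (dg (tau D \<epsilon> \<beta>)) (dg (tau D \<epsilon> \<gamma>)) \<longleftrightarrow> good N (dg \<beta>) (dg \<gamma>)"
proof -
  note T = tau_AP[OF assms(1), of \<epsilon>] tau_AP[OF assms(2), of \<epsilon>]
  have "(\<forall>q a b. lab (dg (tau D \<epsilon> \<beta>)) q a \<longrightarrow> lab (dg (tau D \<epsilon> \<gamma>)) q b \<longrightarrow> near a b) \<longleftrightarrow>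
    (\<forall>q a b. lab (dg \<beta>) q a \<longrightarrow> lab (dg \<gamma>) q b \<longrightarrow> near a b)"
    using labels_tau[OF assms, of \<epsilon>] labels_tau[OF T, of \<epsilon>]
    unfolding tau_tau[OF assms(1)] tau_tau[OF assms(2)] by blast
  then show ?thesis
    unfolding good_def labels_iff[OF assms] labels_iff[OF T] crossings_tau[OF assms] by blast
qed

section \<open>The criterion against negative simple roots\<close>

lemma negd_XX: "1 \<le> l \<Longrightarrow> l < N \<Longrightarrow> Q = {} \<or> l \<noteq> M \<Longrightarrow> \<alpha> \<in> \<Delta> \<Longrightarrow> cf \<alpha> (x (Suc l)) < cf \<alpha> (x l) \<Longrightarrow>
  {X l, X (Suc l)} \<in> negd \<alpha>"
  using cf_step[of l \<alpha>] x_in[of l] mid_x[of l] mid_x[of "Suc l"] unfolding negd_def by force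

lemma negd_XO:
  assumes "q \<in> Q" "\<alpha> \<in> \<Delta>" "cf \<alpha> q < cf \<alpha> (x M)"
  shows "{X M, Origin q} \<in> negd \<alpha>" "{X (Suc M), Origin (- q)} \<in> negd \<alpha>"
proof -
  have M: "1 \<le> M" "M \<le> N" using N_eq[OF assms(1), symmetric] M_ge[OF assms(1)] by auto
  have r: "refl \<alpha> (x M) = q" "0 < \<alpha> \<bullet> x M" using cf_Q_step assms by auto
  have "{mid (x M), mid (refl \<alpha> (x M))} \<in> negd \<alpha>" using r x_in[OF M] unfolding negd_def by blast
  then show *: "{X M, Origin q} \<in> negd \<alpha>" using r mid_x[OF M] mid_Q[OF assms(1)] by simp
  show "{X (Suc M), Origin (- q)} \<in> negd \<alpha>"
    using * assms(2)
  proof (cases rule: negd_cases)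
    case (XX i)
    have "Origin q \<in> {X i, X (Suc i)}" using XX(5) by blast
    then show ?thesis by simp
  next
    case (XO q')
    have "Origin q \<in> {X M, Origin q'}" using XO(3) by blast
    then show ?thesis using XO(5) by simp
  next
    case (OX q')
    have "X M \<in> {X (Suc M), Origin q'}" using OX(3) by blast
    then show ?thesis using pt_neq[of M "Suc M"] M by simp
  qed
qed

lemma cf_Q_minus:
  assumes "q \<in> Q"
  shows "cf \<alpha> (x (Suc M)) < cf \<alpha> q \<longleftrightarrow> cf \<alpha> (- q) < cf \<alpha> (x M)"
  unfolding x_Suc_M[OF assms] cf_minus by linarith

lemma cf_Q_bounds:
  assumes "q \<in> Q" "\<alpha> \<in> \<Delta>"
  shows "cf \<alpha> q \<le> cf \<alpha> (x M)" "cf \<alpha> (x (Suc M)) \<le> cf \<alpha> q"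
  using M_above_Q[OF assms(1)] Q_above_M[OF assms(1)] assms(2) by (auto simp: above_def)

lemma not_goodI1: "s \<in> C1 \<Longrightarrow> t \<in> C2 \<Longrightarrow> segments_cross s t \<Longrightarrow> unlabeled s \<noteq> unlabeled t \<Longrightarrow> \<not> good h C1 C2"
  by (auto simp: good_def)

text \<open>The coefficient of \<alpha> drops somewhere between \<open>x i\<close> and its image in
  \<open>Q\<close>. A drop before \<open>x M\<close> produces a crossing, a drop in the last step a
  conflict of labels.\<close>

lemma bad_XQ:
  assumes \<beta>: "\<beta> \<in> Pos" and \<alpha>: "\<alpha> \<in> \<Delta>"
    and i: "1 \<le> i" "i \<le> M" "0 < \<beta> \<bullet> x i" "refl \<beta> (x i) \<in> Q" and less: "cf \<alpha> (refl \<beta> (x i)) < cf \<alpha> (x i)"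
  shows "\<not> good N (posd \<beta>) (negd \<alpha>)"
proof -
  let ?q = "refl \<beta> (x i)"
  have M: "2 * M = N" "2 \<le> M" using N_eq[OF i(4), symmetric] M_ge[OF i(4)] by auto
  have iN: "i \<le> N" using i M by simp
  have Qne: "Q \<noteq> {}" using i(4) by blast
  show ?thesis
  proof (cases "cf \<alpha> ?q < cf \<alpha> (x M)")
    case True
    have t: "{X M, Origin ?q} \<in> negd \<alpha>" using negd_XO(1) i(4) \<alpha> True by blast
    \<comment> \<open>\<beta> also swaps the negated pair, which gives a radius labeled
      \<open>?q\<close> that ends at N + 2 - i. This lies beyond the gray zone from M, where the
      radius of \<alpha> with that label ends, and is not its antipode.\<close>
    have "0 < \<beta> \<bullet> (- ?q)" using i(3) by (simp add: inner_refl_self)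
    then have "{up (- ?q), down (refl \<beta> (- ?q))} \<in> posd \<beta>"
      using Q_in[OF Q_uminus[OF i(4)]] unfolding posd_def by blast
    moreover have "refl \<beta> (- ?q) = x (Suc N - i)" using Q_minus[OF Qne i(1) iN] by (simp add: refl_minus)
    moreover have "1 \<le> Suc N - i" "Suc N - i \<le> N" using i iN by auto
    ultimately have s: "{X (Suc (Suc N - i)), Origin ?q} \<in> posd \<beta>"
      using up_Q[OF Q_uminus[OF i(4)]] down_x[of "Suc N - i"] by (simp add: insert_commute)
    have "same_origin_point {X (Suc (Suc N - i)), Origin ?q} {X M, Origin ?q}"
      by (auto simp: same_origin_point_def)
    moreover have "\<not> near (Suc (Suc N - i)) M" using M i by (auto simp: near_def)
    moreover have "Suc (Suc N - i) \<le> Suc N" "M \<le> Suc N" using i iN M by auto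
    ultimately show ?thesis
      using s t near_iff[OF i(4), of "Suc (Suc N - i)" M ?q ?q] unfolding good_def by blast
  next
    case False
    then have less: "cf \<alpha> (x M) < cf \<alpha> (x i)" using less by simp
    then have "i \<noteq> M" by auto
    then have "i < M" using i(2) by simp
    then obtain l where l: "i \<le> l" "l < M" "cf \<alpha> (x (Suc l)) < cf \<alpha> (x l)"
      using cf_drop[of i M \<alpha>] i M \<alpha> less by auto
    have t: "{X l, X (Suc l)} \<in> negd \<alpha>" using negd_XX[of l \<alpha>] l i M \<alpha> by auto
    have "{up (x i), down ?q} \<in> posd \<beta>" using x_in[OF i(1) iN] i(3) unfolding posd_def by blast
    then have s: "{X (i - 1), Origin (- ?q)} \<in> posd \<beta>" using up_x[OF i(1) iN] down_Q[OF i(4)] by simp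
    have "i - 1 < l" using i l by simp
    then show ?thesis using not_goodI1[OF s t] cross_XO[OF i(4) _ l(2)] by blast
  qed
qed

lemma bad_pos:
  assumes \<beta>: "\<beta> \<in> Pos" and \<alpha>: "\<alpha> \<in> \<Delta>" and pos: "0 < cf \<alpha> \<beta>"
  shows "\<not> good N (posd \<beta>) (negd \<alpha>)"
proof -
  obtain y where y: "y \<in> Orb" "0 < \<beta> \<bullet> y" using ex_Pos_pair \<beta> by blast
  have cf: "cf \<alpha> (refl \<beta> z) < cf \<alpha> z" if "0 < \<beta> \<bullet> z" for z
  proof -
    have "cf \<alpha> z - cf \<alpha> (refl \<beta> z) = (2 * (\<beta> \<bullet> z) / (\<beta> \<bullet> \<beta>)) * cf \<alpha> \<beta>"
      using refl_eq_scale[of z \<beta>] by (metis cf_diff cf_scale)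
    also have "\<dots> > 0" using refl_coeff_pos[OF root_nonzero[OF PosD(1)[OF \<beta>]] that] pos by (rule mult_pos_pos)
    finally show ?thesis by simp
  qed
  from \<beta> y show ?thesis
  proof (cases rule: Pos_pair)
    case (xx i j)
    have "{up y, down (refl \<beta> y)} \<in> posd \<beta>" using y unfolding posd_def by blast
    moreover have "up y = X (i - 1)" "down (refl \<beta> y) = X (Suc j)"
      using up_x[of i] down_x[of j] xx(1-5) by auto
    ultimately have s: "{X (i - 1), X (Suc j)} \<in> posd \<beta>" by simp
    have "cf \<alpha> (x j) < cf \<alpha> (x i)" using cf[OF y(2)] xx(4,5) by simp
    then obtain l where l: "i \<le> l" "l < j" "cf \<alpha> (x (Suc l)) < cf \<alpha> (x l)"
      using cf_drop[of i j \<alpha>] xx(1-3) \<alpha> by auto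
    show ?thesis
    proof (cases "Q = {} \<or> l \<noteq> M")
      case True
      then have "{X l, X (Suc l)} \<in> negd \<alpha>" using negd_XX[of l \<alpha>] l xx(1-3) \<alpha> by auto
      then show ?thesis using not_goodI1[OF s] cross_XX[of "i - 1" l "Suc j"] l xx(1-3) by auto
    next
      case False
      then obtain q where q: "q \<in> Q" and lM: "l = M" by auto
      \<comment> \<open>A drop from \<open>x M\<close> to \<open>x (Suc M)\<close> occurs on one
        side of q, and passing to -q exchanges the sides. So it can be placed between
        \<open>x M\<close> and some \<open>q0\<close>, and then both radii of the middle diameter
        belong to \<alpha>.\<close>
      have "cf \<alpha> q < cf \<alpha> (x M) \<or> cf \<alpha> (x (Suc M)) < cf \<alpha> q" using l(3) unfolding lM by linarith
      then have "\<exists>q\<in>Q. cf \<alpha> q < cf \<alpha> (x M)" using q Q_uminus cf_Q_minus by blast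
      then obtain q0 where q0: "q0 \<in> Q" "cf \<alpha> q0 < cf \<alpha> (x M)" by blast
      note t = negd_XO[OF q0(1) \<alpha> q0(2)]
      have ij: "i - 1 < M" "Suc M < Suc j" "Suc j \<le> Suc N" "i - 1 + Suc j \<noteq> Suc N"
        using l lM xx(1-3,6) False by auto
      obtain m where "m \<in> {M, Suc M}"
        "segments_cross {X (i - 1), X (Suc j)} {X m, Origin (if m = M then q0 else - q0)}"
        "unlabeled {X (i - 1), X (Suc j)} \<noteq> unlabeled {X m, Origin (if m = M then q0 else - q0)}"
        using cross_XM[OF q ij, of "\<lambda>m. if m = M then q0 else - q0"] by blast
      moreover have "{X m, Origin (if m = M then q0 else - q0)} \<in> negd \<alpha>" if "m \<in> {M, Suc M}"
        using t that by auto
      ultimately show ?thesis using not_goodI1[OF s] by blast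
    qed
  next
    case (xQ i)
    then show ?thesis using bad_XQ[OF \<beta> \<alpha>, of i] cf y by simp
  next
    case (Qx j)
    have N: "2 * M = N" using N_eq[OF Qx(4), symmetric] .
    \<comment> \<open>The negated pair starts at index N + 1 - j and ends in \<open>Q\<close>, which
      reduces this case to \<open>bad_XQ\<close>.\<close>
    have xj: "x (Suc N - j) = - refl \<beta> y" using Q_minus[of j] Qx by auto
    have "0 < \<beta> \<bullet> x (Suc N - j)" "refl \<beta> (x (Suc N - j)) \<in> Q"
      unfolding xj using y Q_uminus[OF Qx(4)] by (simp_all add: refl_minus inner_refl_self)
    then show ?thesis using bad_XQ[OF \<beta> \<alpha>, of "Suc N - j"] cf Qx(1,3) N by simp
  qed
qed

lemma cf_between:
  assumes "1 \<le> i" "i \<le> j" "j \<le> N" "\<alpha> \<in> \<Delta>" "cf \<alpha> (x j) = cf \<alpha> (x i)" "i \<le> l" "l < j"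
  shows "\<not> cf \<alpha> (x (Suc l)) < cf \<alpha> (x l)"
  using cf_mono[of i l \<alpha>] cf_mono[of "Suc l" j \<alpha>] assms by auto

text \<open>With coefficient 0, swapped elements agree in the coefficient of \<alpha>, which by
  monotonicity is constant between them. The segments of -\<alpha> sit at drops, hence outside this
  range.\<close>

lemma good_pos:
  assumes \<beta>: "\<beta> \<in> Pos" and \<alpha>: "\<alpha> \<in> \<Delta>" and zero: "cf \<alpha> \<beta> = 0"
  shows "good N (posd \<beta>) (negd \<alpha>)"
proof -
  have cf: "cf \<alpha> (refl \<beta> z) = cf \<alpha> z" for z
    using refl_eq_scale[of z \<beta>] zero by (metis cf_diff cf_scale mult_zero_right right_minus_eq)
  have nM: "cf \<alpha> (x (Suc M)) < cf \<alpha> (x M)" if "q \<in> Q" "cf \<alpha> q < cf \<alpha> (x M) \<or> cf \<alpha> (x (Suc M)) < cf \<alpha> q" for q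
    using cf_Q_bounds[OF that(1) \<alpha>] that(2) by linarith
  have "\<not> segments_cross s t \<and> (same_origin_point s t \<longrightarrow> collinear (unlabeled s \<union> unlabeled t) \<or> \<not> union_crosses_gray_zone N s t)"
    if s: "s \<in> posd \<beta>" and t: "t \<in> negd \<alpha>" for s t
    using s \<beta>
  proof (cases rule: posd_cases)
    case (XX i j)
    have no: "\<not> same_origin_point s t" unfolding XX(6) by (auto simp: same_origin_point_def)
    have eq: "cf \<alpha> (x j) = cf \<alpha> (x i)" using cf XX(5) by metis
    have drop: "l < i \<or> j \<le> l" if "cf \<alpha> (x (Suc l)) < cf \<alpha> (x l)" for l
      using cf_between[OF XX(1) less_imp_le[OF XX(2)] XX(3) \<alpha> eq, of l] that not_less by blast
    have M: "\<not> segments_cross s {X m, Origin z}"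
      if "m = M \<or> m = Suc M" "q \<in> Q" "cf \<alpha> q < cf \<alpha> (x M) \<or> cf \<alpha> (x (Suc M)) < cf \<alpha> q" for m q z
      unfolding XX(6) using drop[OF nM[OF that(2,3)]] XX(1-3) that(1)
      by (intro nocross_XM[OF that(2)]) auto
    from t \<alpha> show ?thesis
    proof (cases rule: negd_cases)
      case l: (XX l)
      have "\<not> segments_cross s t" unfolding XX(6) l(5) using drop[OF l(6)] XX(1-3) l(1,2)
        by (intro nocross_XX) auto
      then show ?thesis using no by blast
    next
      case (XO q)
      then show ?thesis using M[of M q q] no by simp
    next
      case (OX q)
      then show ?thesis using M[of "Suc M" q q] no by simp
    qed
  next
    case (XO i q')
    have N: "2 * M = N" "i \<le> N" using N_eq[OF XO(3), symmetric] XO(2) by auto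
    have eq: "cf \<alpha> q' = cf \<alpha> (x i)" using cf XO(4) by metis
    have "cf \<alpha> (x M) \<le> cf \<alpha> (x i)" using cf_mono[of i M \<alpha>] XO N \<alpha> by simp
    then have eqM: "cf \<alpha> (x M) = cf \<alpha> (x i)" "cf \<alpha> q' = cf \<alpha> (x M)" using cf_Q_bounds(1)[OF XO(3) \<alpha>] eq by auto
    from t \<alpha> show ?thesis
    proof (cases rule: negd_cases)
      case l: (XX l)
      have "\<not> (i \<le> l \<and> l < M)"
        using cf_between[OF XO(1,2) _ \<alpha> eqM(1), of l] l(6) N by auto
      then have "\<not> segments_cross s t" unfolding XO(5) l(5) using XO(1-3) l(1,2,3) N
        by (intro nocross_XO[OF XO(3)]) auto
      moreover have "\<not> same_origin_point s t" unfolding l(5) by (auto simp: same_origin_point_def)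
      ultimately show ?thesis by blast
    next
      case m: (XO q)
      have "\<not> segments_cross s t" unfolding XO(5) m(3) using XO(1-3) N by (intro nocross_OO) auto
      moreover have "near (i - 1) M" using XO(2) by (auto simp: near_def)
      then have "collinear (unlabeled s \<union> unlabeled t) \<or> \<not> union_crosses_gray_zone N s t"
        unfolding XO(5) m(3) using XO(2) N by (subst near_iff[OF XO(3)]) auto
      ultimately show ?thesis by blast
    next
      case m: (OX q)
      have "\<not> segments_cross s t" unfolding XO(5) m(3) using XO(1-3) N by (intro nocross_OO) auto
      \<comment> \<open>A radius of \<alpha> at M + 1 labeled -q' would mean, after negation, a drop
        from \<open>x M\<close> to q', where the coefficient is constant.\<close>
      moreover have "q \<noteq> - q'" using m(4) eqM(2) unfolding cf_Q_minus[OF m(1)] by auto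
      then have "\<not> same_origin_point s t" unfolding XO(5) m(3) by (auto simp: same_origin_point_def)
      ultimately show ?thesis by blast
    qed
  next
    case (OX j q')
    have N: "2 * M = N" "1 \<le> M" using N_eq[OF OX(3), symmetric] M_ge[OF OX(3)] by auto
    have eq: "cf \<alpha> q' = cf \<alpha> (x j)" using cf OX(4) by metis
    have "cf \<alpha> (x j) \<le> cf \<alpha> (x (Suc M))" using cf_mono[of "Suc M" j \<alpha>] OX N \<alpha> by simp
    then have eqM: "cf \<alpha> (x j) = cf \<alpha> (x (Suc M))" "cf \<alpha> q' = cf \<alpha> (x (Suc M))"
      using cf_Q_bounds(2)[OF OX(3) \<alpha>] eq by auto
    from t \<alpha> show ?thesis
    proof (cases rule: negd_cases)
      case l: (XX l)
      have "\<not> (Suc M \<le> l \<and> l < j)"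
        using cf_between[of "Suc M" j \<alpha> l] \<alpha> eqM(1) OX(1,2) l(6) by auto
      then have "\<not> segments_cross s t" unfolding OX(5) l(5) using OX(1-3) l(1,2,3) N
        by (intro nocross_XO[OF OX(3)]) auto
      moreover have "\<not> same_origin_point s t" unfolding l(5) by (auto simp: same_origin_point_def)
      ultimately show ?thesis by blast
    next
      case m: (XO q)
      have "\<not> segments_cross s t" unfolding OX(5) m(3) using OX(1-3) N by (intro nocross_OO) auto
      moreover have "q \<noteq> - q'" using m(4) eqM(2) cf_Q_minus[OF OX(3), of \<alpha>] by auto
      then have "\<not> same_origin_point s t" unfolding OX(5) m(3) by (auto simp: same_origin_point_def)
      ultimately show ?thesis by blast
    next
      case m: (OX q)
      have "\<not> segments_cross s t" unfolding OX(5) m(3) using OX(1-3) N by (intro nocross_OO) auto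
      moreover have "near (Suc j) (Suc M)" using OX(1) by (auto simp: near_def)
      then have "collinear (unlabeled s \<union> unlabeled t) \<or> \<not> union_crosses_gray_zone N s t"
        unfolding OX(5) m(3) using OX(2) N by (subst near_iff[OF OX(3)]) auto
      ultimately show ?thesis by blast
    qed
  qed
  then show ?thesis unfolding good_def by blast
qed

text \<open>Here both exceptions of the criterion are needed. Simple roots that move
  \<open>x M\<close> to q and to -q have coinciding radii, excused as equal drawings, with different
  labels. Radii at M and M + 1 with the same label form a diameter and so lie in a common
  line.\<close>

lemma good_neg:
  assumes \<gamma>: "\<gamma> \<in> \<Delta>" and \<alpha>: "\<alpha> \<in> \<Delta>" and ne: "\<gamma> \<noteq> \<alpha>"
  shows "good N (negd \<gamma>) (negd \<alpha>)"
proof -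
  have uniq: False if "cf \<gamma> q < cf \<gamma> (x M)" "cf \<alpha> q < cf \<alpha> (x M)" "q \<in> Q" for q
  proof -
    have "refl \<gamma> (x M) = q" "refl \<alpha> (x M) = q" using cf_Q_step that \<gamma> \<alpha> by auto
    moreover have "q \<noteq> x M" using that(1) by auto
    ultimately show False using simple_unique[OF \<gamma> \<alpha>, of "x M"] ne by metis
  qed
  have "(segments_cross s t \<longrightarrow> unlabeled s = unlabeled t) \<and>
    (same_origin_point s t \<longrightarrow> collinear (unlabeled s \<union> unlabeled t) \<or> \<not> union_crosses_gray_zone N s t)"
    if s: "s \<in> negd \<gamma>" and t: "t \<in> negd \<alpha>" for s t
    using s \<gamma>
  proof (cases rule: negd_cases)
    case (XX i)
    have no: "\<not> same_origin_point s t" unfolding XX(5) by (auto simp: same_origin_point_def)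
    from t \<alpha> have "\<not> segments_cross s t"
    proof (cases rule: negd_cases)
      case l: (XX l)
      have "i \<noteq> l"
      proof
        assume "i = l"
        then have "refl \<gamma> (x i) = x (Suc i)" "refl \<alpha> (x i) = x (Suc i)"
          using cf_step[of i \<gamma>] cf_step[of i \<alpha>] XX l \<gamma> \<alpha> by auto
        then show False using simple_unique[OF \<gamma> \<alpha>, of "x i"] ne x_eq_iff[of i "Suc i"] XX(1,2) by auto
      qed
      then show ?thesis unfolding XX(5) l(5) using XX(1,2) l(1,2) by (intro nocross_XX) auto
    next
      case (XO q)
      then show ?thesis unfolding XX(5) XO(3) using XX(1-3) by (intro nocross_XM[OF XO(1)]) auto
    next
      case (OX q)
      then show ?thesis unfolding XX(5) OX(3) using XX(1-3) by (intro nocross_XM[OF OX(1)]) auto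
    qed
    then show ?thesis using no by blast
  next
    case (XO q)
    have N: "2 * M = N" using N_eq[OF XO(1), symmetric] .
    from t \<alpha> show ?thesis
    proof (cases rule: negd_cases)
      case l: (XX l)
      have "\<not> segments_cross s t" unfolding XO(3) l(5) using l(1-3) XO(1) N by (intro nocross_XO[OF XO(1)]) auto
      moreover have "\<not> same_origin_point s t" unfolding l(5) by (auto simp: same_origin_point_def)
      ultimately show ?thesis by blast
    next
      case m: (XO q')
      have "q' \<noteq> q" using uniq XO m by auto
      then have "\<not> same_origin_point s t" unfolding XO(3) m(3) by (auto simp: same_origin_point_def)
      moreover have "unlabeled s = unlabeled t" unfolding XO(3) m(3) by (rule unlabeled_XO)
      ultimately show ?thesis by blast
    next
      case m: (OX q')
      have "\<not> segments_cross s t" unfolding XO(3) m(3) using N by (intro nocross_OO) auto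
      moreover have "near M (Suc M)" using N by (auto simp: near_def)
      then have "collinear (unlabeled s \<union> unlabeled t) \<or> \<not> union_crosses_gray_zone N s t"
        unfolding XO(3) m(3) using N by (subst near_iff[OF XO(1)]) auto
      ultimately show ?thesis by blast
    qed
  next
    case (OX q)
    have N: "2 * M = N" "1 \<le> M" using N_eq[OF OX(1), symmetric] M_ge[OF OX(1)] by auto
    from t \<alpha> show ?thesis
    proof (cases rule: negd_cases)
      case l: (XX l)
      have "\<not> segments_cross s t" unfolding OX(3) l(5) using l(1-3) OX(1) N by (intro nocross_XO[OF OX(1)]) auto
      moreover have "\<not> same_origin_point s t" unfolding l(5) by (auto simp: same_origin_point_def)
      ultimately show ?thesis by blast
    next
      case m: (OX q')
      have "q' \<noteq> q" using uniq[of "- q"] OX(1,4) m(4) Q_uminus cf_Q_minus[OF OX(1)] by auto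
      then have "\<not> same_origin_point s t" unfolding OX(3) m(3) by (auto simp: same_origin_point_def)
      moreover have "unlabeled s = unlabeled t" unfolding OX(3) m(3) by (rule unlabeled_XO)
      ultimately show ?thesis by blast
    next
      case m: (XO q')
      have "\<not> segments_cross s t" unfolding OX(3) m(3) using N by (intro nocross_OO) auto
      moreover have "near (Suc M) M" using N by (auto simp: near_def)
      then have "collinear (unlabeled s \<union> unlabeled t) \<or> \<not> union_crosses_gray_zone N s t"
        unfolding OX(3) m(3) using N by (subst near_iff[OF OX(1)]) auto
      ultimately show ?thesis by blast
    qed
  qed
  then show ?thesis unfolding good_def by blast
qed

text \<open>The diagonal is removed because a compatibility relation excludes the pair of -\<alpha>
  with itself: the coefficient there is -1.\<close>

definition compat where
  "compat = {(\<beta>, \<gamma>). \<beta> \<in> AP \<and> \<gamma> \<in> AP \<and> \<beta> \<noteq> \<gamma> \<and> good N (dg \<beta>) (dg \<gamma>)}"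

lemma compat_neg_simple:
  assumes "\<beta> \<in> AP" "\<alpha> \<in> \<Delta>"
  shows "(\<beta>, - \<alpha>) \<in> compat \<longleftrightarrow> cf \<alpha> \<beta> = 0"
  using assms(1)
proof (cases rule: AP_cases)
  case pos
  have "good N (posd \<beta>) (negd \<alpha>) \<longleftrightarrow> cf \<alpha> \<beta> = 0"
    using good_pos[OF pos assms(2)] bad_pos[OF pos assms(2)] PosD(2)[OF pos assms(2)] by force
  then show ?thesis
    using pos assms Pos_neg_simple neg_simple_AP dg_Pos dg_neg by (simp add: compat_def)
next
  case (neg \<gamma>)
  show ?thesis
  proof (cases "\<gamma> = \<alpha>")
    case True
    then show ?thesis using neg assms by (simp add: compat_def cf_minus cf_simple)
  next
    case False
    then have "good N (negd \<gamma>) (negd \<alpha>)" using good_neg neg assms by blast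
    then show ?thesis using False neg assms neg_simple_AP dg_neg by (simp add: compat_def cf_minus cf_simple)
  qed
qed

lemma compatibility_relation_compat: "compatibility_relation \<Phi> D compat"
  unfolding compatibility_relation_def Let_def
proof (intro conjI allI ballI)
  show "compat \<subseteq> AP \<times> AP" by (auto simp: compat_def)
  show "(tau D \<epsilon> \<beta>, tau D \<epsilon> \<gamma>) \<in> compat \<longleftrightarrow> (\<beta>, \<gamma>) \<in> compat" if "\<beta> \<in> AP" "\<gamma> \<in> AP" for \<epsilon> \<beta> \<gamma>
    using that tau_AP tau_inj good_tau by (simp add: compat_def)
  show "(\<beta>, - \<alpha>) \<in> compat \<longleftrightarrow> cf \<alpha> \<beta> = 0" if "\<alpha> \<in> \<Delta>" "\<beta> \<in> AP" for \<alpha> \<beta>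
    using that compat_neg_simple by blast
qed

text \<open>Negative simple roots in the second argument have prescribed values, and equivariance
  carries these along the orbits. The first argument is quantified inside the induction because it
  moves too.\<close>

lemma compatibility_relation_unique:
  assumes "compatibility_relation \<Phi> D R"
  shows "R = compat"
proof -
  have R: "R \<subseteq> AP \<times> AP" "\<And>\<epsilon> \<beta> \<gamma>. \<beta> \<in> AP \<Longrightarrow> \<gamma> \<in> AP \<Longrightarrow> (tau D \<epsilon> \<beta>, tau D \<epsilon> \<gamma>) \<in> R \<longleftrightarrow> (\<beta>, \<gamma>) \<in> R"
    "\<And>\<alpha> \<beta>. \<alpha> \<in> \<Delta> \<Longrightarrow> \<beta> \<in> AP \<Longrightarrow> (\<beta>, - \<alpha>) \<in> R \<longleftrightarrow> cf \<alpha> \<beta> = 0"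
    using assms unfolding compatibility_relation_def Let_def by auto
  have S: "(tau D \<epsilon> \<beta>, tau D \<epsilon> \<gamma>) \<in> compat \<longleftrightarrow> (\<beta>, \<gamma>) \<in> compat" if "\<beta> \<in> AP" "\<gamma> \<in> AP" for \<epsilon> \<beta> \<gamma>
    using that tau_AP tau_inj good_tau by (simp add: compat_def)
  have N: "0 < N" using N_ge by simp
  have eq: "\<forall>\<beta>\<in>AP. (\<beta>, \<gamma>) \<in> R \<longleftrightarrow> (\<beta>, \<gamma>) \<in> compat" if "\<gamma> \<in> AP" for \<gamma>
    using N cc_power_N that
  proof (induction \<gamma> rule: tau_orbit_induct)
    case (neg_simple \<alpha>)
    then show ?case using R(3) compat_neg_simple by blast
  next
    case (tau \<gamma> \<epsilon>)
    show ?case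
    proof
      fix \<beta> assume \<beta>: "\<beta> \<in> AP"
      have "(\<beta>, tau D \<epsilon> \<gamma>) \<in> R \<longleftrightarrow> (tau D \<epsilon> \<beta>, \<gamma>) \<in> R"
        using R(2)[of "tau D \<epsilon> \<beta>" \<gamma> \<epsilon>] tau_AP tau_tau \<beta> tau by simp
      also have "\<dots> \<longleftrightarrow> (tau D \<epsilon> \<beta>, \<gamma>) \<in> compat" using tau tau_AP \<beta> by blast
      also have "\<dots> \<longleftrightarrow> (\<beta>, tau D \<epsilon> \<gamma>) \<in> compat"
        using S[of "tau D \<epsilon> \<beta>" \<gamma> \<epsilon>] tau_AP tau_tau \<beta> tau by simp
      finally show "(\<beta>, tau D \<epsilon> \<gamma>) \<in> R \<longleftrightarrow> (\<beta>, tau D \<epsilon> \<gamma>) \<in> compat" .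
    qed
  qed
  have sub: "compat \<subseteq> AP \<times> AP" by (auto simp: compat_def)
  show ?thesis
  proof (rule set_eqI)
    fix p
    show "p \<in> R \<longleftrightarrow> p \<in> compat"
    proof (cases "p \<in> AP \<times> AP")
      case True
      then obtain \<beta> \<gamma> where "p = (\<beta>, \<gamma>)" "\<beta> \<in> AP" "\<gamma> \<in> AP" by blast
      then show ?thesis using eq by simp
    next
      case False
      then show ?thesis using R(1) sub by blast
    qed
  qed
qed

theorem compatible_iff_good:
  assumes "\<beta> \<in> AP" "\<gamma> \<in> AP" "\<beta> \<noteq> \<gamma>" "is_diagram D c \<omega> Orb \<beta> C1" "is_diagram D c \<omega> Orb \<gamma> C2"
  shows "compatible \<Phi> D \<beta> \<gamma> \<longleftrightarrow> good (coxeter_number D) C1 C2"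
proof -
  have "(THE R. compatibility_relation \<Phi> D R) = compat"
    by (rule the_equality) (rule compatibility_relation_compat, rule compatibility_relation_unique)
  then show ?thesis
    using assms(1-3) is_diagram_dg[OF assms(4)] is_diagram_dg[OF assms(5)]
    by (simp add: compatible_def compat_def coxeter_number_eq)
qed

end

section \<open>The orbits of the classical and dihedral groups\<close>

text \<open>Independence is a hypothesis on coefficients so that the lemma also serves type A, with
  n of its n + 1 vectors, which are not orthonormal.\<close>

lemma orthonormal_frame_total:
  fixes e :: "nat \<Rightarrow> 'a::euclidean_space"
  assumes dim: "DIM('a) = n"
    and ind: "\<And>a. (\<Sum>i\<in>{1..n}. a i *\<^sub>R e i) = 0 \<Longrightarrow> \<forall>i\<in>{1..n}. a i = 0"
    and v: "\<And>i. i \<in> {1..n} \<Longrightarrow> v \<bullet> e i = 0"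
  shows "v = 0"
proof -
  have inj: "inj_on e {1..n}"
  proof (rule inj_onI, rule ccontr)
    fix i j assume ij: "i \<in> {1..n}" "j \<in> {1..n}" "e i = e j" "i \<noteq> j"
    let ?a = "\<lambda>k. if k = i then 1 else if k = j then -1 else (0::real)"
    have "(\<Sum>k\<in>{1..n}. ?a k *\<^sub>R e k) = (\<Sum>k\<in>{i, j}. ?a k *\<^sub>R e k)"
      using ij by (intro sum.mono_neutral_right) auto
    also have "\<dots> = 0" using ij by simp
    finally have "?a i = 0" using ind[of ?a] ij(1) by blast
    then show False by simp
  qed
  have "independent (e ` {1..n})"
  proof (rule independent_if_scalars_zero)
    fix f y assume 0: "(\<Sum>y\<in>e ` {1..n}. f y *\<^sub>R y) = 0" and y: "y \<in> e ` {1..n}"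
    have "(\<Sum>i\<in>{1..n}. f (e i) *\<^sub>R e i) = 0" using 0 by (simp only: sum.reindex[OF inj] comp_def)
    then show "f y = 0" using ind[of "\<lambda>i. f (e i)"] y by blast
  qed simp
  moreover have "card (e ` {1..n}) = dim (UNIV :: 'a set)" using card_image[OF inj] dim by simp
  ultimately have "v \<in> span (e ` {1..n})" using card_eq_dim[of "e ` {1..n}" UNIV] by auto
  then have "orthogonal v v" by (rule orthogonal_to_span) (use v in \<open>auto simp: orthogonal_def\<close>)
  then show ?thesis by (simp add: orthogonal_def)
qed

lemma orthonormal_total:
  fixes e :: "nat \<Rightarrow> 'a::euclidean_space"
  assumes dim: "DIM('a) = n" and e: "orthonormal_frame n e" and v: "\<And>i. i \<in> {1..n} \<Longrightarrow> v \<bullet> e i = 0"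
  shows "v = 0"
proof (rule orthonormal_frame_total[OF dim _ v])
  fix a assume 0: "(\<Sum>i\<in>{1..n}. a i *\<^sub>R e i) = 0"
  show "\<forall>i\<in>{1..n}. a i = 0"
  proof
    fix j assume j: "j \<in> {1..n}"
    have "e j \<bullet> (\<Sum>i\<in>{1..n}. a i *\<^sub>R e i) = (\<Sum>i\<in>{1..n}. if i = j then a i else 0)"
      unfolding inner_sum_right using e j by (intro sum.cong) (auto simp: orthonormal_frame_def)
    then show "a j = 0" using 0 j by simp
  qed
qed auto

lemma refl_swap': "norm x = norm y \<Longrightarrow> refl (x - y) y = x"
  using refl_swap refl_refl by metis

lemma orthogonal_transformation_refl: "orthogonal_transformation (refl v)"
  by (simp add: orthogonal_transformation_def refl_linear refl_inner)

lemma refl_symmetry_group: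
  assumes "\<And>z. z \<in> X \<Longrightarrow> refl v z \<in> X"
  shows "refl v \<in> symmetry_group X"
proof -
  have "X \<subseteq> refl v ` X" using assms by (auto simp: image_iff) (metis refl_refl)
  then show ?thesis using assms orthogonal_transformation_refl by (auto simp: symmetry_group_def)
qed

text \<open>The alternatives lead to \<open>chain_snake\<close> and \<open>origin_snake\<close>. The
  types enter the proof only through this property and \<open>spherical_orbit\<close>.\<close>

definition swappable :: "('a::real_inner \<Rightarrow> 'a) set \<Rightarrow> 'a set \<Rightarrow> bool" where
  "swappable W Orb \<longleftrightarrow>
     (\<forall>x\<in>Orb. \<forall>y\<in>Orb. x \<noteq> y \<longrightarrow> refl (x - y) \<in> W) \<and> 3 \<le> card Orb \<or>
     (\<forall>x\<in>Orb. - x \<in> Orb \<and> refl x \<notin> W) \<and>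
     (\<forall>x\<in>Orb. \<forall>y\<in>Orb. x \<noteq> y \<and> x \<noteq> - y \<longrightarrow> refl (x - y) \<in> W) \<and> 6 \<le> card Orb"

definition spherical_orbit :: "('a::real_inner \<Rightarrow> 'a) set \<Rightarrow> 'a set \<Rightarrow> bool" where
  "spherical_orbit W Orb \<longleftrightarrow> finite Orb \<and> (\<forall>x\<in>Orb. \<forall>y\<in>Orb. norm x = norm y) \<and>
     (\<forall>w\<in>W. w ` Orb \<subseteq> Orb) \<and> (\<forall>v. (\<forall>x\<in>Orb. v \<bullet> x = 0) \<longrightarrow> v = 0)"

lemma type_A_orbit:
  fixes W :: "('a::euclidean_space \<Rightarrow> 'a) set"
  assumes n: "2 \<le> n" and A: "type_A n W Orb"
  shows "spherical_orbit W Orb \<and> swappable W Orb"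
proof -
  obtain e where dim: "DIM('a) = n"
    and gram: "\<And>i j. i \<in> {1..n+1} \<Longrightarrow> j \<in> {1..n+1} \<Longrightarrow> e i \<bullet> e j = (if i = j then 1 else 0) - 1 / (real n + 1)"
    and W: "W = {f. linear f \<and> (\<exists>\<pi>. \<pi> permutes {1..n+1} \<and> (\<forall>i\<in>{1..n+1}. f (e i) = e (\<pi> i)))}"
    and Orb: "Orb = e ` {1..n+1}"
    using A unfolding type_A_def by blast
  have e_inj: "i = j" if "i \<in> {1..n+1}" "j \<in> {1..n+1}" "e i = e j" for i j
    using gram[of i i] gram[of i j] that by (auto split: if_splits)
  have norm_e: "norm (e i) = norm (e j)" if "i \<in> {1..n+1}" "j \<in> {1..n+1}" for i j
    using gram that by (simp add: norm_eq_sqrt_inner)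
  have total: "v = 0" if v: "\<forall>x\<in>Orb. v \<bullet> x = 0" for v
  proof (rule orthonormal_frame_total[OF dim, of e])
    fix a assume 0: "(\<Sum>i\<in>{1..n}. a i *\<^sub>R e i) = 0"
    let ?s = "\<Sum>i\<in>{1..n}. a i"
    \<comment> \<open>The Gram matrix is the identity minus a constant matrix, so pairing with
      \<open>e j\<close> expresses each coefficient through the sum s of all. Adding up gives s = n
      s/(n + 1).\<close>
    have eq: "a j = ?s / (real n + 1)" if j: "j \<in> {1..n}" for j
    proof -
      have "0 = e j \<bullet> (\<Sum>i\<in>{1..n}. a i *\<^sub>R e i)" using 0 by simp
      also have "\<dots> = (\<Sum>i\<in>{1..n}. a i * (e j \<bullet> e i))" by (simp add: inner_sum_right)
      also have "\<dots> = (\<Sum>i\<in>{1..n}. (if i = j then a i else 0) - a i / (real n + 1))"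
      proof (rule sum.cong)
        fix i assume "i \<in> {1..n}"
        then have "e j \<bullet> e i = (if i = j then 1 else 0) - 1 / (real n + 1)" using gram[of j i] j by auto
        then show "a i * (e j \<bullet> e i) = (if i = j then a i else 0) - a i / (real n + 1)"
          by (simp add: right_diff_distrib)
      qed simp
      also have "\<dots> = a j - ?s / (real n + 1)" using j by (simp add: sum_subtractf sum_divide_distrib)
      finally show ?thesis by simp
    qed
    have "?s = (\<Sum>i\<in>{1..n}. ?s / (real n + 1))" by (rule sum.cong[OF refl eq])
    also have "\<dots> = real n * (?s / (real n + 1))" by simp
    finally have "?s = 0" by (simp add: field_simps)
    then have "?s / (real n + 1) = 0" by simp
    then show "\<forall>i\<in>{1..n}. a i = 0" using eq by metis
  qed (use v Orb in auto)
  have swap: "refl (x - y) \<in> W" if xy: "x \<in> Orb" "y \<in> Orb" "x \<noteq> y" for x y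
  proof -
    obtain i j where ij: "i \<in> {1..n+1}" "j \<in> {1..n+1}" "x = e i" "y = e j" using xy Orb by auto
    have "i \<noteq> j" using ij xy by auto
    have "refl (x - y) (e k) = e (Transposition.transpose i j k)" if k: "k \<in> {1..n+1}" for k
    proof -
      consider "k = i" | "k = j" | "k \<noteq> i" "k \<noteq> j" by blast
      then show ?thesis
      proof cases
        case 3
        then have "(x - y) \<bullet> e k = 0" using ij k gram by (simp add: inner_diff_left)
        then show ?thesis using 3 refl_fix_iff[of "x - y" "e k"] by simp
      qed (use ij refl_swap[OF norm_e[OF ij(1,2)]] refl_swap'[OF norm_e[OF ij(1,2)]] in simp_all)
    qed
    then show ?thesis unfolding W using ij by (auto intro!: refl_linear exI[of _ "Transposition.transpose i j"] permutes_swap_id)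
  qed
  have "card Orb = n + 1" unfolding Orb using e_inj by (subst card_image) (auto intro: inj_onI)
  then have "swappable W Orb" using swap n by (simp add: swappable_def)
  moreover have "w ` Orb \<subseteq> Orb" if w: "w \<in> W" for w
  proof -
    obtain \<pi> where "\<pi> permutes {1..n+1}" "\<forall>i\<in>{1..n+1}. w (e i) = e (\<pi> i)" using w W by blast
    then show ?thesis unfolding Orb using permutes_in_image by fastforce
  qed
  moreover have "\<forall>x\<in>Orb. \<forall>y\<in>Orb. norm x = norm y" unfolding Orb using norm_e by blast
  moreover have "finite Orb" unfolding Orb by simp
  ultimately show ?thesis unfolding spherical_orbit_def using total by blast
qed

locale signed_frame =
  fixes n :: nat and e :: "nat \<Rightarrow> 'a::euclidean_space" and Orb :: "'a set"
  assumes dim: "DIM('a) = n" and frame: "orthonormal_frame n e"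
    and Orb: "Orb = e ` {1..n} \<union> uminus ` e ` {1..n}"
begin

lemma inner_e: "i \<in> {1..n} \<Longrightarrow> j \<in> {1..n} \<Longrightarrow> e i \<bullet> e j = (if i = j then 1 else 0)"
  using frame by (simp add: orthonormal_frame_def)

lemma Orb_cases:
  assumes "x \<in> Orb"
  obtains i s where "i \<in> {1..n}" "s = 1 \<or> s = -1" "x = s *\<^sub>R e i"
  using assms unfolding Orb by (force intro: that[of _ 1] that[of _ "-1"])

lemma Orb_I: "i \<in> {1..n} \<Longrightarrow> s = 1 \<or> s = -1 \<Longrightarrow> s *\<^sub>R e i \<in> Orb"
  unfolding Orb by auto

lemma spherical:
  assumes "\<And>f. f \<in> W \<Longrightarrow> \<exists>\<pi> \<sigma>. signed_perm_via n e \<pi> \<sigma> f"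
  shows "spherical_orbit W Orb"
proof -
  have "norm x = 1" if "x \<in> Orb" for x
    using that by (rule Orb_cases) (auto simp: norm_eq_sqrt_inner inner_e)
  moreover have "w ` Orb \<subseteq> Orb" if "w \<in> W" for w
  proof
    fix y assume "y \<in> w ` Orb"
    then obtain z where z: "z \<in> Orb" "y = w z" by blast
    obtain i s where x: "i \<in> {1..n}" "s = 1 \<or> s = -1" "y = w (s *\<^sub>R e i)" using Orb_cases[OF z(1)] z(2) by metis
    obtain \<pi> \<sigma> where w: "linear w" "\<pi> permutes {1..n}" "\<sigma> i \<in> {1, -1}" "w (e i) = \<sigma> i *\<^sub>R e (\<pi> i)"
      using assms[OF \<open>w \<in> W\<close>] x(1) unfolding signed_perm_via_def by blast
    have y: "y = (s * \<sigma> i) *\<^sub>R e (\<pi> i)" using x w by (simp add: linear_scale)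
    have "\<pi> i \<in> {1..n}" using permutes_in_image[OF w(2)] x(1) by blast
    moreover have "s * \<sigma> i = 1 \<or> s * \<sigma> i = -1" using x(2) w(3) by auto
    ultimately show "y \<in> Orb" unfolding y by (rule Orb_I)
  qed
  moreover have "v = 0" if "\<forall>x\<in>Orb. v \<bullet> x = 0" for v
    using orthonormal_total[OF dim frame] that by (auto simp: Orb)
  moreover have "finite Orb" by (simp add: Orb)
  ultimately show ?thesis by (simp add: spherical_orbit_def)
qed

lemma card_Orb: "card Orb = 2 * n"
proof -
  have inj: "inj_on e {1..n}"
    by (rule inj_onI) (metis inner_e zero_neq_one)
  have "e i \<noteq> - e j" if "i \<in> {1..n}" "j \<in> {1..n}" for i j
  proof
    assume "e i = - e j"
    then have "e i \<bullet> e i = - (e i \<bullet> e j)" by (metis inner_minus_right)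
    then show False using that by (auto simp: inner_e split: if_splits)
  qed
  then have "e ` {1..n} \<inter> uminus ` e ` {1..n} = {}" by blast
  moreover have "card (e ` {1..n}) = n" using card_image[OF inj] by simp
  moreover have "card (uminus ` e ` {1..n}) = card (e ` {1..n})" by (rule card_image) (simp add: inj_on_def)
  ultimately show ?thesis unfolding Orb by (subst card_Un_disjoint) simp_all
qed

text \<open>For x = s e_i and y = t e_j the reflection is the transposition of i and j with both
  signs equal to st, so there are no minus signs or two.\<close>

lemma refl_difference:
  assumes "x \<in> Orb" "y \<in> Orb" "x \<noteq> y" "x \<noteq> - y"
  shows "\<exists>\<pi> \<sigma>. signed_perm_via n e \<pi> \<sigma> (refl (x - y)) \<and> even (card {i\<in>{1..n}. \<sigma> i = -1})"
proof -
  obtain i s where i: "i \<in> {1..n}" "s = 1 \<or> s = -1" "x = s *\<^sub>R e i" using Orb_cases assms(1) by blast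
  obtain j t where j: "j \<in> {1..n}" "t = 1 \<or> t = -1" "y = t *\<^sub>R e j" using Orb_cases assms(2) by blast
  have ij: "i \<noteq> j" using i j assms(3,4) by auto
  have norms: "norm x = norm y" using i j by (auto simp: norm_eq_sqrt_inner inner_e)
  define \<sigma> where "\<sigma> k = (if k = i \<or> k = j then s * t else 1)" for k
  have st: "s * s = 1" "t * t = 1" "s * t = 1 \<or> s * t = -1" using i j by auto
  have xi: "e i = s *\<^sub>R x" "e j = t *\<^sub>R y" using i j st by simp_all
  have "refl (x - y) (e k) = \<sigma> k *\<^sub>R e (Transposition.transpose i j k)" if k: "k \<in> {1..n}" for k
  proof -
    consider "k = i" | "k = j" | "k \<noteq> i" "k \<noteq> j" by blast
    then show ?thesis
    proof cases
      case 1
      have "refl (x - y) (e i) = s *\<^sub>R y" unfolding xi(1) using refl_swap[OF norms] linear_scale[OF refl_linear] by metis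
      then show ?thesis using 1 j by (simp add: \<sigma>_def)
    next
      case 2
      have "refl (x - y) (e j) = t *\<^sub>R x" unfolding xi(2) using refl_swap'[OF norms] linear_scale[OF refl_linear] by metis
      then show ?thesis using 2 i ij by (simp add: \<sigma>_def mult.commute)
    next
      case 3
      then have "(x - y) \<bullet> e k = 0" using i j k by (simp add: inner_diff_left inner_e)
      then show ?thesis using 3 refl_fix_iff[of "x - y" "e k"] by (simp add: \<sigma>_def)
    qed
  qed
  then have "signed_perm_via n e (Transposition.transpose i j) \<sigma> (refl (x - y))"
    unfolding signed_perm_via_def using i j st(3) by (auto intro: refl_linear permutes_swap_id simp: \<sigma>_def)
  moreover have "even (card {k\<in>{1..n}. \<sigma> k = -1})"
  proof (cases "s * t = 1")
    case True
    then have eq: "{k\<in>{1..n}. \<sigma> k = -1} = {}" by (auto simp: \<sigma>_def)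
    show ?thesis unfolding eq by simp
  next
    case False
    then have eq: "{k\<in>{1..n}. \<sigma> k = -1} = {i, j}" using st(3) i(1) j(1) by (auto simp: \<sigma>_def)
    show ?thesis unfolding eq using ij by simp
  qed
  ultimately show ?thesis by blast
qed

lemma refl_single:
  assumes "i \<in> {1..n}"
  shows "k \<in> {1..n} \<Longrightarrow> refl (e i) (e k) = (if k = i then - e k else e k)"
  using assms by (simp add: refl_def inner_e scaleR_2)

lemma refl_scaled: "s = 1 \<or> s = -1 \<Longrightarrow> refl (s *\<^sub>R v) = refl v"
  by (rule refl_scaleR) auto

end

lemma type_B_orbit:
  fixes W :: "('a::euclidean_space \<Rightarrow> 'a) set"
  assumes n: "2 \<le> n" and B: "type_B n W Orb"
  shows "spherical_orbit W Orb \<and> swappable W Orb"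
proof -
  obtain e where "DIM('a) = n" "orthonormal_frame n e" and W: "W = {f. \<exists>\<pi> \<sigma>. signed_perm_via n e \<pi> \<sigma> f}"
    and "Orb = e ` {1..n} \<union> uminus ` e ` {1..n}"
    using B unfolding type_B_def by blast
  then interpret signed_frame n e Orb by unfold_locales
  have "refl (x - y) \<in> W" if xy: "x \<in> Orb" "y \<in> Orb" "x \<noteq> y" for x y
  proof (cases "x = - y")
    case True
    obtain i s where i: "i \<in> {1..n}" "s = 1 \<or> s = -1" "x = s *\<^sub>R e i" using Orb_cases xy by blast
    have "x - y = (2 * s) *\<^sub>R e i" using True i by (simp add: scaleR_2 flip: scaleR_scaleR)
    then have "refl (x - y) = refl (e i)" using refl_scaleR[of "2 * s" "e i"] i(2) by auto
    moreover have "signed_perm_via n e id (\<lambda>k. if k = i then -1 else 1) (refl (e i))"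
      using refl_single[OF i(1)] by (auto simp: signed_perm_via_def refl_linear permutes_id)
    ultimately show ?thesis unfolding W by auto
  next
    case False
    then show ?thesis using refl_difference xy unfolding W by blast
  qed
  moreover have "3 \<le> card Orb" using n card_Orb by simp
  ultimately have "swappable W Orb" by (simp add: swappable_def)
  then show ?thesis using spherical[of W] W by blast
qed

lemma type_D_orbit:
  fixes W :: "('a::euclidean_space \<Rightarrow> 'a) set"
  assumes n: "4 \<le> n" and B: "type_D n W Orb"
  shows "spherical_orbit W Orb \<and> swappable W Orb"
proof -
  obtain e where "DIM('a) = n" "orthonormal_frame n e"
    and W: "W = {f. \<exists>\<pi> \<sigma>. signed_perm_via n e \<pi> \<sigma> f \<and> even (card {i\<in>{1..n}. \<sigma> i = -1})}"
    and "Orb = e ` {1..n} \<union> uminus ` e ` {1..n}"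
    using B unfolding type_D_def by blast
  then interpret signed_frame n e Orb by unfold_locales
  have "refl x \<notin> W" if x: "x \<in> Orb" for x
  proof
    assume "refl x \<in> W"
    obtain i s where i: "i \<in> {1..n}" "s = 1 \<or> s = -1" "x = s *\<^sub>R e i" using Orb_cases x by blast
    then have "refl (e i) \<in> W" using \<open>refl x \<in> W\<close> refl_scaled by metis
    then obtain \<pi> \<sigma> where p: "signed_perm_via n e \<pi> \<sigma> (refl (e i))" "even (card {i\<in>{1..n}. \<sigma> i = -1})"
      unfolding W by blast
    \<comment> \<open>Pairing the image of \<open>e k\<close> with \<open>e k\<close> reads off the
      sign. Only k = i gives -1, an odd number of sign changes.\<close>
    have "\<sigma> k = (if k = i then -1 else 1)" if k: "k \<in> {1..n}" for k
    proof -
      have \<pi>k: "\<pi> k \<in> {1..n}" and \<sigma>: "\<sigma> k \<in> {1, -1}" and r: "refl (e i) (e k) = \<sigma> k *\<^sub>R e (\<pi> k)"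
        using p(1) k permutes_in_image[of \<pi> "{1..n}" k] unfolding signed_perm_via_def by blast+
      have "e k \<bullet> refl (e i) (e k) = (if k = i then -1 else 1)" using refl_single[OF i(1) k] k by (simp add: inner_e)
      then have "\<sigma> k * (e k \<bullet> e (\<pi> k)) = (if k = i then -1 else 1)" unfolding r by simp
      then show ?thesis using k \<pi>k by (auto simp: inner_e split: if_splits)
    qed
    then have eq: "{k\<in>{1..n}. \<sigma> k = -1} = {i}" using i(1) by (auto split: if_splits)
    show False using p(2) unfolding eq by simp
  qed
  moreover have "- x \<in> Orb" if "x \<in> Orb" for x using that by (auto simp: Orb)
  moreover have "refl (x - y) \<in> W" if "x \<in> Orb" "y \<in> Orb" "x \<noteq> y \<and> x \<noteq> - y" for x y
    using refl_difference that unfolding W by blast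
  moreover have "6 \<le> card Orb" using n card_Orb by simp
  ultimately have "swappable W Orb" by (simp add: swappable_def)
  then show ?thesis using spherical[of W] W by blast
qed

lemma orthonormal_frame2:
  assumes "orthonormal_frame 2 e"
  shows "e 1 \<bullet> e 1 = 1" "e 1 \<bullet> e 2 = 0" "e 2 \<bullet> e 1 = 0" "e 2 \<bullet> e 2 = 1"
  using assms by (auto simp: orthonormal_frame_def)

text \<open>The difference of unit vectors at angles s and t is normal to the line at angle (s +
  t)/2, and reflection in this line takes angle u to s + t - u.\<close>

lemma refl_circle:
  fixes a b :: "'a::real_inner"
  assumes ab: "a \<bullet> a = 1" "a \<bullet> b = 0" "b \<bullet> a = 0" "b \<bullet> b = 1"
    and ne: "cos s *\<^sub>R a + sin s *\<^sub>R b \<noteq> cos t *\<^sub>R a + sin t *\<^sub>R b"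
  shows "refl ((cos s *\<^sub>R a + sin s *\<^sub>R b) - (cos t *\<^sub>R a + sin t *\<^sub>R b)) (cos u *\<^sub>R a + sin u *\<^sub>R b) =
    cos (s + t - u) *\<^sub>R a + sin (s + t - u) *\<^sub>R b"
proof -
  let ?h = "(s + t) / 2" and ?k = "2 * sin ((s - t) / 2)"
  let ?n = "- sin ?h *\<^sub>R a + cos ?h *\<^sub>R b"
  have m: "(t - s) / 2 = - ((s - t) / 2)" by (simp add: field_simps)
  have "cos s - cos t = ?k * - sin ?h" unfolding cos_diff_cos m sin_minus by simp
  moreover have "sin s - sin t = ?k * cos ?h" unfolding sin_diff_sin by simp
  moreover have "(cos s *\<^sub>R a + sin s *\<^sub>R b) - (cos t *\<^sub>R a + sin t *\<^sub>R b) = (cos s - cos t) *\<^sub>R a + (sin s - sin t) *\<^sub>R b"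
    by (simp add: algebra_simps)
  ultimately have d: "(cos s *\<^sub>R a + sin s *\<^sub>R b) - (cos t *\<^sub>R a + sin t *\<^sub>R b) = ?k *\<^sub>R ?n"
    by (simp add: scaleR_right_distrib scaleR_right_diff_distrib)
  then have "?k \<noteq> 0" using ne by auto
  then have r: "refl ((cos s *\<^sub>R a + sin s *\<^sub>R b) - (cos t *\<^sub>R a + sin t *\<^sub>R b)) = refl ?n"
    unfolding d by (rule refl_scaleR)
  have nn: "?n \<bullet> ?n = 1" using ab by (simp add: inner_diff_left inner_diff_right flip: power2_eq_square)
  have nu: "?n \<bullet> (cos u *\<^sub>R a + sin u *\<^sub>R b) = sin (u - ?h)"
    using ab by (simp add: inner_diff_left inner_add_right sin_diff)
  have h: "u - ?h - ?h = - (s + t - u)" "u - ?h + ?h = u" by (simp_all add: field_simps)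
  have "cos u - 2 * sin (u - ?h) * - sin ?h = cos (s + t - u)"
  proof -
    have "2 * (sin (u - ?h) * sin ?h) = cos (u - ?h - ?h) - cos (u - ?h + ?h)"
      using sin_times_sin[of "u - ?h" ?h] by simp
    also have "\<dots> = cos (s + t - u) - cos u" unfolding h cos_minus ..
    finally show ?thesis by simp
  qed
  moreover have "sin u - 2 * sin (u - ?h) * cos ?h = sin (s + t - u)"
  proof -
    have "2 * (sin (u - ?h) * cos ?h) = sin (u - ?h + ?h) + sin (u - ?h - ?h)"
      using sin_times_cos[of "u - ?h" ?h] by simp
    also have "\<dots> = sin u - sin (s + t - u)" unfolding h sin_minus by simp
    finally show ?thesis by simp
  qed
  moreover have "refl ?n (cos u *\<^sub>R a + sin u *\<^sub>R b) =
      (cos u - 2 * sin (u - ?h) * - sin ?h) *\<^sub>R a + (sin u - 2 * sin (u - ?h) * cos ?h) *\<^sub>R b"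
    unfolding refl_def nn nu by (simp add: algebra_simps)
  ultimately show ?thesis unfolding r by simp
qed

lemma type_I2_orbit:
  fixes W :: "('a::euclidean_space \<Rightarrow> 'a) set"
  assumes m: "3 \<le> m" and I: "type_I2 m W Orb"
  shows "spherical_orbit W Orb \<and> swappable W Orb"
proof -
  obtain e r where dim: "DIM('a) = 2" and e: "orthonormal_frame 2 e" and r: "r > 0"
    and Orb: "Orb = (\<lambda>k. r *\<^sub>R (cos (2 * pi * real k / real m) *\<^sub>R e 1 + sin (2 * pi * real k / real m) *\<^sub>R e 2)) ` {..<m}"
    and W: "W = symmetry_group Orb"
    using I unfolding type_I2_def regular_polygon_vertices_def by (metis (no_types, lifting))
  note E = orthonormal_frame2[OF e]
  define P where "P t = cos t *\<^sub>R e 1 + sin t *\<^sub>R e 2" for t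
  define ang where "ang k = 2 * pi * real k / real m" for k :: nat
  have Orb': "Orb = (\<lambda>k. r *\<^sub>R P (ang k)) ` {..<m}" unfolding Orb P_def ang_def ..
  have PP: "P s \<bullet> P s = 1" for s
    using E by (simp add: P_def inner_add_left inner_add_right flip: power2_eq_square)
  have P_eq: "cis s = cis t" if "P s = P t" for s t
  proof -
    have "P s \<bullet> e 1 = P t \<bullet> e 1" "P s \<bullet> e 2 = P t \<bullet> e 2" using that by simp_all
    then show ?thesis using E by (simp add: P_def inner_add_left complex_eq_iff)
  qed
  have P_int: "\<exists>k<m. P (2 * pi * real_of_int i / real m) = P (ang k)" for i :: int
  proof -
    define k where "k = nat (i mod int m)"
    have k: "int k = i mod int m" "k < m" using m by (auto simp: k_def nat_less_iff)
    have "i = int k + int m * (i div int m)" using k by simp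
    then have i: "real_of_int i = real k + real m * real_of_int (i div int m)"
      by (metis of_int_add of_int_mult of_int_of_nat_eq)
    have "2 * pi * real_of_int i / real m = ang k + 2 * pi * real_of_int (i div int m)"
      unfolding i ang_def using m by (simp add: field_simps)
    moreover have "cos (a + 2 * pi * real_of_int j) = cos a" "sin (a + 2 * pi * real_of_int j) = sin a" for a j
      by (simp_all add: cos_add sin_add)
    ultimately have "P (2 * pi * real_of_int i / real m) = P (ang k)" by (simp only: P_def)
    then show ?thesis using k by blast
  qed
  have swap: "refl (x - y) \<in> W" if xy: "x \<in> Orb" "y \<in> Orb" "x \<noteq> y" for x y
    unfolding W
  proof (rule refl_symmetry_group)
    fix z assume "z \<in> Orb"
    obtain i j k where ijk: "x = r *\<^sub>R P (ang i)" "y = r *\<^sub>R P (ang j)" "z = r *\<^sub>R P (ang k)"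
      using xy \<open>z \<in> Orb\<close> unfolding Orb' by blast
    have "P (ang i) \<noteq> P (ang j)" using xy ijk by auto
    then have "refl (P (ang i) - P (ang j)) (P (ang k)) = P (ang i + ang j - ang k)"
      unfolding P_def using refl_circle[OF E] by blast
    moreover have "x - y = r *\<^sub>R (P (ang i) - P (ang j))" using ijk by (simp add: scaleR_diff_right)
    then have "refl (x - y) = refl (P (ang i) - P (ang j))" using refl_scaleR[of r] r by simp
    ultimately have "refl (x - y) z = r *\<^sub>R P (ang i + ang j - ang k)"
      using ijk by (simp add: linear_scale[OF refl_linear])
    moreover have "ang i + ang j - ang k = 2 * pi * real_of_int (int i + int j - int k) / real m"
      by (simp add: ang_def add_divide_distrib diff_divide_distrib algebra_simps)
    ultimately show "refl (x - y) z \<in> Orb" using P_int[of "int i + int j - int k"] unfolding Orb' by auto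
  qed
  have "inj_on (\<lambda>k. r *\<^sub>R P (ang k)) {..<m}"
  proof (rule inj_onI)
    fix i j assume ij: "i \<in> {..<m}" "j \<in> {..<m}" "r *\<^sub>R P (ang i) = r *\<^sub>R P (ang j)"
    then have "cis (ang i) = cis (ang j)" using r by (intro P_eq) simp
    \<comment> \<open>\<open>cis_shift_eq_iff\<close> starts at 1, so everything is rotated by 2
      pi/m, which moves index 0 to 2 units of pi/m.\<close>
    then have "cis (ang i) * cis (2 * pi / m) = cis (ang j) * cis (2 * pi / m)" by simp
    moreover have "ang k + 2 * pi / m = real (2 * k + 2) * pi / real m" for k
      using m by (simp add: ang_def field_simps)
    ultimately have "cis (real (2 * i + 2) * pi / real m) = cis (real (2 * j + 2) * pi / real m)"
      unfolding cis_mult by simp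
    then have "2 * i + 2 = 2 * j + 2" using cis_shift_eq_iff[of "2 * i + 2" m "2 * j + 2"] ij by simp
    then show "i = j" by simp
  qed
  then have "card Orb = m" unfolding Orb' by (subst card_image) auto
  then have "swappable W Orb" using swap m by (simp add: swappable_def)
  moreover have "v = 0" if v: "\<forall>x\<in>Orb. v \<bullet> x = 0" for v
  proof (rule orthonormal_total[OF dim e])
    have "v \<bullet> P (ang k) = 0" if "k < m" for k using v that r unfolding Orb' by fastforce
    from this[of 0] this[of 1] have 0: "v \<bullet> e 1 = 0" "sin (2 * pi / m) * (v \<bullet> e 2) = 0"
      using m by (auto simp: P_def ang_def inner_add_right)
    have "2 * pi / m < pi" using m by (simp add: field_simps)
    then have "0 < sin (2 * pi / m)" using m by (intro sin_gt_zero) auto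
    then have "v \<bullet> e 2 = 0" using 0 by simp
    moreover fix i :: nat assume "i \<in> {1..2}"
    then have "i = 1 \<or> i = 2" by auto
    ultimately show "v \<bullet> e i = 0" using 0 by auto
  qed
  moreover have "norm x = r" if "x \<in> Orb" for x
    using that r PP unfolding Orb' by (auto simp: norm_eq_sqrt_inner)
  moreover have "finite Orb" unfolding Orb by simp
  moreover have "w ` Orb \<subseteq> Orb" if "w \<in> W" for w using that by (simp add: W symmetry_group_def)
  ultimately show ?thesis by (simp add: spherical_orbit_def)
qed

section \<open>The icosahedron\<close>

definition golden :: real where "golden = (1 + sqrt 5) / 2"

lemma golden_sq: "golden * golden = golden + 1"
  by (simp add: golden_def field_simps)

lemma golden_sq_mult: "golden * (golden * x) = golden * x + x"
  using golden_sq by (metis distrib_right mult.assoc mult_1)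

lemma golden_bounds: "1 < golden" "golden < 2"
proof -
  have "2 < sqrt 5" by (rule real_less_rsqrt) simp
  moreover have "sqrt 5 < 3" by (rule real_less_lsqrt) simp_all
  ultimately show "1 < golden" "golden < 2" by (simp_all add: golden_def)
qed

definition orth3 :: "'a::real_inner \<Rightarrow> 'a \<Rightarrow> 'a \<Rightarrow> bool" where
  "orth3 a b c \<longleftrightarrow> a \<bullet> a = 1 \<and> b \<bullet> b = 1 \<and> c \<bullet> c = 1 \<and> a \<bullet> b = 0 \<and> b \<bullet> c = 0 \<and> a \<bullet> c = 0"

lemma orth3_cycle: "orth3 a b c \<Longrightarrow> orth3 b c a"
  by (auto simp: orth3_def inner_commute)

lemma orth3_minus: "orth3 a b c \<Longrightarrow> orth3 (- a) b c"
  by (auto simp: orth3_def)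

definition icosa :: "real \<Rightarrow> 'a::real_inner \<Rightarrow> 'a \<Rightarrow> 'a \<Rightarrow> 'a set" where
  "icosa r a b c = (\<Union>s\<in>{1, -1}. \<Union>t\<in>{golden, - golden}.
     {r *\<^sub>R (s *\<^sub>R a + t *\<^sub>R b), r *\<^sub>R (s *\<^sub>R b + t *\<^sub>R c), r *\<^sub>R (s *\<^sub>R c + t *\<^sub>R a)})"

lemma icosa_cycle: "icosa r a b c = icosa r b c a"
  unfolding icosa_def by auto

lemma icosa_minus_first: "icosa r (- a) b c = icosa r a b c"
  unfolding icosa_def by auto

lemma icosa_uminus: "z \<in> icosa r a b c \<Longrightarrow> - z \<in> icosa r a b c"
  unfolding icosa_def by (auto simp: scaleR_right_distrib scaleR_right_diff_distrib)

lemma icosa_I: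
  assumes "s = 1 \<or> s = -1" "t = 1 \<or> t = -1"
  shows "r *\<^sub>R (s *\<^sub>R a + (t * golden) *\<^sub>R b) \<in> icosa r a b c"
    "r *\<^sub>R (s *\<^sub>R b + (t * golden) *\<^sub>R c) \<in> icosa r a b c"
    "r *\<^sub>R (s *\<^sub>R c + (t * golden) *\<^sub>R a) \<in> icosa r a b c"
  using assms unfolding icosa_def by auto

text \<open>Permuting the frame cyclically and changing its signs reduces a case analysis over pairs of
  vertices to one over single vertices.\<close>

lemma icosa_frame:
  assumes "orth3 a b c" "z \<in> icosa r a b c"
  obtains a' b' c' where "orth3 a' b' c'" "icosa r a' b' c' = icosa r a b c" "z = r *\<^sub>R (a' + golden *\<^sub>R b')"
proof -
  have first: "\<exists>a' b' c'. orth3 a' b' c' \<and> icosa r a' b' c' = icosa r a b c \<and> z = r *\<^sub>R (a' + golden *\<^sub>R b')"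
    if o: "orth3 a b c" and z: "z = r *\<^sub>R (s *\<^sub>R a + t *\<^sub>R b)" and st: "s = 1 \<or> s = -1" "t = golden \<or> t = - golden"
    for a b c s t
  proof -
    define a' where "a' = s *\<^sub>R a"
    define b' where "b' = (if t = golden then b else - b)"
    have a': "a' = a \<or> a' = - a" and b': "b' = b \<or> b' = - b" using st by (auto simp: a'_def b'_def)
    have "orth3 b c a'" using a' orth3_cycle[OF o] orth3_cycle[OF orth3_minus[OF o]] by auto
    then have "orth3 b' c a'" using b' orth3_minus by auto
    then have "orth3 a' b' c" by (metis orth3_cycle)
    moreover have "icosa r b' c a' = icosa r a b c"
      using a' b' icosa_minus_first icosa_cycle by metis
    then have "icosa r a' b' c = icosa r a b c" by (metis icosa_cycle)
    moreover have "z = r *\<^sub>R (a' + golden *\<^sub>R b')"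
      unfolding z using st golden_bounds by (auto simp: a'_def b'_def)
    ultimately show ?thesis by blast
  qed
  obtain s t where st: "s = 1 \<or> s = -1" "t = golden \<or> t = - golden" and
    "z = r *\<^sub>R (s *\<^sub>R a + t *\<^sub>R b) \<or> z = r *\<^sub>R (s *\<^sub>R b + t *\<^sub>R c) \<or> z = r *\<^sub>R (s *\<^sub>R c + t *\<^sub>R a)"
    using assms(2) unfolding icosa_def by blast
  then consider "z = r *\<^sub>R (s *\<^sub>R a + t *\<^sub>R b)" | "z = r *\<^sub>R (s *\<^sub>R b + t *\<^sub>R c)" | "z = r *\<^sub>R (s *\<^sub>R c + t *\<^sub>R a)" by blast
  then show ?thesis
  proof cases
    case 1
    then show ?thesis using first[OF assms(1) 1 st] that by blast
  next
    case 2
    then show ?thesis using first[OF orth3_cycle[OF assms(1)] 2 st] that icosa_cycle by metis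
  next
    case 3
    then show ?thesis using first[OF orth3_cycle[OF orth3_cycle[OF assms(1)]] 3 st] that icosa_cycle by metis
  qed
qed

lemma icosa_cases:
  assumes "z \<in> icosa r a b c"
  obtains s where "s = 1 \<or> s = -1" "z = s *\<^sub>R r *\<^sub>R (a + golden *\<^sub>R b)"
  | s where "s = 1 \<or> s = -1" "z = s *\<^sub>R r *\<^sub>R (a - golden *\<^sub>R b)"
  | s where "s = 1 \<or> s = -1" "z = s *\<^sub>R r *\<^sub>R (b + golden *\<^sub>R c)"
  | s where "s = 1 \<or> s = -1" "z = s *\<^sub>R r *\<^sub>R (b - golden *\<^sub>R c)"
  | s where "s = 1 \<or> s = -1" "z = s *\<^sub>R r *\<^sub>R (c + golden *\<^sub>R a)"
  | s where "s = 1 \<or> s = -1" "z = s *\<^sub>R r *\<^sub>R (c - golden *\<^sub>R a)"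
proof -
  have eq: "r *\<^sub>R ((-1) *\<^sub>R u + golden *\<^sub>R v) = (-1) *\<^sub>R r *\<^sub>R (u - golden *\<^sub>R v)"
    "r *\<^sub>R ((-1) *\<^sub>R u + (- golden) *\<^sub>R v) = (-1) *\<^sub>R r *\<^sub>R (u + golden *\<^sub>R v)"
    "r *\<^sub>R (1 *\<^sub>R u + golden *\<^sub>R v) = 1 *\<^sub>R r *\<^sub>R (u + golden *\<^sub>R v)"
    "r *\<^sub>R (1 *\<^sub>R u + (- golden) *\<^sub>R v) = 1 *\<^sub>R r *\<^sub>R (u - golden *\<^sub>R v)" for u v :: 'a
    by (simp_all add: algebra_simps)
  show ?thesis
    using assms unfolding icosa_def UN_insert UN_empty Un_empty_right Un_iff insert_iff empty_iff eq
    using that[of 1] that[of "-1"] by blast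
qed

lemma icosa_refl_axis:
  assumes o: "orth3 a b c" and z: "z \<in> icosa r a b c"
  shows "refl a z \<in> icosa r a b c"
proof -
  have r: "refl a a = - a" "refl a b = b" "refl a c = c"
    using o by (auto simp: orth3_def refl_def scaleR_2)
  have "refl a z \<in> icosa r (- a) b c"
    using z unfolding icosa_def
    by (auto simp: linear_add[OF refl_linear] linear_diff[OF refl_linear] linear_scale[OF refl_linear] refl_minus r)
  then show ?thesis by (simp add: icosa_minus_first)
qed

text \<open>The vector is the difference of the adjacent vertices a + golden b and b - golden c for
  r = 1, of squared length 4. Its reflection permutes the six vertices up to sign, as computed one
  by one.\<close>

lemma icosa_refl_edge:
  assumes o: "orth3 a b c" and z: "z \<in> icosa r a b c"
  shows "refl (a + (golden - 1) *\<^sub>R b + golden *\<^sub>R c) z \<in> icosa r a b c"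
proof -
  let ?d = "a + (golden - 1) *\<^sub>R b + golden *\<^sub>R c"
  have I: "a \<bullet> a = 1" "b \<bullet> b = 1" "c \<bullet> c = 1" "a \<bullet> b = 0" "b \<bullet> a = 0" "b \<bullet> c = 0" "c \<bullet> b = 0" "a \<bullet> c = 0" "c \<bullet> a = 0"
    using o by (auto simp: orth3_def inner_commute)
  have "?d \<bullet> ?d = 1 + (golden - 1) * (golden - 1) + golden * golden"
    by (simp add: inner_add_left inner_add_right I)
  also have "\<dots> = 4" using golden_sq by (simp add: algebra_simps)
  finally have dd: "?d \<bullet> ?d = 4" .
  have rd: "refl ?d w = w - k *\<^sub>R ?d" if "?d \<bullet> w = 2 * k" for w k
    unfolding refl_def dd that by simp
  have gg: "golden *\<^sub>R golden *\<^sub>R v = golden *\<^sub>R v + v" for v :: 'a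
    using golden_sq by (simp add: scaleR_add_left)
  have 1: "refl ?d (a + golden *\<^sub>R b) = b - golden *\<^sub>R c"
  proof -
    have "?d \<bullet> (a + golden *\<^sub>R b) = 2 * 1" using golden_sq by (simp add: inner_add_left inner_add_right I algebra_simps)
    from rd[OF this] show ?thesis by (simp add: algebra_simps)
  qed
  have 2: "refl ?d (a - golden *\<^sub>R b) = a - golden *\<^sub>R b"
  proof -
    have "?d \<bullet> (a - golden *\<^sub>R b) = 2 * 0" using golden_sq by (simp add: inner_add_left inner_diff_right I algebra_simps)
    from rd[OF this] show ?thesis by simp
  qed
  have 3: "refl ?d (b + golden *\<^sub>R c) = - (c + golden *\<^sub>R a)"
  proof -
    have "?d \<bullet> (b + golden *\<^sub>R c) = 2 * golden" using golden_sq by (simp add: inner_add_left inner_add_right I algebra_simps)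
    from rd[OF this] show ?thesis using gg by (simp add: algebra_simps golden_sq)
  qed
  have 4: "refl ?d (b - golden *\<^sub>R c) = a + golden *\<^sub>R b"
  proof -
    have "?d \<bullet> (b - golden *\<^sub>R c) = 2 * (-1)" using golden_sq by (simp add: inner_add_left inner_diff_right I algebra_simps)
    from rd[OF this] show ?thesis by (simp add: algebra_simps)
  qed
  have 5: "refl ?d (c + golden *\<^sub>R a) = - (b + golden *\<^sub>R c)"
  proof -
    have "?d \<bullet> (c + golden *\<^sub>R a) = 2 * golden" using golden_sq by (simp add: inner_add_left inner_add_right I algebra_simps)
    from rd[OF this] show ?thesis using gg by (simp add: algebra_simps golden_sq)
  qed
  have 6: "refl ?d (c - golden *\<^sub>R a) = c - golden *\<^sub>R a"
  proof -
    have "?d \<bullet> (c - golden *\<^sub>R a) = 2 * 0" using golden_sq by (simp add: inner_add_left inner_diff_right I algebra_simps)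
    from rd[OF this] show ?thesis by simp
  qed
  have J: "r *\<^sub>R (a + golden *\<^sub>R b) \<in> icosa r a b c" "r *\<^sub>R (a - golden *\<^sub>R b) \<in> icosa r a b c"
    "r *\<^sub>R (b + golden *\<^sub>R c) \<in> icosa r a b c" "r *\<^sub>R (b - golden *\<^sub>R c) \<in> icosa r a b c"
    "r *\<^sub>R (c + golden *\<^sub>R a) \<in> icosa r a b c" "r *\<^sub>R (c - golden *\<^sub>R a) \<in> icosa r a b c"
    using icosa_I[where s = 1 and t = 1 and r = r and a = a and b = b and c = c]
      icosa_I[where s = 1 and t = "-1" and r = r and a = a and b = b and c = c] by auto
  have sc: "s *\<^sub>R w \<in> icosa r a b c" if "w \<in> icosa r a b c" "s = 1 \<or> s = -1" for s w
    using that icosa_uminus by auto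
  have L: "refl ?d (s *\<^sub>R r *\<^sub>R w) = s *\<^sub>R r *\<^sub>R refl ?d w" for s w
    by (simp only: linear_scale[OF refl_linear])
  show ?thesis
    using z
  proof (cases rule: icosa_cases)
    case s: (1 s)
    show ?thesis unfolding s(2) L 1 by (rule sc[OF J(4) s(1)])
  next
    case s: (2 s)
    show ?thesis unfolding s(2) L 2 by (rule sc[OF J(2) s(1)])
  next
    case s: (3 s)
    show ?thesis unfolding s(2) L 3 scaleR_minus_right using icosa_uminus[OF sc[OF J(5) s(1)]] by simp
  next
    case s: (4 s)
    show ?thesis unfolding s(2) L 4 by (rule sc[OF J(1) s(1)])
  next
    case s: (5 s)
    show ?thesis unfolding s(2) L 5 scaleR_minus_right using icosa_uminus[OF sc[OF J(3) s(1)]] by simp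
  next
    case s: (6 s)
    show ?thesis unfolding s(2) L 6 by (rule sc[OF J(6) s(1)])
  qed
qed

lemma icosa_refl_edge':
  assumes o: "orth3 a b c" and X: "icosa r a b c = X" and d: "d = k *\<^sub>R (a + (golden - 1) *\<^sub>R b + golden *\<^sub>R c)" "k \<noteq> 0"
    and z: "z \<in> X"
  shows "refl d z \<in> X"
  using icosa_refl_edge[OF o, of z r] z X refl_scaleR[OF d(2)] unfolding d(1) by metis

lemma icosa_refl_axis':
  assumes o: "orth3 a b c" and X: "icosa r a b c = X" and d: "d = k *\<^sub>R a + k *\<^sub>R a" "k \<noteq> 0" and z: "z \<in> X"
  shows "refl d z \<in> X"
proof -
  have "d = (2 * k) *\<^sub>R a" unfolding d(1) by (simp flip: scaleR_2)
  then have "refl d = refl a" using refl_scaleR[of "2 * k" a] d(2) by simp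
  then show ?thesis using icosa_refl_axis[OF o, of z r] z X by simp
qed

text \<open>With x in standard position, every difference is a multiple of twice a coordinate axis
  or of the vector of \<open>icosa_refl_edge\<close> in another frame of the same icosahedron. The
  factor is r for adjacent vertices and r * golden for the others.\<close>

lemma icosa_swap:
  assumes o: "orth3 a b c" and r: "r > 0" and x: "x \<in> icosa r a b c" and y: "y \<in> icosa r a b c"
    and ne: "x \<noteq> y" "x \<noteq> - y" and z: "z \<in> icosa r a b c"
  shows "refl (x - y) z \<in> icosa r a b c"
proof -
  obtain a' b' c' where o': "orth3 a' b' c'" and X: "icosa r a' b' c' = icosa r a b c"
    and x': "x = r *\<^sub>R (a' + golden *\<^sub>R b')"
    using icosa_frame[OF o x] .
  let ?X = "icosa r a b c"
  have g: "golden \<noteq> 0" using golden_bounds by simp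
  have o2: "orth3 b' c' a'" "orth3 c' a' b'" using orth3_cycle o' by blast+
  have X2: "icosa r b' c' a' = ?X" "icosa r c' a' b' = ?X" using X icosa_cycle by metis+
  have sgn_c: "orth3 (s *\<^sub>R c') a' b'" "icosa r (s *\<^sub>R c') a' b' = ?X" if "s = 1 \<or> s = -1" for s
    using that o2(2) X2(2) orth3_minus[OF o2(2)] icosa_minus_first[of r c' a' b'] by auto
  have sgn_ca: "orth3 (s *\<^sub>R c') (- a') b'" "icosa r (s *\<^sub>R c') (- a') b' = ?X" if "s = 1 \<or> s = -1" for s
  proof -
    have 1: "orth3 a' b' (s *\<^sub>R c')" using sgn_c(1)[OF that] orth3_cycle by blast
    have 2: "icosa r a' b' (s *\<^sub>R c') = ?X" using sgn_c(2)[OF that] icosa_cycle by metis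
    have 3: "orth3 (- a') b' (s *\<^sub>R c')" using orth3_minus[OF 1] .
    have 4: "icosa r (- a') b' (s *\<^sub>R c') = ?X" using 2 icosa_minus_first by metis
    show "orth3 (s *\<^sub>R c') (- a') b'" using orth3_cycle[OF orth3_cycle[OF 3]] .
    show "icosa r (s *\<^sub>R c') (- a') b' = ?X" using 4 icosa_cycle by metis
  qed
  have sgn_cyc: "orth3 a' b' (s *\<^sub>R c')" "icosa r a' b' (s *\<^sub>R c') = ?X" 
     "orth3 b' (s *\<^sub>R c') a'" "icosa r b' (s *\<^sub>R c') a' = ?X" if "s = 1 \<or> s = -1" for s
    using sgn_c[OF that] orth3_cycle icosa_cycle by metis+
  have "y \<in> icosa r a' b' c'" using y X by simp
  then show ?thesis
  proof (cases rule: icosa_cases)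
    case s: (1 s)
    then show ?thesis using ne x' by auto
  next
    case s: (2 s)
    show ?thesis
    proof (cases "s = 1")
      case True
      have d: "x - y = (r * golden) *\<^sub>R b' + (r * golden) *\<^sub>R b'" unfolding x' s(2) True by (simp add: algebra_simps)
      then show ?thesis using icosa_refl_axis'[OF o2(1) X2(1) _ _ z, of "x - y" "r * golden"] r g by simp
    next
      case False
      then have "s = -1" using s(1) by simp
      have d: "x - y = r *\<^sub>R a' + r *\<^sub>R a'" unfolding x' s(2) \<open>s = -1\<close> by (simp add: algebra_simps)
      then show ?thesis using icosa_refl_axis'[OF o' X _ _ z, of "x - y" r] r by simp
    qed
  next
    case s: (3 s)
    show ?thesis
    proof (cases "s = 1")
      case True
      have d: "x - y = r *\<^sub>R (a' + (golden - 1) *\<^sub>R b' + golden *\<^sub>R ((-1) *\<^sub>R c'))" unfolding x' s(2) True by (simp add: algebra_simps)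
      then show ?thesis using icosa_refl_edge'[OF sgn_cyc(1,2) _ _ z, OF _ _ d] r by simp
    next
      case False
      then have "s = -1" using s(1) by simp
      \<comment> \<open>The inverse of \<open>golden\<close> is golden - 1, which becomes the middle
        coefficient once the factor is taken out.\<close>
      have d: "x - y = (r * golden) *\<^sub>R (1 *\<^sub>R c' + (golden - 1) *\<^sub>R a' + golden *\<^sub>R b')"
        unfolding x' s(2) \<open>s = -1\<close> by (simp add: algebra_simps golden_sq golden_sq_mult)
      then show ?thesis using icosa_refl_edge'[OF sgn_c _ _ z, OF _ _ d] r g by simp
    qed
  next
    case s: (4 s)
    show ?thesis
    proof (cases "s = 1")
      case True
      have d: "x - y = r *\<^sub>R (a' + (golden - 1) *\<^sub>R b' + golden *\<^sub>R (1 *\<^sub>R c'))" unfolding x' s(2) True by (simp add: algebra_simps)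
      then show ?thesis using icosa_refl_edge'[OF sgn_cyc(1,2) _ _ z, OF _ _ d] r by simp
    next
      case False
      then have "s = -1" using s(1) by simp
      have d: "x - y = (r * golden) *\<^sub>R ((-1) *\<^sub>R c' + (golden - 1) *\<^sub>R a' + golden *\<^sub>R b')"
        unfolding x' s(2) \<open>s = -1\<close> by (simp add: algebra_simps golden_sq golden_sq_mult)
      then show ?thesis using icosa_refl_edge'[OF sgn_c _ _ z, OF _ _ d] r g by simp
    qed
  next
    case s: (5 s)
    show ?thesis
    proof (cases "s = 1")
      case True
      have d: "x - y = r *\<^sub>R ((-1) *\<^sub>R c' + (golden - 1) *\<^sub>R (- a') + golden *\<^sub>R b')" unfolding x' s(2) True by (simp add: algebra_simps)
      then show ?thesis using icosa_refl_edge'[OF sgn_ca _ _ z, OF _ _ d] r by simp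
    next
      case False
      then have "s = -1" using s(1) by simp
      have d: "x - y = (r * golden) *\<^sub>R (b' + (golden - 1) *\<^sub>R (1 *\<^sub>R c') + golden *\<^sub>R a')"
        unfolding x' s(2) \<open>s = -1\<close> by (simp add: algebra_simps golden_sq golden_sq_mult)
      then show ?thesis using icosa_refl_edge'[OF sgn_cyc(3,4) _ _ z, OF _ _ d] r g by simp
    qed
  next
    case s: (6 s)
    show ?thesis
    proof (cases "s = 1")
      case True
      have d: "x - y = (r * golden) *\<^sub>R (b' + (golden - 1) *\<^sub>R ((-1) *\<^sub>R c') + golden *\<^sub>R a')"
        unfolding x' s(2) True by (simp add: algebra_simps golden_sq golden_sq_mult)
      then show ?thesis using icosa_refl_edge'[OF sgn_cyc(3,4) _ _ z, OF _ _ d] r g by simp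
    next
      case False
      then have "s = -1" using s(1) by simp
      have d: "x - y = r *\<^sub>R (1 *\<^sub>R c' + (golden - 1) *\<^sub>R (- a') + golden *\<^sub>R b')" unfolding x' s(2) \<open>s = -1\<close> by (simp add: algebra_simps)
      then show ?thesis using icosa_refl_edge'[OF sgn_ca _ _ z, OF _ _ d] r by simp
    qed
  qed
qed

text \<open>Reflection in a vertex sends an adjacent one to a point with first coordinate -2 r
  golden/(golden + 2), a value that no vertex has as a coordinate.\<close>

lemma icosa_not_refl:
  assumes o: "orth3 a b c" and r: "r > 0" and x: "x \<in> icosa r a b c"
  shows "\<exists>z\<in>icosa r a b c. refl x z \<notin> icosa r a b c"
proof -
  obtain a' b' c' where o': "orth3 a' b' c'" and X: "icosa r a' b' c' = icosa r a b c"
    and x': "x = r *\<^sub>R (a' + golden *\<^sub>R b')"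
    using icosa_frame[OF o x] .
  have I: "a' \<bullet> a' = 1" "b' \<bullet> b' = 1" "c' \<bullet> c' = 1" "a' \<bullet> b' = 0" "b' \<bullet> a' = 0" "b' \<bullet> c' = 0" "c' \<bullet> b' = 0" "a' \<bullet> c' = 0" "c' \<bullet> a' = 0"
    using o' by (auto simp: orth3_def inner_commute)
  let ?w = "a' + golden *\<^sub>R b'" and ?z = "r *\<^sub>R (b' + golden *\<^sub>R c')"
  have ww: "?w \<bullet> ?w = golden + 2" using golden_sq by (simp add: inner_add_left inner_add_right I)
  have wz: "?w \<bullet> ?z = r * golden" by (simp add: inner_add_left inner_add_right I)
  have rz: "refl x ?z = ?z - (2 * (r * golden) / (golden + 2)) *\<^sub>R ?w"
    unfolding x' using r by (simp add: refl_scaleR) (simp only: refl_def ww wz)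
  have coord: "refl x ?z \<bullet> a' = - (2 * (r * golden) / (golden + 2))"
    unfolding rz by (simp add: inner_diff_left inner_add_left I)
  have "z \<bullet> a' \<in> {0, r, - r, r * golden, - (r * golden)}" if "z \<in> icosa r a' b' c'" for z
    using that by (cases rule: icosa_cases) (auto simp: inner_add_left inner_diff_left I)
  moreover have "- (2 * (r * golden) / (golden + 2)) \<notin> {0, r, - r, r * golden, - (r * golden)}"
  proof -
    let ?k = "2 * (r * golden) / (golden + 2)"
    have k: "0 < ?k" "0 < r * golden" using r golden_bounds by simp_all
    have "?k \<noteq> r"
    proof
      assume "?k = r"
      then have "r * (2 * golden) = r * (golden + 2)" using golden_bounds by (simp add: field_simps)
      then have "2 * golden = golden + 2" using r by (simp only: mult_cancel_left) simp
      then show False using golden_bounds by simp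
    qed
    moreover have "?k \<noteq> r * golden"
    proof
      assume "?k = r * golden"
      then have "(r * golden) * 2 = (r * golden) * (golden + 2)" using golden_bounds by (simp add: field_simps)
      moreover have "r * golden \<noteq> 0" using k by linarith
      ultimately have "2 = golden + 2" using mult_left_cancel by blast
      then show False using golden_bounds by simp
    qed
    moreover have "- K \<notin> {0, r, - r, r * golden, - (r * golden)}"
      if "0 < K" "0 < r * golden" "K \<noteq> r" "K \<noteq> r * golden" for K
      using that r by auto
    ultimately show ?thesis using k by blast
  qed
  ultimately have "refl x ?z \<notin> icosa r a' b' c'" using coord by metis
  moreover have "?z \<in> icosa r a' b' c'" using icosa_I(2)[of 1 1 r b' c' a'] by simp
  ultimately show ?thesis using X by metis
qed

text \<open>The six vertices with golden coordinate of positive sign are told apart by their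
  coordinates.\<close>

lemma card_icosa:
  assumes o: "orth3 a b c" and r: "r > 0"
  shows "6 \<le> card (icosa r a b c)"
proof -
  let ?f = "\<lambda>v. (v \<bullet> a, v \<bullet> b, v \<bullet> c)" and ?X = "icosa r a b c"
  let ?T = "{(r, r * golden, 0), (- r, r * golden, 0), (0, r, r * golden), (0, - r, r * golden),
    (r * golden, 0, r), (r * golden, 0, - r)}"
  have I: "a \<bullet> a = 1" "b \<bullet> b = 1" "c \<bullet> c = 1" "a \<bullet> b = 0" "b \<bullet> a = 0" "b \<bullet> c = 0" "c \<bullet> b = 0" "a \<bullet> c = 0" "c \<bullet> a = 0"
    using o by (auto simp: orth3_def inner_commute)
  have f: "?f (r *\<^sub>R (s *\<^sub>R a + golden *\<^sub>R b)) = (r * s, r * golden, 0)"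
    "?f (r *\<^sub>R (s *\<^sub>R b + golden *\<^sub>R c)) = (0, r * s, r * golden)"
    "?f (r *\<^sub>R (s *\<^sub>R c + golden *\<^sub>R a)) = (r * golden, 0, r * s)" for s
    by (simp_all add: inner_add_left I)
  have "(r * s, r * golden, 0) \<in> ?f ` ?X \<and> (0, r * s, r * golden) \<in> ?f ` ?X \<and> (r * golden, 0, r * s) \<in> ?f ` ?X"
    if "s = 1 \<or> s = -1" for s
  proof -
    have "r *\<^sub>R (s *\<^sub>R a + golden *\<^sub>R b) \<in> ?X" "r *\<^sub>R (s *\<^sub>R b + golden *\<^sub>R c) \<in> ?X"
      "r *\<^sub>R (s *\<^sub>R c + golden *\<^sub>R a) \<in> ?X"
      using that unfolding icosa_def by blast+
    from imageI[OF this(1), of ?f] imageI[OF this(2), of ?f] imageI[OF this(3), of ?f]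
    show ?thesis unfolding f by blast
  qed
  from this[of 1] this[of "-1"] have "?T \<subseteq> ?f ` ?X" by simp
  moreover have "finite ?X" by (simp add: icosa_def)
  ultimately have "card ?T \<le> card ?X" by (rule surj_card_le[rotated])
  moreover have "card ?T = 6" using r golden_bounds by simp
  ultimately show ?thesis by simp
qed

lemma type_H3_orbit:
  fixes W :: "('a::euclidean_space \<Rightarrow> 'a) set"
  assumes H: "type_H3 W Orb"
  shows "spherical_orbit W Orb \<and> swappable W Orb"
proof -
  obtain e r where dim: "DIM('a) = 3" and e: "orthonormal_frame 3 e" and r: "r > 0"
    and Orb: "Orb = icosa r (e 1) (e 2) (e 3)" and W: "W = symmetry_group Orb"
    using H unfolding type_H3_def regular_icosahedron_vertices_def icosa_def golden_def by blast
  have E: "e i \<bullet> e j = (if i = j then 1 else 0)" if "i \<in> {1..3}" "j \<in> {1..3}" for i j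
    using e that by (auto simp: orthonormal_frame_def)
  have o: "orth3 (e 1) (e 2) (e 3)" using E by (simp add: orth3_def)
  have "refl (x - y) \<in> W" if "x \<in> Orb" "y \<in> Orb" "x \<noteq> y" "x \<noteq> - y" for x y
    unfolding W by (rule refl_symmetry_group) (use icosa_swap[OF o r] that Orb in blast)
  moreover have "refl x \<notin> W" if x: "x \<in> Orb" for x
    using icosa_not_refl[OF o r] x unfolding W symmetry_group_def Orb by blast
  moreover have "- x \<in> Orb" if "x \<in> Orb" for x using icosa_uminus that Orb by blast
  moreover have "6 \<le> card Orb" unfolding Orb by (rule card_icosa[OF o r])
  ultimately have "swappable W Orb" by (simp add: swappable_def)
  moreover have "norm x = r * sqrt (golden + 2)" if x_in: "x \<in> Orb" for x
  proof -
    obtain a b c where o': "orth3 a b c" and x: "x = r *\<^sub>R (a + golden *\<^sub>R b)"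
      using icosa_frame[OF o x_in[unfolded Orb]] by blast
    have "(a + golden *\<^sub>R b) \<bullet> (a + golden *\<^sub>R b) = golden + 2"
      using o' golden_sq by (simp add: orth3_def inner_add_left inner_add_right inner_commute)
    then show ?thesis unfolding x using r by (simp add: norm_eq_sqrt_inner real_sqrt_mult)
  qed
  moreover have "v = 0" if v: "\<forall>x\<in>Orb. v \<bullet> x = 0" for v
  proof (rule orthonormal_total[OF dim e])
    \<comment> \<open>Two vertices that differ in the sign of one coordinate add up to a nonzero
      multiple of the other axis.\<close>
    have z: "v \<bullet> b = 0" if "\<And>s. s = 1 \<or> s = -1 \<Longrightarrow> r *\<^sub>R (s *\<^sub>R a + (1 * golden) *\<^sub>R b) \<in> Orb" for a b
    proof -
      have "v \<bullet> (r *\<^sub>R (1 *\<^sub>R a + (1 * golden) *\<^sub>R b)) = 0" "v \<bullet> (r *\<^sub>R ((-1) *\<^sub>R a + (1 * golden) *\<^sub>R b)) = 0"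
        using v that by blast+
      then show ?thesis using r golden_bounds by (auto simp: inner_add_right inner_diff_right)
    qed
    fix i :: nat assume "i \<in> {1..3}"
    then have "i = 1 \<or> i = 2 \<or> i = 3" by auto
    then show "v \<bullet> e i = 0"
      using z[of "e 3" "e 1"] z[of "e 1" "e 2"] z[of "e 2" "e 3"] icosa_I[where t = 1 and r = r and a = "e 1" and b = "e 2" and c = "e 3"] unfolding Orb by blast
  qed
  moreover have "finite Orb" by (simp add: Orb icosa_def)
  moreover have "w ` Orb \<subseteq> Orb" if "w \<in> W" for w using that by (simp add: W symmetry_group_def)
  ultimately show ?thesis by (simp add: spherical_orbit_def)
qed

section \<open>The main theorem\<close>

theorem mainTheorem5:
  fixes W :: "('a::euclidean_space \<Rightarrow> 'a) set"
    and Orb \<Phi> :: "'a set"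
    and D :: "pm \<Rightarrow> 'a set"
    and c :: "'a \<Rightarrow> real"
    and \<omega> :: "'a \<Rightarrow> 'a"
    and \<beta>1 \<beta>2 :: 'a
    and C1 C2 :: "'a lpoint set set"
  assumes "(\<exists>n\<ge>2. type_A n W Orb) \<or> (\<exists>n\<ge>2. type_B n W Orb) \<or> (\<exists>n\<ge>4. type_D n W Orb) \<or>
           (\<exists>m\<ge>3. type_I2 m W Orb) \<or> type_H3 W Orb"
    and "root_system_for W \<Phi>"
    and "simple_roots \<Phi> (simples D)"
    and "diagram_bipartition D"
    and "positive_smallest_eigenvector (simples D) c"
    and "dual_basis (simples D) \<omega>"
    and "\<beta>1 \<in> almost_positive_roots \<Phi> (simples D)"
    and "\<beta>2 \<in> almost_positive_roots \<Phi> (simples D)"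
    and "\<beta>1 \<noteq> \<beta>2"
    and "is_diagram D c \<omega> Orb \<beta>1 C1"
    and "is_diagram D c \<omega> Orb \<beta>2 C2"
  shows "compatible \<Phi> D \<beta>1 \<beta>2 \<longleftrightarrow>
           (\<forall>s\<in>C1. \<forall>t\<in>C2. segments_cross s t \<longrightarrow> unlabeled s = unlabeled t) \<and>
           (\<forall>s\<in>C1. \<forall>t\<in>C2. same_origin_point s t \<longrightarrow>
              collinear (unlabeled s \<union> unlabeled t) \<or>
              \<not> union_crosses_gray_zone (coxeter_number D) s t)"
proof -
  have "spherical_orbit W Orb \<and> swappable W Orb"
    using assms(1) type_A_orbit type_B_orbit type_D_orbit type_I2_orbit type_H3_orbit by blast
  then have S: "spherical_orbit W Orb" and swap: "swappable W Orb" by auto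
  interpret root_orbit W \<Phi> D Orb
  proof unfold_locales
    show "finite Orb" using S unfolding spherical_orbit_def by blast
    show "norm x = norm y" if "x \<in> Orb" "y \<in> Orb" for x y
      using S that unfolding spherical_orbit_def by blast
    show "refl \<beta> x \<in> Orb" if "refl \<beta> \<in> W" "x \<in> Orb" for \<beta> x
      using S that unfolding spherical_orbit_def by blast
    show "v = 0" if "\<And>x. x \<in> Orb \<Longrightarrow> v \<bullet> x = 0" for v
      using S that unfolding spherical_orbit_def by blast
  qed (rule assms)+
  have "\<exists>N M x Q e. snake W \<Phi> D Orb N M x Q e"
    using swap unfolding swappable_def
  proof
    assume "(\<forall>x\<in>Orb. \<forall>y\<in>Orb. x \<noteq> y \<longrightarrow> refl (x - y) \<in> W) \<and> 3 \<le> card Orb"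
    then show ?thesis using chain_snake by blast
  next
    assume "(\<forall>x\<in>Orb. - x \<in> Orb \<and> refl x \<notin> W) \<and>
      (\<forall>x\<in>Orb. \<forall>y\<in>Orb. x \<noteq> y \<and> x \<noteq> - y \<longrightarrow> refl (x - y) \<in> W) \<and> 6 \<le> card Orb"
    then show ?thesis using origin_snake by blast
  qed
  then obtain N M x Q e where "snake W \<Phi> D Orb N M x Q e" by blast
  then interpret snake W \<Phi> D Orb N M x Q e .
  interpret snake_plane W \<Phi> D Orb N M x Q e c \<omega>
    by unfold_locales (rule assms)+
  show ?thesis
    using compatible_iff_good[OF assms(7-11)] unfolding good_def .
qed

end
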